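(* Let $\omega\subset\mathbb{R}^2$ be a bounded Lipschitz domain and let $v:\omega\to\mathbb{R}^2$ be a piecewise affine Lipschitz map such that $$\operatorname{tr}\nabla v=0\ \text{ a.e. in }\omega,\qquad \operatorname*{ess\,sup}_{\omega}|e(v)|<\frac{3}{2\sqrt2}.\qquad( * )$$ Then for every $\varepsilon>0$ there exists $u_\varepsilon\in W^{1,\infty}(\omega;\mathbb{R}^2)$ such that $$\tilde V(e(u_\varepsilon))=0\ \text{ a.e. in }\omega,\qquad u_\varepsilon=v\ \text{ on }\partial\omega,$$ and $\|u_\varepsilon-v\|_\infty\leq\varepsilon$. The same result holds if, instead of being piecewise affine and Lipschitz, $v\in C^{1,\alpha}(\overline{\omega};\mathbb{R}^2)$ for some $0<\alpha<1$ and $v$ satisfies $( * )$.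
   Context: For $u:\omega\to\mathbb{R}^2$, $e(u):=\frac12(\nabla u+(\nabla u)^T)$. $Sym_0(2)$ is the set of symmetric real $2\times2$ matrices with zero trace, and $|\cdot|$ is the Euclidean (Frobenius) norm on matrices. Set $$\tilde U_n:=\frac34(2\,n\otimes n-I)\ \ (n\in S^1),\qquad \tilde{\mathcal U}:=\{\tilde U_n:n\in S^1\}=\left\{\tilde E\in Sym_0(2):|\tilde E|=\frac{3}{2\sqrt2}\right\},$$ and define $\tilde V:Sym_0(2)\to\mathbb{R}$ by $\tilde V(\tilde E):=\min_{U\in\tilde{\mathcal U}}|\tilde E-U|^2$. The condition $\tilde V(e(u))=0$ a.e. includes the requirement $\operatorname{div}u=0$ a.e. A map $y:\omega\to\mathbb{R}^m$ is called piecewise affine if it is continuous and there exist countably many mutually disjoint Lipschitz domains $\omega_i\subseteq\omega$ such that $y|_{\omega_i}$ is affine for every $i$ and $|\omega\setminus\bigcup_i\omega_i|=0$ (Lebesgue measure). Lipschitz maps are identified with their continuous extensions to the closure; $\|\cdot\|_\infty$ is the $L^\infty$ norm. *)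

theory Defs
  imports "HOL-Analysis.Analysis" "HOL-Probability.Essential_Supremum"
begin

text \<open>Throughout, maps on a set \<open>\<omega>\<close> are total functions whose values outside \<open>\<omega>\<close> are irrelevant, and
  the norm on \<^typ>\<open>real^2^2\<close> is the Frobenius norm.\<close>

section \<open>Lipschitz domains and classes of maps\<close>

text \<open>Near each boundary point the set is the strict epigraph of a Lipschitz function, in the
  orthonormal coordinates centred at that point given by \<open>a\<close> and \<open>b\<close>.\<close>

definition lipschitz_domain :: "(real^2) set \<Rightarrow> bool" where
  "lipschitz_domain D \<longleftrightarrow> open D \<and> connected D \<and> D \<noteq> {} \<and>
     (\<forall>p\<in>frontier D. \<exists>(r::real) (a::real^2) (b::real^2) (\<gamma>::real \<Rightarrow> real) (L::real).
        r > 0 \<and> norm a = 1 \<and> norm b = 1 \<and> a \<bullet> b = 0 \<and> L-lipschitz_on UNIV \<gamma> \<and>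
        D \<inter> ball p r = {x. \<gamma> ((x - p) \<bullet> a) < (x - p) \<bullet> b} \<inter> ball p r)"

definition piecewise_affine :: "(real^2) set \<Rightarrow> (real^2 \<Rightarrow> real^'m) \<Rightarrow> bool" where
  "piecewise_affine \<omega> y \<longleftrightarrow> continuous_on \<omega> y \<and>
     (\<exists>P. countable P \<and> disjoint P \<and> (\<forall>W\<in>P. lipschitz_domain W \<and> W \<subseteq> \<omega>) \<and>
        (\<forall>W\<in>P. \<exists>A b. \<forall>x\<in>W. y x = A *v x + b) \<and>
        negligible (\<omega> - \<Union>P))"

text \<open>\<open>C\<^sup>1\<^sup>,\<^sup>\<alpha>\<close> up to the boundary, for bounded \<open>\<omega>\<close>: the map and its classical gradient extend
  continuously to the closure, and the extended gradient is Hoelder continuous there.\<close>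

definition C1_holder :: "(real^2) set \<Rightarrow> real \<Rightarrow> (real^2 \<Rightarrow> real^2) \<Rightarrow> bool" where
  "C1_holder \<omega> \<alpha> v \<longleftrightarrow> (\<exists>w G.
     continuous_on (closure \<omega>) w \<and> continuous_on (closure \<omega>) G \<and>
     (\<forall>x\<in>\<omega>. w x = v x \<and> (v has_derivative (\<lambda>h. G x *v h)) (at x)) \<and>
     (\<exists>C. \<forall>x\<in>closure \<omega>. \<forall>y\<in>closure \<omega>. norm (G x - G y) \<le> C * dist x y powr \<alpha>))"

section \<open>Weak gradients and the Sobolev space of order one with exponent infinity\<close>

definition partial_deriv :: "2 \<Rightarrow> (real^2 \<Rightarrow> real) \<Rightarrow> real^2 \<Rightarrow> real" where
  "partial_deriv j \<phi> x = frechet_derivative \<phi> (at x) (axis j 1)"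

text \<open>Test functions are \<open>C\<^sup>1\<close> with compact support, as in Evans and Gariepy, \<open>Measure Theory and
  Fine Properties of Functions\<close>. By mollification, smooth test functions define the same weak
  gradients.\<close>

definition test_function :: "(real^2) set \<Rightarrow> (real^2 \<Rightarrow> real) \<Rightarrow> bool" where
  "test_function \<omega> \<phi> \<longleftrightarrow>
     (\<forall>x. \<phi> differentiable (at x)) \<and> (\<forall>j. continuous_on UNIV (partial_deriv j \<phi>)) \<and>
     compact (closure {x. \<phi> x \<noteq> 0}) \<and> closure {x. \<phi> x \<noteq> 0} \<subseteq> \<omega>"

definition locally_integrable :: "(real^2) set \<Rightarrow> (real^2 \<Rightarrow> 'b::euclidean_space) \<Rightarrow> bool" where
  "locally_integrable \<omega> f \<longleftrightarrow> (\<forall>K. compact K \<and> K \<subseteq> \<omega> \<longrightarrow> set_integrable lebesgue K f)"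

definition has_weak_gradient ::
    "(real^2) set \<Rightarrow> (real^2 \<Rightarrow> real^2) \<Rightarrow> (real^2 \<Rightarrow> real^2^2) \<Rightarrow> bool" where
  "has_weak_gradient \<omega> u G \<longleftrightarrow> locally_integrable \<omega> u \<and> locally_integrable \<omega> G \<and>
     (\<forall>\<phi> i j. test_function \<omega> \<phi> \<longrightarrow>
        (LINT x:\<omega>|lebesgue. u x $ i * partial_deriv j \<phi> x)
          = - (LINT x:\<omega>|lebesgue. G x $ i $ j * \<phi> x))"

text \<open>The weak gradient is unique up to null sets, so it does not matter which representative is
  chosen. It is unspecified if \<open>u\<close> has no weak gradient.\<close>

definition weak_gradient :: "(real^2) set \<Rightarrow> (real^2 \<Rightarrow> real^2) \<Rightarrow> real^2 \<Rightarrow> real^2^2" where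
  "weak_gradient \<omega> u = (SOME G. has_weak_gradient \<omega> u G)"

definition Linf_norm :: "(real^2) set \<Rightarrow> (real^2 \<Rightarrow> 'b::euclidean_space) \<Rightarrow> ereal" where
  "Linf_norm \<omega> f = esssup (lebesgue_on \<omega>) (\<lambda>x. ereal (norm (f x)))"

definition Linf :: "(real^2) set \<Rightarrow> (real^2 \<Rightarrow> 'b::euclidean_space) set" where
  "Linf \<omega> = {f. f \<in> borel_measurable (lebesgue_on \<omega>) \<and> Linf_norm \<omega> f < \<infinity>}"

definition W1inf :: "(real^2) set \<Rightarrow> (real^2 \<Rightarrow> real^2) set" where
  "W1inf \<omega> = {u. u \<in> Linf \<omega> \<and> (\<exists>G. has_weak_gradient \<omega> u G \<and> G \<in> Linf \<omega>)}"

text \<open>Boundary values are those of the continuous extension to the closure; elements of \<open>W1inf\<close> are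
  only determined almost everywhere, hence the passage to a continuous representative. For open
  \<open>\<omega>\<close> the extensions are unique.\<close>

definition boundary_eq ::
    "(real^2) set \<Rightarrow> (real^2 \<Rightarrow> real^2) \<Rightarrow> (real^2 \<Rightarrow> real^2) \<Rightarrow> bool" where
  "boundary_eq \<omega> u v \<longleftrightarrow> (\<exists>u' v'.
     continuous_on (closure \<omega>) u' \<and> continuous_on (closure \<omega>) v' \<and>
     (AE x in lebesgue_on \<omega>. u' x = u x) \<and> (AE x in lebesgue_on \<omega>. v' x = v x) \<and>
     (\<forall>x\<in>frontier \<omega>. u' x = v' x))"

section \<open>Strain and energy\<close>

definition strain :: "(real^2) set \<Rightarrow> (real^2 \<Rightarrow> real^2) \<Rightarrow> real^2 \<Rightarrow> real^2^2" where
  "strain \<omega> u x = (1/2) *\<^sub>R (weak_gradient \<omega> u x + transpose (weak_gradient \<omega> u x))"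

definition Sym0 :: "(real^2^2) set" where
  "Sym0 = {E. transpose E = E \<and> trace E = 0}"

definition Umat :: "real^2 \<Rightarrow> real^2^2" where
  "Umat n = (3/4) *\<^sub>R (2 *\<^sub>R (\<chi> i j. n $ i * n $ j) - mat 1)"

definition Uset :: "(real^2^2) set" where
  "Uset = Umat ` sphere 0 1"

text \<open>The infimum is a minimum, see \<open>Vt_attained\<close> below. The function is only meant to be evaluated
  on \<open>Sym0\<close>.\<close>

definition Vt :: "real^2^2 \<Rightarrow> real" where
  "Vt E = (INF U\<in>Uset. (norm (E - U))\<^sup>2)"

lemma Vt_attained: "\<exists>U\<in>Uset. Vt E = (norm (E - U))\<^sup>2 \<and> (\<forall>U'\<in>Uset. Vt E \<le> (norm (E - U'))\<^sup>2)"
proof -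
  have "continuous_on (sphere 0 1) Umat"
    unfolding Umat_def by (intro continuous_intros)
  then have "compact Uset"
    unfolding Uset_def by (intro compact_continuous_image) auto
  moreover have "axis 1 1 \<in> sphere (0::real^2) 1" by simp
  then have "Uset \<noteq> {}" unfolding Uset_def by blast
  moreover have "continuous_on Uset (\<lambda>U. (norm (E - U))\<^sup>2)" by (intro continuous_intros)
  ultimately obtain U where U: "U \<in> Uset" "\<forall>U'\<in>Uset. (norm (E - U))\<^sup>2 \<le> (norm (E - U'))\<^sup>2"
    using continuous_attains_inf by blast
  then have "Vt E = (norm (E - U))\<^sup>2"
    unfolding Vt_def by (intro cInf_eq_minimum) auto
  with U show ?thesis by auto
qed

end

theory Submission
  imports Defs
begin

text \<open>The statement is a differential inclusion, and it is solved by direct convex integration. Write \<open>z\<close>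
  for the trace-free symmetric part of a matrix \<open>A\<close>, as a complex number (\<open>dev\<close>), and \<open>s\<close> for its
  skew part, a real number (\<open>skw\<close>). A trace-free matrix is a point \<open>(z, s)\<close> of a three-dimensional
  space, its strain has norm \<open>sqrt 2 * \<bar>z\<bar>\<close>, and the target is the cylinder \<open>\<bar>z\<bar> = 3/4\<close>; by hypothesis
  the gradient of \<open>v\<close> stays strictly inside. A trace-free matrix has rank at most one if and only if
  \<open>\<bar>z\<bar> = \<bar>s\<bar>\<close>. Rank-one lines are therefore the null lines of Minkowski space, and they move \<open>z\<close> in any
  prescribed direction.

  The limit of the construction is Lipschitz only if the skew parts stay bounded. This is achieved by
  the choice of the region \<open>admissible\<close>: \<open>\<bar>z\<bar> < 3/4\<close> and \<open>\<bar>s\<bar> < \<bar>z\<bar> + C\<close>. Its lateral boundary is made of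
  light cones, which are ruled by null lines, and around each of its points the region contains a
  segment on which \<open>z\<close> moves radially by up to \<open>(3/4 - \<bar>z\<bar>) / 2\<close> and \<open>s\<close> by the same amount
  (\<open>ex_rank_one_segment\<close>).

  Such a segment is realised on a ball by the rotated gradient of a localised plane wave of high
  frequency (\<open>wave_on_ball\<close>). This perturbation is divergence free and uniformly small, its gradient
  is close to the segment, and the mean square of its gradient is at least a fixed multiple of the
  squared length of the segment. Distributing waves over disjoint balls gives a perturbation \<open>\<eta>\<close> with gradient
  \<open>H\<close> of any field with admissible gradient, such that the squared deficit
  \<open>(3/4 - \<bar>z\<bar>)\<^sup>2\<close> has integral at most \<open>800\<close> times that of \<open>\<bar>H\<bar>\<^sup>2\<close> (\<open>ex_perturbation_step\<close>).

  The step is iterated. The gradient of a uniformly small perturbation, being bounded, is almost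
  orthogonal to everything fixed before, so the squared \<open>L\<^sup>2\<close> norms of the successive gradients form an almost
  increasing sequence; it is bounded because the region is. Hence the gradients form a Cauchy sequence
  in \<open>L\<^sup>2\<close>, their increments tend to zero, and with the increments the deficit. The limit solves the
  inclusion (\<open>exact_perturbation\<close>).

  Both classes of data reduce to one situation, treated in \<open>attainment_for_C1_data\<close>: \<open>v\<close> is \<open>C\<^sup>1\<close> on an
  open set of full measure, and the classical gradient there is the weak gradient on \<open>\<omega>\<close>. That an
  arbitrarily chosen weak gradient may be replaced by the classical one is the fundamental lemma of the
  calculus of variations.\<close>

section \<open>Integration by parts and weak smallness\<close>

lemma integrable_scaled_indicator:
  "K \<in> lmeasurable \<Longrightarrow> integrable lebesgue (\<lambda>x. (B::real) * indicat_real K x)"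
  by (intro integrable_mult_right) (auto simp: fmeasurable_def)

lemma integrable_bounded_support:
  fixes f :: "'a::euclidean_space \<Rightarrow> 'b::euclidean_space"
  assumes "f \<in> borel_measurable lebesgue" and "K \<in> lmeasurable"
    and "\<And>x. norm (f x) \<le> B" and "\<And>x. x \<notin> K \<Longrightarrow> f x = 0"
  shows "integrable lebesgue f"
proof (rule Bochner_Integration.integrable_bound)
  show "integrable lebesgue (\<lambda>x. B * indicat_real K x)"
    using assms(2) by (rule integrable_scaled_indicator)
  show "AE x in lebesgue. norm (f x) \<le> norm (B * indicat_real K x)"
    using assms(3,4) by (intro AE_I2) (auto simp: indicator_def intro: order_trans[OF _ abs_ge_self])
qed fact

lemma borel_measurable_lebesgue_continuous:
  fixes f :: "'a::euclidean_space \<Rightarrow> 'b::euclidean_space"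
  assumes "continuous_on UNIV f"
  shows "f \<in> borel_measurable lebesgue"
  using borel_measurable_continuous_onI[OF assms] by (simp add: measurable_completion)

lemma indicator_continuous_measurable:
  fixes G :: "'a::euclidean_space \<Rightarrow> 'b::euclidean_space"
  assumes "open \<Omega>" and "continuous_on \<Omega> G"
  shows "(\<lambda>x. indicat_real \<Omega> x *\<^sub>R G x) \<in> borel_measurable lebesgue"
  using borel_measurable_continuous_on_indicator[OF _ assms(2)] assms(1)
  by (auto simp: borel_open intro!: measurable_completion)

lemma bounded_compact_support:
  fixes f :: "'a::euclidean_space \<Rightarrow> 'b::euclidean_space"
  assumes "continuous_on UNIV f" and "compact K" and "\<And>x. x \<notin> K \<Longrightarrow> f x = 0"
  obtains B where "B > 0" "\<And>x. norm (f x) \<le> B"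
proof -
  have "bounded (f ` K)"
    using assms(1,2) by (meson compact_continuous_image compact_imp_bounded continuous_on_subset subset_UNIV)
  then obtain B where "B > 0" "\<forall>y\<in>f ` K. norm y \<le> B"
    by (auto simp: bounded_pos)
  with assms(3) have "norm (f x) \<le> B" for x
    by (cases "x \<in> K") auto
  with \<open>B > 0\<close> show ?thesis by (rule that)
qed

lemma integrable_compact_support:
  fixes f :: "'a::euclidean_space \<Rightarrow> 'b::euclidean_space"
  assumes "continuous_on UNIV f" and "compact K" and "\<And>x. x \<notin> K \<Longrightarrow> f x = 0"
  shows "integrable lebesgue f"
proof -
  obtain B where "\<And>x. norm (f x) \<le> B"
    using bounded_compact_support[OF assms] by metis
  then show ?thesis
    using assms by (intro integrable_bounded_support[of f K B])
      (auto intro: borel_measurable_lebesgue_continuous lmeasurable_compact)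
qed

lemma set_integrable_bounded_compact:
  fixes f :: "'a::euclidean_space \<Rightarrow> 'b::euclidean_space"
  assumes "f \<in> borel_measurable lebesgue" and "AE x in lebesgue. norm (f x) \<le> B" and K: "compact K"
  shows "set_integrable lebesgue K f"
  unfolding set_integrable_def
proof (rule Bochner_Integration.integrable_bound[OF integrable_scaled_indicator[OF lmeasurable_compact[OF K], of B]])
  have "K \<in> sets lebesgue" using K by (simp add: lmeasurable_compact fmeasurableD)
  then show "(\<lambda>x. indicat_real K x *\<^sub>R f x) \<in> borel_measurable lebesgue"
    using assms(1) by (intro borel_measurable_scaleR borel_measurable_indicator)
  show "AE x in lebesgue. norm (indicat_real K x *\<^sub>R f x) \<le> norm (B * indicat_real K x)"
    using assms(2) by eventually_elim (auto simp: indicator_def intro: order_trans[OF _ abs_ge_self])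
qed

lemma integral_abs_le_support:
  fixes h :: "'a::euclidean_space \<Rightarrow> real"
  assumes "h \<in> borel_measurable lebesgue" and K: "K \<in> lmeasurable"
    and "\<And>x. x \<in> K \<Longrightarrow> \<bar>h x\<bar> \<le> c" and "\<And>x. x \<notin> K \<Longrightarrow> h x = 0"
  shows "\<bar>LINT x|lebesgue. h x\<bar> \<le> c * measure lebesgue K"
proof -
  have le: "\<bar>h x\<bar> \<le> c * indicat_real K x" for x
    using assms(3,4) by (cases "x \<in> K") auto
  have "\<bar>h x\<bar> \<le> \<bar>c\<bar>" for x
    using assms(3,4) by (cases "x \<in> K") (auto intro: order_trans[OF _ abs_ge_self])
  then have "integrable lebesgue h"
    using assms by (intro integrable_bounded_support[of h K "\<bar>c\<bar>"]) auto
  then have "\<bar>LINT x|lebesgue. h x\<bar> \<le> (LINT x|lebesgue. c * indicat_real K x)"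
    using le by (intro integral_abs_bound[THEN order_trans] integral_mono integrable_abs
        integrable_scaled_indicator K) auto
  also have "\<dots> = c * measure lebesgue K"
    using K by simp
  finally show ?thesis .
qed

lemma lebesgue_integral_translation:
  fixes F :: "'a::euclidean_space \<Rightarrow> real"
  assumes "continuous_on UNIV F"
  shows "(LINT x|lebesgue. F (c + x)) = (LINT x|lebesgue. F x)"
proof -
  have [measurable]: "F \<in> borel_measurable borel"
    by (rule borel_measurable_continuous_onI) fact
  have "(LINT x|lebesgue. F x) = (LINT x|distr lborel borel ((+) c). F x)"
    by (subst lborel_distr_plus) (simp add: integral_completion)
  also have "\<dots> = (LINT x|lborel. F (c + x))"
    by (rule integral_distr) auto
  finally show ?thesis by (simp add: integral_completion)
qed

text \<open>By translation invariance all difference quotients of \<open>F\<close> have integral zero, and the Lipschitz bound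
  dominates them. Differentiability almost everywhere thus suffices, which is what piecewise affine maps
  offer.\<close>

lemma integral_partial_derivative_eq_0:
  fixes F g :: "'a::euclidean_space \<Rightarrow> real"
  assumes lip: "L-lipschitz_on UNIV F" and supp: "\<And>x. x \<notin> cball 0 R \<Longrightarrow> F x = 0"
    and g: "g \<in> borel_measurable lebesgue"
    and der: "AE x in lebesgue. ((\<lambda>t. F (x + t *\<^sub>R e)) has_real_derivative g x) (at 0)"
  shows "(LINT x|lebesgue. g x) = 0"
proof -
  define s where "s n x = real (Suc n) * (F ((1 / real (Suc n)) *\<^sub>R e + x) - F x)" for n x
  have cF: "continuous_on UNIV F" using lip by (rule lipschitz_on_continuous_on)
  have cF': "continuous_on UNIV (\<lambda>x. F (c + x))" for c
    by (intro continuous_on_compose2[OF cF] continuous_intros) auto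
  have iF: "integrable lebesgue F"
    by (rule integrable_compact_support[OF cF compact_cball[of 0 R] supp])
  have iF': "integrable lebesgue (\<lambda>x. F (c + x))" for c
    by (rule integrable_compact_support[OF cF' compact_cball[of "-c" R]])
       (auto intro!: supp simp: dist_norm norm_minus_commute)
  have "integral\<^sup>L lebesgue (s n) = 0" for n
    unfolding s_def using iF iF' lebesgue_integral_translation[OF cF] by simp
  moreover have "(\<lambda>n. integral\<^sup>L lebesgue (s n)) \<longlonglongrightarrow> integral\<^sup>L lebesgue g"
  proof (rule integral_dominated_convergence)
    show "s n \<in> borel_measurable lebesgue" for n
      unfolding s_def by (intro borel_measurable_lebesgue_continuous continuous_intros cF cF')
    show "integrable lebesgue (\<lambda>x. (L * norm e) * indicat_real (cball 0 (R + norm e)) x)"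
      using lmeasurable_cball by (rule integrable_scaled_indicator)
    show "AE x in lebesgue. norm (s n x) \<le> (L * norm e) * indicat_real (cball 0 (R + norm e)) x" for n
    proof (intro AE_I2)
      fix x
      show "norm (s n x) \<le> (L * norm e) * indicat_real (cball 0 (R + norm e)) x"
      proof (cases "x \<in> cball 0 (R + norm e)")
        case True
        have "\<bar>F ((1 / real (Suc n)) *\<^sub>R e + x) - F x\<bar> \<le> L * norm ((1 / real (Suc n)) *\<^sub>R e)"
          using lipschitz_onD[OF lip, of "(1 / real (Suc n)) *\<^sub>R e + x" x] by (simp add: dist_norm)
        then have "real (Suc n) * \<bar>F ((1 / real (Suc n)) *\<^sub>R e + x) - F x\<bar>
            \<le> real (Suc n) * (L * norm ((1 / real (Suc n)) *\<^sub>R e))"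
          by (intro mult_left_mono) auto
        with True show ?thesis by (simp add: s_def abs_mult)
      next
        case False
        let ?y = "(1 / real (Suc n)) *\<^sub>R e"
        have "norm ?y \<le> norm e"
          by (simp add: field_simps mult_left_le_one_le)
        then have "R < norm (?y + x)"
          using False norm_triangle_ineq4[of "?y + x" ?y] by simp
        moreover have "R + norm e < norm x" using False by simp
        then have "R < norm x" using norm_ge_zero[of e] by linarith
        ultimately show ?thesis using False by (simp add: s_def supp)
      qed
    qed
    show "AE x in lebesgue. (\<lambda>n. s n x) \<longlonglongrightarrow> g x"
      using der
    proof eventually_elim
      case (elim x)
      have "(\<lambda>h. (F (x + h *\<^sub>R e) - F x) / h) \<midarrow>0\<rightarrow> g x"
        using elim by (simp add: DERIV_def)
      moreover have "filterlim (\<lambda>n. 1 / real (Suc n)) (at 0) sequentially"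
        using LIMSEQ_inverse_real_of_nat by (simp add: filterlim_at inverse_eq_divide)
      ultimately have "(\<lambda>n. (F (x + (1 / real (Suc n)) *\<^sub>R e) - F x) / (1 / real (Suc n))) \<longlonglongrightarrow> g x"
        by (rule filterlim_compose)
      then show ?case by (simp only: s_def add.commute mult.commute divide_divide_eq_right div_by_1)
    qed
  qed (rule g)
  ultimately show ?thesis using LIMSEQ_unique[of "\<lambda>n. 0" 0] by (simp add: LIMSEQ_const_iff)
qed

abbreviation has_gradient :: "('a::euclidean_space \<Rightarrow> real) \<Rightarrow> 'a \<Rightarrow> 'a \<Rightarrow> bool" where
  "has_gradient f g x \<equiv> (f has_derivative (\<lambda>h. g \<bullet> h)) (at x)"

lemma has_gradient_imp_directional:
  fixes F :: "'a::euclidean_space \<Rightarrow> real"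
  assumes "has_gradient F g x"
  shows "((\<lambda>t. F (x + t *\<^sub>R e)) has_real_derivative g \<bullet> e) (at 0)"
proof -
  have "((\<lambda>t. x + t *\<^sub>R e) has_derivative (\<lambda>t. t *\<^sub>R e)) (at 0)"
    by (auto intro!: derivative_eq_intros)
  moreover have "(F has_derivative (\<lambda>h. g \<bullet> h)) (at (x + 0 *\<^sub>R e))"
    using assms by simp
  ultimately have "(F \<circ> (\<lambda>t. x + t *\<^sub>R e) has_derivative (\<lambda>h. g \<bullet> h) \<circ> (\<lambda>t. t *\<^sub>R e)) (at 0)"
    by (rule diff_chain_at)
  then show ?thesis
    unfolding has_field_derivative_def o_def
    by (rule has_derivative_eq_rhs) (auto simp: fun_eq_iff)
qed

lemma continuous_on_if_derivative:
  fixes F :: "'a::real_normed_vector \<Rightarrow> 'b::real_normed_vector"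
  assumes "\<And>x. (F has_derivative F' x) (at x)"
  shows "continuous_on UNIV F"
  by (intro continuous_at_imp_continuous_on ballI has_derivative_continuous[OF assms])

lemma lipschitz_on_bounded_gradient:
  fixes F :: "'a::euclidean_space \<Rightarrow> real"
  assumes "\<And>x. has_gradient F (g x) x" and "\<And>x. norm (g x) \<le> B"
  shows "B-lipschitz_on UNIV F"
proof (rule bounded_derivative_imp_lipschitz)
  show "(F has_derivative (\<lambda>h. g x \<bullet> h)) (at x within UNIV)" for x using assms(1) by simp
  show "onorm (\<lambda>h. g x \<bullet> h) \<le> B" for x
  proof (rule onorm_le)
    fix h
    have "norm (g x \<bullet> h) \<le> norm (g x) * norm h" by (simp add: Cauchy_Schwarz_ineq2)
    also have "\<dots> \<le> B * norm h" by (intro mult_right_mono assms) auto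
    finally show "norm (g x \<bullet> h) \<le> B * norm h" .
  qed
  show "0 \<le> B" using assms(2)[of 0] norm_ge_zero order_trans by blast
qed auto

lemma integral_by_parts_compact_support:
  fixes f \<phi> :: "'a::euclidean_space \<Rightarrow> real"
  assumes f: "\<And>x. has_gradient f (gf x) x" "continuous_on UNIV gf"
    and \<phi>: "\<And>x. has_gradient \<phi> (g\<phi> x) x" "continuous_on UNIV g\<phi>"
    and K: "compact K" "\<And>x. x \<notin> K \<Longrightarrow> \<phi> x = 0" "\<And>x. x \<notin> K \<Longrightarrow> g\<phi> x = 0"
  shows "(LINT x|lebesgue. f x * (g\<phi> x \<bullet> e)) = - (LINT x|lebesgue. (gf x \<bullet> e) * \<phi> x)"
proof -
  have cf: "continuous_on UNIV f" and c\<phi>: "continuous_on UNIV \<phi>"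
    by (rule continuous_on_if_derivative, fact)+
  let ?F = "\<lambda>x. f x * \<phi> x" and ?g = "\<lambda>x. f x *\<^sub>R g\<phi> x + \<phi> x *\<^sub>R gf x"
  have F: "has_gradient ?F (?g x) x" for x
    by (rule has_derivative_eq_rhs[OF has_derivative_mult[OF f(1) \<phi>(1)]])
       (auto simp: fun_eq_iff inner_add_left mult.commute)
  have cg: "continuous_on UNIV ?g"
    by (intro continuous_intros cf c\<phi> f \<phi>)
  have "?g x = 0" if "x \<notin> K" for x using K(2,3)[OF that] by simp
  then obtain B where B: "\<And>x. norm (?g x) \<le> B"
    using bounded_compact_support[OF cg K(1)] by blast
  obtain R where R: "K \<subseteq> cball 0 R"
    using compact_imp_bounded[OF K(1)] by (auto simp: bounded_iff subset_iff)
  have "(LINT x|lebesgue. ?g x \<bullet> e) = 0"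
  proof (rule integral_partial_derivative_eq_0)
    show "B-lipschitz_on UNIV ?F" by (rule lipschitz_on_bounded_gradient[OF F B])
    show "?F x = 0" if "x \<notin> cball 0 R" for x
      using K(2)[of x] that R by (auto simp: subset_iff)
    show "(\<lambda>x. ?g x \<bullet> e) \<in> borel_measurable lebesgue"
      by (intro borel_measurable_lebesgue_continuous continuous_intros cf c\<phi> f \<phi>)
    show "AE x in lebesgue. ((\<lambda>t. ?F (x + t *\<^sub>R e)) has_real_derivative ?g x \<bullet> e) (at 0)"
      by (intro AE_I2 has_gradient_imp_directional F)
  qed
  moreover have "integrable lebesgue (\<lambda>x. f x * (g\<phi> x \<bullet> e))"
    by (rule integrable_compact_support[OF _ K(1)]) (auto intro!: continuous_intros cf \<phi> simp: K)
  moreover have "integrable lebesgue (\<lambda>x. (gf x \<bullet> e) * \<phi> x)"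
    by (rule integrable_compact_support[OF _ K(1)]) (auto intro!: continuous_intros c\<phi> f simp: K)
  ultimately show ?thesis
    by (simp add: inner_add_left mult.commute)
qed

lemma real_polynomial_function_gradient:
  fixes p :: "'a::euclidean_space \<Rightarrow> real"
  assumes "real_polynomial_function p"
  shows "\<exists>g. continuous_on UNIV g \<and> (\<forall>x. has_gradient p (g x) x)"
  using assms
proof induction
  case (linear f)
  then interpret bounded_linear f .
  have "f h = adjoint f 1 \<bullet> h" for h
    using adjoint_works[OF linear_axioms, of h 1] by (simp add: inner_commute)
  then have "(\<lambda>h. adjoint f 1 \<bullet> h) = f" by auto
  then have "has_gradient f (adjoint f 1) x" for x
    using bounded_linear_imp_has_derivative[OF bounded_linear_axioms] by simp
  then show ?case by (intro exI[of _ "\<lambda>x. adjoint f 1"]) auto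
next
  case (const c)
  show ?case by (intro exI[of _ "\<lambda>x. 0"]) auto
next
  case (add p q)
  then obtain gp gq where g: "continuous_on UNIV gp" "continuous_on UNIV gq"
    "\<And>x. has_gradient p (gp x) x" "\<And>x. has_gradient q (gq x) x"
    by blast
  have "has_gradient (\<lambda>x. p x + q x) (gp x + gq x) x" for x
    unfolding inner_add_left by (intro has_derivative_add g)
  with g show ?case by (intro exI[of _ "\<lambda>x. gp x + gq x"]) (auto intro: continuous_intros)
next
  case (mult p q)
  then obtain gp gq where g: "continuous_on UNIV gp" "continuous_on UNIV gq"
    "\<And>x. has_gradient p (gp x) x" "\<And>x. has_gradient q (gq x) x"
    by blast
  have "has_gradient (\<lambda>x. p x * q x) (p x *\<^sub>R gq x + q x *\<^sub>R gp x) x" for x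
    by (rule has_derivative_eq_rhs[OF has_derivative_mult[OF g(3,4)]])
       (auto simp: fun_eq_iff inner_add_left mult.commute)
  moreover have "continuous_on UNIV p" "continuous_on UNIV q"
    by (rule continuous_on_if_derivative, fact)+
  ultimately show ?case using g(1,2)
    by (intro exI[of _ "\<lambda>x. p x *\<^sub>R gq x + q x *\<^sub>R gp x"]) (auto intro!: continuous_intros)
qed

text \<open>The derivative of \<open>\<phi>\<close> is moved to the other factor. As \<open>f\<close> is only continuous, it is first replaced
  by a polynomial; the error is controlled by the bound \<open>M\<close> on the derivative of \<open>\<phi>\<close>.\<close>

lemma weakly_small_if_uniformly_small:
  fixes f :: "'a::euclidean_space \<Rightarrow> real"
  assumes f: "continuous_on UNIV f" and "e > 0"
  obtains d where "d > 0"
    "\<And>\<phi> g K. \<lbrakk>\<And>x. has_gradient \<phi> (g x) x; continuous_on UNIV g;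
        compact K; K \<subseteq> cball 0 R; \<And>x. x \<notin> K \<Longrightarrow> \<phi> x = 0; \<And>x. x \<notin> K \<Longrightarrow> g x = 0;
        \<And>x. \<bar>\<phi> x\<bar> \<le> d; \<And>x. \<bar>g x \<bullet> b\<bar> \<le> M\<rbrakk> \<Longrightarrow> \<bar>LINT x|lebesgue. f x * (g x \<bullet> b)\<bar> \<le> e"
proof -
  let ?B = "cball (0::'a) R" and ?m = "measure lebesgue (cball (0::'a) R)"
  define e1 where "e1 = e / (2 * (\<bar>M\<bar> * ?m + 1))"
  have m: "?m \<ge> 0" by simp
  then have pos1: "\<bar>M\<bar> * ?m + 1 > 0" by (simp add: add_nonneg_pos)
  then have "e1 > 0" using \<open>e > 0\<close> by (simp add: e1_def)
  then obtain p where p: "real_polynomial_function p" "\<And>x. x \<in> ?B \<Longrightarrow> \<bar>f x - p x\<bar> < e1"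
    using Stone_Weierstrass_real_polynomial_function[OF compact_cball continuous_on_subset[OF f subset_UNIV]]
    by metis
  obtain gp where gp: "continuous_on UNIV gp" "\<And>x. has_gradient p (gp x) x"
    using real_polynomial_function_gradient[OF p(1)] by blast
  have cp: "continuous_on UNIV p"
    by (rule continuous_on_if_derivative, fact)
  have "compact ((\<lambda>x. gp x \<bullet> b) ` ?B)"
    by (intro compact_continuous_image continuous_intros continuous_on_subset[OF gp(1)]) auto
  then have "bounded ((\<lambda>x. gp x \<bullet> b) ` ?B)" by (rule compact_imp_bounded)
  then obtain c where "c > 0" "\<forall>y\<in>(\<lambda>x. gp x \<bullet> b) ` ?B. norm y \<le> c"
    unfolding bounded_pos by blast
  then have c: "c > 0" "\<And>x. x \<in> ?B \<Longrightarrow> \<bar>gp x \<bullet> b\<bar> \<le> c" by auto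
  define d where "d = e / (2 * (c * ?m + 1))"
  have pos2: "c * ?m + 1 > 0" using c m by (simp add: add_nonneg_pos)
  then have "d > 0" using \<open>e > 0\<close> by (simp add: d_def)
  moreover have "\<bar>LINT x|lebesgue. f x * (g x \<bullet> b)\<bar> \<le> e"
    if der: "\<And>x. has_gradient \<phi> (g x) x" and cg: "continuous_on UNIV g"
      and K: "compact K" "K \<subseteq> ?B" and z: "\<And>x. x \<notin> K \<Longrightarrow> \<phi> x = 0" "\<And>x. x \<notin> K \<Longrightarrow> g x = 0"
      and b: "\<And>x. \<bar>\<phi> x\<bar> \<le> d" "\<And>x. \<bar>g x \<bullet> b\<bar> \<le> M" for \<phi> g K
  proof -
    have c\<phi>: "continuous_on UNIV \<phi>"
      by (rule continuous_on_if_derivative, fact)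
    have z': "\<phi> x = 0" "g x = 0" if "x \<notin> ?B" for x
      using z[of x] K(2) that by blast+
    have "\<bar>LINT x|lebesgue. (f x - p x) * (g x \<bullet> b)\<bar> \<le> (e1 * \<bar>M\<bar>) * ?m"
    proof (rule integral_abs_le_support)
      show "\<bar>(f x - p x) * (g x \<bullet> b)\<bar> \<le> e1 * \<bar>M\<bar>" if "x \<in> ?B" for x
        unfolding abs_mult using p(2)[OF that] b(2)[of x] by (intro mult_mono) auto
    qed (use z' in \<open>auto intro!: borel_measurable_lebesgue_continuous continuous_intros f cp cg\<close>)
    also have "\<dots> \<le> e / 2"
    proof -
      have "e1 * (\<bar>M\<bar> * ?m) \<le> e1 * (\<bar>M\<bar> * ?m + 1)" using \<open>e1 > 0\<close> by (intro mult_left_mono) auto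
      also have "\<dots> = e / 2" using pos1 unfolding e1_def by (simp add: divide_simps)
      finally show ?thesis by (simp add: mult.assoc)
    qed
    finally have 1: "\<bar>LINT x|lebesgue. (f x - p x) * (g x \<bullet> b)\<bar> \<le> e / 2" .
    have "\<bar>LINT x|lebesgue. (gp x \<bullet> b) * \<phi> x\<bar> \<le> (c * d) * ?m"
    proof (rule integral_abs_le_support)
      show "\<bar>(gp x \<bullet> b) * \<phi> x\<bar> \<le> c * d" if "x \<in> ?B" for x
        unfolding abs_mult using c(1) c(2)[OF that] b(1)[of x] by (intro mult_mono) auto
    qed (use z' in \<open>auto intro!: borel_measurable_lebesgue_continuous continuous_intros gp c\<phi>\<close>)
    also have "\<dots> \<le> e / 2"
    proof -
      have "d * (c * ?m) \<le> d * (c * ?m + 1)" using \<open>d > 0\<close> by (intro mult_left_mono) auto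
      also have "\<dots> = e / 2" using pos2 unfolding d_def by (simp add: divide_simps)
      finally show ?thesis by (simp add: mult_ac)
    qed
    finally have "\<bar>LINT x|lebesgue. (gp x \<bullet> b) * \<phi> x\<bar> \<le> e / 2" .
    then have 2: "\<bar>LINT x|lebesgue. p x * (g x \<bullet> b)\<bar> \<le> e / 2"
      using integral_by_parts_compact_support[OF gp(2,1) der cg K(1) z] by simp
    have "integrable lebesgue (\<lambda>x. (f x - p x) * (g x \<bullet> b))" "integrable lebesgue (\<lambda>x. p x * (g x \<bullet> b))"
      by (rule integrable_compact_support[OF _ K(1)]; auto intro!: continuous_intros f cp cg simp: z)+
    then have "(LINT x|lebesgue. f x * (g x \<bullet> b))
        = (LINT x|lebesgue. (f x - p x) * (g x \<bullet> b)) + (LINT x|lebesgue. p x * (g x \<bullet> b))"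
      by (subst Bochner_Integration.integral_add[symmetric]) (auto simp: algebra_simps)
    with 1 2 show ?thesis by linarith
  qed
  ultimately show ?thesis using that by blast
qed

section \<open>Bump functions\<close>

lemma has_real_derivative_max_0_power:
  "((\<lambda>s::real. max 0 s ^ Suc (Suc n)) has_real_derivative real (Suc (Suc n)) * max 0 s ^ Suc n) (at s)"
proof -
  consider "s > 0" | "s < 0" | "s = 0" by linarith
  then show ?thesis
  proof cases
    case 1
    have "((\<lambda>s::real. s ^ Suc (Suc n)) has_real_derivative real (Suc (Suc n)) * s ^ Suc n) (at s)"
      using DERIV_pow[of "Suc (Suc n)" s] by simp
    then have "((\<lambda>s::real. max 0 s ^ Suc (Suc n)) has_real_derivative real (Suc (Suc n)) * s ^ Suc n) (at s)"
      by (rule has_field_derivative_transform_within_open[of _ _ _ "{0<..}"]) (use 1 in auto)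
    with 1 show ?thesis by simp
  next
    case 2
    have "((\<lambda>s::real. 0) has_real_derivative 0) (at s)" by simp
    then have "((\<lambda>s::real. max 0 s ^ Suc (Suc n)) has_real_derivative 0) (at s)"
      by (rule has_field_derivative_transform_within_open[of _ _ _ "{..<0}"]) (use 2 in auto)
    with 2 show ?thesis by simp
  next
    case 3
    have "((\<lambda>h. (max 0 h ^ Suc (Suc n)) / h) \<longlongrightarrow> 0) (at (0::real))"
    proof (rule Lim_null_comparison)
      have "norm (max 0 h ^ Suc (Suc n) / h) \<le> \<bar>h\<bar> ^ Suc n" for h :: real
        by (cases "h > 0") (auto simp: max_absorb1 not_less intro!: mult_nonpos_nonneg)
      then show "\<forall>\<^sub>F h in at (0::real). norm (max 0 h ^ Suc (Suc n) / h) \<le> \<bar>h\<bar> ^ Suc n"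
        by (intro always_eventually allI)
      show "((\<lambda>h. \<bar>h\<bar> ^ Suc n) \<longlongrightarrow> 0) (at (0::real))"
        by (rule tendsto_eq_intros refl | simp)+
    qed
    with 3 show ?thesis by (simp add: DERIV_def)
  qed
qed

lemma has_derivative_real_compose:
  fixes p :: "'a::real_normed_vector \<Rightarrow> real"
  assumes "(p has_derivative p') (at x)" and "(f has_real_derivative D) (at (p x))"
  shows "((\<lambda>y. f (p y)) has_derivative (\<lambda>h. D * p' h)) (at x)"
  using diff_chain_at[OF assms(1) assms(2)[unfolded has_field_derivative_def]]
  by (simp add: o_def)

text \<open>The bump is the third power of the positive part of \<open>1 - \<bar>x - a\<bar>\<^sup>2 / r\<^sup>2\<close>. The exponent makes it \<open>C\<^sup>2\<close>, as
  required of a factor of a stream function whose velocity field is to be \<open>C\<^sup>1\<close>; on the ball of half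
  the radius its values are at least \<open>(3/4)^3 > 2/5\<close>.\<close>

lemma bump_on_ball:
  fixes a :: "real^2"
  assumes "r > 0"
  obtains \<beta> :: "real^2 \<Rightarrow> real" and g :: "real^2 \<Rightarrow> real^2" and D :: "real^2 \<Rightarrow> real^2^2"
  where "\<And>x. has_gradient \<beta> (g x) x"
    "\<And>x i. has_gradient (\<lambda>y. g y $ i) (D x $ i) x"
    "continuous_on UNIV g" "continuous_on UNIV D" "\<And>x i j. D x $ i $ j = D x $ j $ i"
    "\<And>x. x \<notin> ball a r \<Longrightarrow> \<beta> x = 0 \<and> g x = 0 \<and> D x = 0"
    "\<And>x. x \<in> ball a r \<Longrightarrow> \<beta> x > 0"
    "\<And>x. 0 \<le> \<beta> x \<and> \<beta> x \<le> 1" "\<And>x. x \<in> cball a (r/2) \<Longrightarrow> 2/5 \<le> \<beta> x"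
proof -
  define p where "p x = 1 - (1 / r^2) * ((x - a) \<bullet> (x - a))" for x
  define m where "m x = max 0 (p x)" for x
  define \<beta> where "\<beta> x = m x ^ 3" for x
  define g where "g x = (- 6 * m x ^ 2 / r^2) *\<^sub>R (x - a)" for x
  define D where "D x = (\<chi> i. (- 6 * m x ^ 2 / r^2) *\<^sub>R axis i 1
      + (24 * m x / r^4 * (x - a) $ i) *\<^sub>R (x - a))" for x
  have p: "(p has_derivative (\<lambda>h. - 2 / r^2 * ((x - a) \<bullet> h))) (at x)" for x
  proof -
    have "(p has_derivative (\<lambda>h. 0 - (1 / r^2) * ((x - a) \<bullet> (h - 0) + (h - 0) \<bullet> (x - a)))) (at x)"
      unfolding p_def by (intro derivative_intros)
    then show ?thesis
      by (rule has_derivative_eq_rhs) (simp add: fun_eq_iff inner_commute)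
  qed
  have pow3: "((\<lambda>s::real. max 0 s ^ 3) has_real_derivative 3 * max 0 s ^ 2) (at s)"
    and pow2: "((\<lambda>s::real. max 0 s ^ 2) has_real_derivative 2 * max 0 s) (at s)" for s
    using has_real_derivative_max_0_power[of 1 s] has_real_derivative_max_0_power[of 0 s]
    by (simp_all add: numeral_eq_Suc)
  have d\<beta>: "has_gradient \<beta> (g x) x" for x
    unfolding \<beta>_def m_def
    by (rule has_derivative_eq_rhs[OF has_derivative_real_compose[OF p pow3]])
       (simp add: g_def m_def fun_eq_iff)
  have dm: "((\<lambda>y. m y ^ 2) has_derivative (\<lambda>h. 2 * m x * (- 2 / r^2 * ((x - a) \<bullet> h)))) (at x)" for x
    unfolding m_def by (rule has_derivative_real_compose[OF p pow2])
  have dg: "has_gradient (\<lambda>y. g y $ i) (D x $ i) x" for x i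
  proof -
    have "((\<lambda>y. (-6 / r^2) * (m y ^ 2 * (y $ i - a $ i))) has_derivative
       (\<lambda>h. (-6 / r^2) * (m x ^ 2 * h $ i + 2 * m x * (- 2 / r^2 * ((x - a) \<bullet> h)) * (x $ i - a $ i)))) (at x)"
    proof -
      have "((\<lambda>y. y $ i - a $ i) has_derivative (\<lambda>h. h $ i)) (at x)"
        by (rule has_derivative_eq_rhs[OF has_derivative_diff[OF
              bounded_linear_imp_has_derivative[OF bounded_linear_vec_nth] has_derivative_const]]) simp
      from has_derivative_mult_right[OF has_derivative_mult[OF dm this]] show ?thesis
        by (rule has_derivative_eq_rhs) (simp add: fun_eq_iff)
    qed
    moreover have "(\<lambda>y. g y $ i) = (\<lambda>y. (-6 / r^2) * (m y ^ 2 * (y $ i - a $ i)))"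
      by (simp add: g_def fun_eq_iff)
    moreover have "(\<lambda>h. D x $ i \<bullet> h) =
       (\<lambda>h. (-6 / r^2) * (m x ^ 2 * h $ i + 2 * m x * (- 2 / r^2 * ((x - a) \<bullet> h)) * (x $ i - a $ i)))"
    proof
      fix h
      define u where "u = (x - a) \<bullet> h"
      have "D x $ i \<bullet> h = (- 6 * m x ^ 2 / r^2) * h $ i + (24 * m x / r^4 * (x - a) $ i) * u"
        unfolding D_def vec_lambda_beta inner_add_left inner_scaleR_left u_def by (simp add: inner_axis')
      also have "\<dots> = (-6 / r^2) * (m x ^ 2 * h $ i + 2 * m x * (- 2 / r^2 * u) * (x $ i - a $ i))"
        using assms by (simp add: field_simps power4_eq_xxxx power2_eq_square)
      finally show "D x $ i \<bullet> h = (-6 / r^2) * (m x ^ 2 * h $ i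
          + 2 * m x * (- 2 / r^2 * ((x - a) \<bullet> h)) * (x $ i - a $ i))" unfolding u_def .
    qed
    ultimately show ?thesis by simp
  qed
  have cm: "continuous_on UNIV m"
    unfolding m_def p_def by (intro continuous_intros) (use assms in auto)
  have cg: "continuous_on UNIV g"
    unfolding g_def by (intro continuous_intros cm) (use assms in auto)
  have cD: "continuous_on UNIV D"
    unfolding D_def by (intro continuous_intros cm) (use assms in auto)
  have sym: "D x $ i $ j = D x $ j $ i" for x i j
    by (simp add: D_def axis_def)
  have nn: "(x - a) \<bullet> (x - a) = (dist a x)^2" for x
    by (metis dist_commute dist_norm power2_norm_eq_inner)
  have out: "\<beta> x = 0 \<and> g x = 0 \<and> D x = 0" if "x \<notin> ball a r" for x
  proof -
    have "r^2 \<le> (dist a x)^2" using that assms by (intro power_mono) auto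
    then have "m x = 0" using assms by (simp add: m_def p_def nn divide_simps)
    then show ?thesis by (simp add: \<beta>_def g_def D_def vec_eq_iff)
  qed
  have "in": "\<beta> x > 0" if "x \<in> ball a r" for x
  proof -
    have "(dist a x)^2 < r^2" using that assms by (intro power_strict_mono) auto
    then have "m x > 0" using assms by (simp add: m_def p_def nn divide_simps)
    then show ?thesis by (simp add: \<beta>_def)
  qed
  have "0 \<le> m x" "m x \<le> 1" for x
    using assms by (auto simp: m_def p_def)
  then have bd: "0 \<le> \<beta> x \<and> \<beta> x \<le> 1" for x
    unfolding \<beta>_def by (auto intro: power_le_one)
  have half: "2/5 \<le> \<beta> x" if "x \<in> cball a (r/2)" for x
  proof -
    have "(dist a x)^2 \<le> (r/2)^2" using that assms by (intro power_mono) auto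
    then have "3/4 \<le> p x" using assms by (simp add: p_def nn field_simps)
    then have "3/4 \<le> m x" by (simp add: m_def)
    then have "(3/4)^3 \<le> \<beta> x" unfolding \<beta>_def by (intro power_mono) auto
    then show ?thesis by (simp add: power3_eq_cube)
  qed
  show ?thesis by (rule that[OF d\<beta> dg cg cD sym out "in" bd half])
qed

lemma ex_C1_positive_on_compact:
  fixes K :: "(real^2) set"
  assumes K: "compact K" "K \<subseteq> U" and U: "open U"
  obtains p :: "real^2 \<Rightarrow> real" and g L where "\<And>x. has_gradient p (g x) x" "continuous_on UNIV g"
    "compact L" "L \<subseteq> U" "\<And>x. x \<notin> L \<Longrightarrow> p x = 0" "\<And>x. p x \<ge> 0" "\<And>x. x \<in> K \<Longrightarrow> p x > 0"
proof -
  have "\<exists>r>0. cball a r \<subseteq> U" if "a \<in> K" for a using that K(2) U open_contains_cball by blast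
  then obtain r where r: "\<And>a. a \<in> K \<Longrightarrow> r a > 0 \<and> cball a (r a) \<subseteq> U" by metis
  have "K \<subseteq> (\<Union>a\<in>K. ball a (r a))" using r by force
  then obtain F where F: "F \<subseteq> K" "finite F" "K \<subseteq> (\<Union>a\<in>F. ball a (r a))"
    by (rule compactE_image[OF K(1) open_ball])
  have "\<exists>\<beta> g. (\<forall>x. has_gradient \<beta> (g x) x) \<and> continuous_on UNIV g \<and>
      (\<forall>x. x \<notin> ball a (r a) \<longrightarrow> \<beta> x = 0) \<and> (\<forall>x. x \<in> ball a (r a) \<longrightarrow> \<beta> x > 0)" if a: "a \<in> F" for a
  proof -
    have "r a > 0" using r a F(1) by blast
    then obtain \<beta> :: "real^2 \<Rightarrow> real" and g :: "real^2 \<Rightarrow> real^2" and D :: "real^2 \<Rightarrow> real^2^2"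
      where "\<And>x. has_gradient \<beta> (g x) x" "continuous_on UNIV g"
        "\<And>x. x \<notin> ball a (r a) \<Longrightarrow> \<beta> x = 0 \<and> g x = 0 \<and> D x = 0" "\<And>x. x \<in> ball a (r a) \<Longrightarrow> \<beta> x > 0"
      by (rule bump_on_ball[of "r a" a]) blast
    then show ?thesis by (intro exI[of _ \<beta>] exI[of _ g]) simp
  qed
  then obtain \<beta> g where b: "\<And>a x. a \<in> F \<Longrightarrow> has_gradient (\<beta> a) (g a x) x"
    "\<And>a. a \<in> F \<Longrightarrow> continuous_on UNIV (g a)" "\<And>a x. a \<in> F \<Longrightarrow> x \<notin> ball a (r a) \<Longrightarrow> \<beta> a x = 0"
    "\<And>a x. a \<in> F \<Longrightarrow> x \<in> ball a (r a) \<Longrightarrow> \<beta> a x > 0" by metis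
  have nn: "\<beta> a x \<ge> 0" if "a \<in> F" for a x using b(3,4)[OF that, of x] by (cases "x \<in> ball a (r a)") auto
  show ?thesis
  proof (rule that[of "\<lambda>x. \<Sum>a\<in>F. \<beta> a x" "\<lambda>x. \<Sum>a\<in>F. g a x" "\<Union>a\<in>F. cball a (r a)"])
    show "has_gradient (\<lambda>x. \<Sum>a\<in>F. \<beta> a x) (\<Sum>a\<in>F. g a x) x" for x
      unfolding inner_sum_left by (intro has_derivative_sum b(1))
    show "continuous_on UNIV (\<lambda>x. \<Sum>a\<in>F. g a x)" by (intro continuous_on_sum b(2))
    show "compact (\<Union>a\<in>F. cball a (r a))" using F(2) by (intro compact_UN) auto
    show "(\<Union>a\<in>F. cball a (r a)) \<subseteq> U" using r F(1) by blast
    show "(\<Sum>a\<in>F. \<beta> a x) = 0" if "x \<notin> (\<Union>a\<in>F. cball a (r a))" for x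
      using that by (intro sum.neutral ballI b(3)) (auto simp: not_less)
    show "(\<Sum>a\<in>F. \<beta> a x) \<ge> 0" for x by (intro sum_nonneg nn)
    show "(\<Sum>a\<in>F. \<beta> a x) > 0" if "x \<in> K" for x
    proof -
      obtain a where a: "a \<in> F" "x \<in> ball a (r a)" using F(3) \<open>x \<in> K\<close> by blast
      then have "\<beta> a x > 0" by (rule b(4))
      also have "\<beta> a x \<le> (\<Sum>a\<in>F. \<beta> a x)" by (rule member_le_sum[OF a(1) _ F(2)]) (use nn in auto)
      finally show ?thesis .
    qed
  qed
qed

section \<open>Test functions and the uniqueness of weak gradients\<close>

text \<open>The next two lemmas translate between test functions and functions given together with their
  gradient, in which all computations below are done.\<close>

lemma test_functionI:
  assumes der: "\<And>x. has_gradient \<phi> (g x) x" and g: "continuous_on UNIV g"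
    and K: "compact K" "K \<subseteq> \<omega>" "\<And>x. x \<notin> K \<Longrightarrow> \<phi> x = 0"
  shows "test_function \<omega> \<phi>" and "partial_deriv j \<phi> x = g x $ j"
proof -
  have pd: "partial_deriv j \<phi> x = g x $ j" for j x
    unfolding partial_deriv_def using frechet_derivative_at[OF der[of x]]
    by (metis inner_axis inner_real_def mult.right_neutral)
  have "closure {x. \<phi> x \<noteq> 0} \<subseteq> K"
    using K(3) by (intro closure_minimal compact_imp_closed K(1)) auto
  moreover have "compact (closure {x. \<phi> x \<noteq> 0})"
    using calculation K(1) by (meson bounded_subset closed_closure compact_eq_bounded_closed)
  ultimately show "test_function \<omega> \<phi>"
    unfolding test_function_def pd using der K(2)
    by (auto simp: differentiable_def intro!: continuous_intros g)
  show "partial_deriv j \<phi> x = g x $ j" by (rule pd)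
qed

lemma test_functionE:
  assumes "test_function \<omega> \<phi>"
  obtains g K where "\<And>x. has_gradient \<phi> (g x) x" "continuous_on UNIV g"
    "compact K" "K \<subseteq> \<omega>" "\<And>x. x \<notin> K \<Longrightarrow> \<phi> x = 0" "\<And>x. x \<notin> K \<Longrightarrow> g x = 0"
    "\<And>x j. partial_deriv j \<phi> x = g x $ j"
proof -
  define g :: "real^2 \<Rightarrow> real^2" where "g x = (\<chi> j. partial_deriv j \<phi> x)" for x
  define K where "K = closure {x. \<phi> x \<noteq> 0}"
  have "has_gradient \<phi> (g x) x" for x
  proof -
    have d: "(\<phi> has_derivative frechet_derivative \<phi> (at x)) (at x)"
      using assms by (simp add: test_function_def frechet_derivative_works)
    then have lin: "linear (frechet_derivative \<phi> (at x))" by (rule has_derivative_linear)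
    have "frechet_derivative \<phi> (at x) h = g x \<bullet> h" for h
    proof -
      have "h = (\<Sum>j\<in>UNIV. h $ j *\<^sub>R axis j 1)"
        by (simp add: vec_eq_iff sum_2 axis_def) (metis exhaust_2)
      then have "frechet_derivative \<phi> (at x) h = frechet_derivative \<phi> (at x) (\<Sum>j\<in>UNIV. h $ j *\<^sub>R axis j 1)"
        by simp
      also have "\<dots> = (\<Sum>j\<in>UNIV. h $ j * frechet_derivative \<phi> (at x) (axis j 1))"
        by (simp add: linear_sum[OF lin] linear_cmul[OF lin])
      also have "\<dots> = g x \<bullet> h"
        by (simp add: inner_vec_def g_def partial_deriv_def mult.commute)
      finally show ?thesis .
    qed
    then have "frechet_derivative \<phi> (at x) = (\<lambda>h. g x \<bullet> h)" by (rule ext)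
    with d show ?thesis by simp
  qed
  moreover have "continuous_on UNIV g"
    using assms unfolding g_def test_function_def by (intro continuous_on_vec_lambda) auto
  moreover have "compact K" "K \<subseteq> \<omega>" using assms by (auto simp: test_function_def K_def)
  moreover have z: "\<phi> x = 0" if "x \<notin> K" for x
    using that closure_subset[of "{x. \<phi> x \<noteq> 0}"] unfolding K_def by auto
  moreover have "g x = 0" if "x \<notin> K" for x
  proof -
    have "(\<phi> has_derivative (\<lambda>h. 0)) (at x)"
    proof (rule has_derivative_transform_within_open[OF has_derivative_const])
      show "open (- K)" using \<open>compact K\<close> by (simp add: compact_imp_closed open_Compl)
    qed (use that z in auto)
    then have "frechet_derivative \<phi> (at x) = (\<lambda>h. 0)" by (rule frechet_derivative_at[symmetric])
    then show ?thesis by (simp add: g_def partial_deriv_def vec_eq_iff)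
  qed
  moreover have "partial_deriv j \<phi> x = g x $ j" for x j by (simp add: g_def)
  ultimately show ?thesis by (rule that)
qed

text \<open>Indicators of compact or open sets are not test functions, but the indicator of a set \<open>{x. p x > 0}\<close> is
  the limit of the test functions \<open>n * p / (1 + n * p)\<close>, all of which live on the support of \<open>p\<close>.\<close>

lemma integral_positivity_set_eq_0:
  fixes h :: "real^2 \<Rightarrow> real"
  assumes int: "\<And>K. compact K \<Longrightarrow> K \<subseteq> \<omega> \<Longrightarrow> set_integrable lebesgue K h"
    and zero: "\<And>\<phi>. test_function \<omega> \<phi> \<Longrightarrow> (LINT x:\<omega>|lebesgue. h x * \<phi> x) = 0"
    and p: "\<And>x. has_gradient p (g x) x" "continuous_on UNIV g"
    and K: "compact K" "K \<subseteq> \<omega>" "\<And>x. x \<notin> K \<Longrightarrow> p x = 0" and nn: "\<And>x. p x \<ge> 0"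
  shows "(LINT x|lebesgue. indicat_real {x. p x > 0} x * h x) = 0"
proof -
  have cp: "continuous_on UNIV p" by (rule continuous_on_if_derivative, fact)
  \<comment> \<open>These \<open>C\<^sup>1\<close> functions tend to the indicator of the set where \<open>p\<close> is positive.\<close>
  define \<theta> where "\<theta> n x = real n * p x / (1 + real n * p x)" for n x
  have pos: "1 + real n * p x > 0" for n x using nn[of x] by (simp add: add_pos_nonneg)
  have d: "(\<theta> n has_derivative (\<lambda>h. ((real n / (1 + real n * p x)\<^sup>2) *\<^sub>R g x) \<bullet> h)) (at x)" for n x
  proof -
    have ne: "1 + real n * p x \<noteq> 0" using pos[of n x] by linarith
    have "((\<lambda>s. real n * s / (1 + real n * s)) has_real_derivative
        (real n * (1 + real n * p x) - real n * p x * real n) / ((1 + real n * p x) * (1 + real n * p x))) (at (p x))"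
      using ne by (auto intro!: derivative_eq_intros)
    from has_derivative_real_compose[OF p(1) this] show ?thesis
      unfolding \<theta>_def by (rule has_derivative_eq_rhs) (simp add: fun_eq_iff power2_eq_square algebra_simps)
  qed
  have cg: "continuous_on UNIV (\<lambda>x. (real n / (1 + real n * p x)\<^sup>2) *\<^sub>R g x)" for n
    using pos by (intro continuous_intros cp p(2)) (metis less_irrefl power_eq_0_iff)
  have "test_function \<omega> (\<theta> n)" for n
    by (rule test_functionI(1)[OF d cg K(1,2)]) (simp add: \<theta>_def K(3))
  then have "(LINT x:\<omega>|lebesgue. h x * \<theta> n x) = 0" for n by (rule zero)
  moreover have "(LINT x:\<omega>|lebesgue. h x * \<theta> n x) = (LINT x|lebesgue. (indicat_real K x * h x) * \<theta> n x)" for n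
    unfolding set_lebesgue_integral_def
    using K by (intro Bochner_Integration.integral_cong) (auto simp: \<theta>_def indicator_def)
  ultimately have z: "(LINT x|lebesgue. (indicat_real K x * h x) * \<theta> n x) = 0" for n by simp
  have hK: "integrable lebesgue (\<lambda>x. indicat_real K x * h x)"
    using int[OF K(1,2)] by (simp add: set_integrable_def)
  have lim: "(\<lambda>n. (indicat_real K x * h x) * \<theta> n x) \<longlonglongrightarrow> indicat_real {x. p x > 0} x * h x" for x
  proof (cases "p x > 0")
    case True
    then have "x \<in> K" using K(3) by force
    have "(\<lambda>n. inverse (real n)) \<longlonglongrightarrow> 0" by (rule lim_inverse_n)
    then have "(\<lambda>n. p x / (inverse (real n) + p x)) \<longlonglongrightarrow> p x / (0 + p x)"
      using True by (intro tendsto_intros) auto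
    moreover have "\<forall>\<^sub>F n in sequentially. p x / (inverse (real n) + p x) = \<theta> n x"
      using eventually_gt_at_top[of 0]
    proof eventually_elim
      case (elim n)
      have "inverse (real n) + p x > 0" using elim True by (simp add: add_pos_pos)
      then show ?case using elim pos[of n x] unfolding \<theta>_def by (simp add: field_simps)
    qed
    ultimately have "(\<lambda>n. \<theta> n x) \<longlonglongrightarrow> 1"
      using True by (simp add: tendsto_cong)
    then have "(\<lambda>n. (indicat_real K x * h x) * \<theta> n x) \<longlonglongrightarrow> (indicat_real K x * h x) * 1"
      by (intro tendsto_intros)
    with True \<open>x \<in> K\<close> show ?thesis by simp
  next
    case False
    then have "p x = 0" using nn[of x] by linarith
    then show ?thesis by (simp add: \<theta>_def)
  qed
  have th: "\<bar>\<theta> n x\<bar> \<le> 1" for n x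
    using nn[of x] pos[of n x] by (simp add: \<theta>_def divide_le_eq)
  have "{x. p x > 0} \<in> sets lebesgue"
    using open_Collect_less[OF continuous_on_const cp] by auto
  have m: "(\<lambda>x. (indicat_real K x * h x) * \<theta> n x) \<in> borel_measurable lebesgue" for n
    using borel_measurable_integrable[OF hK] 
    by (rule borel_measurable_times) (intro borel_measurable_lebesgue_continuous continuous_on_if_derivative[OF d])
  have eq: "indicat_real {x. p x > 0} x * h x = indicat_real {x. p x > 0} x * (indicat_real K x * h x)" for x
    using K(3)[of x] by (cases "x \<in> K") auto
  have m': "(\<lambda>x. indicat_real {x. p x > 0} x * h x) \<in> borel_measurable lebesgue"
    unfolding eq
    by (rule borel_measurable_times[OF borel_measurable_indicator borel_measurable_integrable[OF hK]]) fact
  have "(\<lambda>n. LINT x|lebesgue. (indicat_real K x * h x) * \<theta> n x) \<longlonglongrightarrow> (LINT x|lebesgue. indicat_real {x. p x > 0} x * h x)"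
  proof (rule integral_dominated_convergence[OF m' m integrable_norm[OF hK]])
    show "AE x in lebesgue. (\<lambda>n. (indicat_real K x * h x) * \<theta> n x) \<longlonglongrightarrow> indicat_real {x. p x > 0} x * h x"
      using lim by (intro AE_I2)
    show "AE x in lebesgue. norm ((indicat_real K x * h x) * \<theta> n x) \<le> norm (indicat_real K x * h x)" for n
      using th by (intro AE_I2) (simp add: abs_mult mult_left_le)
  qed
  then show ?thesis unfolding z by (simp add: LIMSEQ_const_iff)
qed

text \<open>A compact set is the limit of sets on which suitable \<open>C\<^sup>1\<close> functions are positive, taken in shrinking
  neighbourhoods; a first such function provides the compact set on which \<open>h\<close> dominates.\<close>

lemma integral_compact_eq_0:
  fixes h :: "real^2 \<Rightarrow> real"
  assumes \<omega>: "open \<omega>" and int: "\<And>K. compact K \<Longrightarrow> K \<subseteq> \<omega> \<Longrightarrow> set_integrable lebesgue K h"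
    and zero: "\<And>\<phi>. test_function \<omega> \<phi> \<Longrightarrow> (LINT x:\<omega>|lebesgue. h x * \<phi> x) = 0"
    and K: "compact K" "K \<subseteq> \<omega>"
  shows "(LINT x|lebesgue. indicat_real K x * h x) = 0"
proof (cases "K = {}")
  case False
  obtain p0 :: "real^2 \<Rightarrow> real" and g0 L where p0: "\<And>x. has_gradient p0 (g0 x) x" "continuous_on UNIV g0"
    "compact L" "L \<subseteq> \<omega>" "\<And>x. x \<notin> L \<Longrightarrow> p0 x = 0" "\<And>x. p0 x \<ge> 0" "\<And>x. x \<in> K \<Longrightarrow> p0 x > 0"
    by (rule ex_C1_positive_on_compact[OF K \<omega>]) blast
  have cp0: "continuous_on UNIV p0" by (rule continuous_on_if_derivative, fact)
  define U where "U n = {x. p0 x > 0} \<inter> {x. infdist x K < 1 / real (Suc n)}" for n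
  have oU: "open (U n)" for n
    unfolding U_def by (intro open_Int open_Collect_less continuous_intros cp0)
  have KU: "K \<subseteq> U n" for n unfolding U_def using p0(7) by auto
  have UL: "U n \<subseteq> L" for n using p0(5) unfolding U_def by force
  define good where "good n V \<longleftrightarrow> V \<in> sets lebesgue \<and> K \<subseteq> V \<and> V \<subseteq> U n \<and>
      (LINT x|lebesgue. indicat_real V x * h x) = 0" for n V
  have "\<exists>V. good n V" for n
  proof -
    obtain p :: "real^2 \<Rightarrow> real" and g L' where p: "\<And>x. has_gradient p (g x) x" "continuous_on UNIV g"
      "compact L'" "L' \<subseteq> U n" "\<And>x. x \<notin> L' \<Longrightarrow> p x = 0" "\<And>x. p x \<ge> 0" "\<And>x. x \<in> K \<Longrightarrow> p x > 0"
      by (rule ex_C1_positive_on_compact[OF K(1) KU oU]) blast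
    have cp: "continuous_on UNIV p" by (rule continuous_on_if_derivative, fact)
    have "L' \<subseteq> \<omega>" using p(4) UL p0(4) by blast
    then have "(LINT x|lebesgue. indicat_real {x. p x > 0} x * h x) = 0"
      by (intro integral_positivity_set_eq_0[OF int zero p(1,2,3) _ p(5,6)])
    moreover have "{x. p x > 0} \<in> sets lebesgue"
      using open_Collect_less[OF continuous_on_const cp] by auto
    moreover have "{x. p x > 0} \<subseteq> U n" using p(4,5) by force
    ultimately show ?thesis using p(7)
      unfolding good_def by (intro exI[of _ "{x. p x > 0}"]) auto
  qed
  then obtain V where "\<And>n. good n (V n)" by metis
  then have V: "\<And>n. V n \<in> sets lebesgue" "\<And>n. K \<subseteq> V n" "\<And>n. V n \<subseteq> U n"
    "\<And>n. (LINT x|lebesgue. indicat_real (V n) x * h x) = 0" unfolding good_def by blast+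
  have hL: "integrable lebesgue (\<lambda>x. indicat_real L x * h x)"
    using int[OF p0(3,4)] by (simp add: set_integrable_def)
  have eq: "indicat_real A x * h x = indicat_real A x * (indicat_real L x * h x)" if "A \<subseteq> L" for A x
    using that by (cases "x \<in> A") auto
  have meas: "(\<lambda>x. indicat_real A x * h x) \<in> borel_measurable lebesgue" if "A \<subseteq> L" "A \<in> sets lebesgue" for A
    unfolding eq[OF that(1)]
    by (rule borel_measurable_times[OF borel_measurable_indicator[OF that(2)] borel_measurable_integrable[OF hL]])
  have VL: "V n \<subseteq> L" for n using V(3) UL by blast
  have "(\<lambda>n. LINT x|lebesgue. indicat_real (V n) x * h x) \<longlonglongrightarrow> (LINT x|lebesgue. indicat_real K x * h x)"
  proof (rule integral_dominated_convergence[OF meas meas[OF VL V(1)] integrable_norm[OF hL]])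
    show "K \<subseteq> L" using KU UL by blast
    show "K \<in> sets lebesgue" using K(1) by (simp add: lmeasurable_compact fmeasurableD)
    show "AE x in lebesgue. (\<lambda>n. indicat_real (V n) x * h x) \<longlonglongrightarrow> indicat_real K x * h x"
    proof (intro AE_I2)
      fix x
      show "(\<lambda>n. indicat_real (V n) x * h x) \<longlonglongrightarrow> indicat_real K x * h x"
      proof (cases "x \<in> K")
        case True
        then have "x \<in> V n" for n using V(2) by blast
        with True show ?thesis by simp
      next
        case x: False
        then have "infdist x K > 0"
          using K(1) False by (simp add: infdist_pos_not_in_closed compact_imp_closed)
        then obtain N where N: "1 / real (Suc N) < infdist x K"
          using nat_approx_posE by blast
        have "x \<notin> V n" if "n \<ge> N" for n
        proof -
          have "1 / real (Suc n) \<le> 1 / real (Suc N)" using that by (simp add: frac_le)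
          then have "x \<notin> U n" using N unfolding U_def by auto
          then show ?thesis using V(3) by blast
        qed
        then have "\<forall>\<^sub>F n in sequentially. indicat_real (V n) x * h x = indicat_real K x * h x"
          using x unfolding eventually_sequentially by (intro exI[of _ N]) auto
        then show ?thesis by (rule tendsto_eventually)
      qed
    qed
    show "AE x in lebesgue. norm (indicat_real (V n) x * h x) \<le> norm (indicat_real L x * h x)" for n
      using VL[of n] by (intro AE_I2) (auto simp: indicator_def)
  qed
  then show ?thesis unfolding V(4) by (simp add: LIMSEQ_const_iff)
qed simp

text \<open>By inner regularity, a set of positive measure on which \<open>h\<close> is positive would contain a compact set of
  positive measure.\<close>

lemma AE_nonpos_if_compact_integrals_eq_0:
  fixes h :: "real^2 \<Rightarrow> real"
  assumes L: "compact L" and int: "set_integrable lebesgue L h"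
    and zero: "\<And>K. compact K \<Longrightarrow> K \<subseteq> L \<Longrightarrow> (LINT x|lebesgue. indicat_real K x * h x) = 0"
  shows "AE x in lebesgue. x \<in> L \<longrightarrow> h x \<le> 0"
proof -
  have hL: "integrable lebesgue (\<lambda>x. indicat_real L x * h x)"
    using int by (simp add: set_integrable_def)
  define S where "S = {x. indicat_real L x * h x > 0}"
  have S: "S \<in> sets lebesgue"
    using borel_measurable_integrable[OF hL] borel_measurable_less[of "\<lambda>x. 0" lebesgue "\<lambda>x. indicat_real L x * h x"]
    unfolding S_def by simp
  have SL: "x \<in> S \<longleftrightarrow> x \<in> L \<and> h x > 0" for x by (auto simp: S_def indicator_def)
  have le: "emeasure lebesgue S \<le> ennreal e" if e: "e > 0" for e
  proof -
    obtain T where T: "closed T" "T \<subseteq> S" "S - T \<in> lmeasurable" "emeasure lebesgue (S - T) < ennreal e"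
      using sets_lebesgue_inner_closed[OF S e] by blast
    have TL: "T \<subseteq> L" using T(2) SL by blast
    then have "compact T" using T(1) L compact_Int_closed[of L T] by (simp add: Int_absorb1)
    then have Ts: "T \<in> sets lebesgue" by (simp add: lmeasurable_compact fmeasurableD)
    have "integrable lebesgue (\<lambda>x. indicat_real T x * (indicat_real L x * h x))"
      using integrable_mult_indicator[OF Ts hL] by simp
    moreover have eq: "indicat_real T x * (indicat_real L x * h x) = indicat_real T x * h x" for x
      using TL by (cases "x \<in> T") auto
    ultimately have i: "integrable lebesgue (\<lambda>x. indicat_real T x * h x)" by simp
    have nn: "indicat_real T x * h x \<ge> 0" for x using T(2) SL[of x] by (cases "x \<in> T") auto
    have "AE x in lebesgue. indicat_real T x * h x = 0"
      using integral_nonneg_eq_0_iff_AE[OF i] nn zero[OF \<open>compact T\<close> TL] by simp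
    then have "AE x in lebesgue. x \<notin> T"
    proof eventually_elim
      case (elim x)
      then show ?case using T(2) SL[of x] by (auto simp: indicator_def)
    qed
    then have "emeasure lebesgue T = 0" using AE_iff_null_sets[OF Ts] null_setsD1 by blast
    moreover have "emeasure lebesgue S \<le> emeasure lebesgue T + emeasure lebesgue (S - T)"
      using emeasure_subadditive[of T lebesgue "S - T"] Ts S T(2) by (simp add: Un_absorb1)
    ultimately show ?thesis using T(4) by simp
  qed
  have "emeasure lebesgue S \<le> 0"
  proof (rule ennreal_le_epsilon)
    show "emeasure lebesgue S \<le> 0 + ennreal e" if "0 < e" for e
      using le[OF that] by simp
  qed
  then have "S \<in> null_sets lebesgue" using S by (intro null_setsI) auto
  then have "AE x in lebesgue. x \<notin> S" by (rule AE_not_in)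
  then show ?thesis by eventually_elim (auto simp: SL)
qed

lemma fundamental_lemma_calculus_of_variations:
  fixes h :: "real^2 \<Rightarrow> real"
  assumes \<omega>: "open \<omega>" and int: "\<And>K. compact K \<Longrightarrow> K \<subseteq> \<omega> \<Longrightarrow> set_integrable lebesgue K h"
    and zero: "\<And>\<phi>. test_function \<omega> \<phi> \<Longrightarrow> (LINT x:\<omega>|lebesgue. h x * \<phi> x) = 0"
  shows "AE x in lebesgue. x \<in> \<omega> \<longrightarrow> h x = 0"
proof -
  obtain C :: "nat \<Rightarrow> (real^2) set" where C: "\<And>n. compact (C n)" "\<And>n. C n \<subseteq> \<omega>" "(\<Union>n. C n) = \<omega>"
    using open_Union_compact_subsets[OF \<omega>] by metis
  have "AE x in lebesgue. x \<in> C n \<longrightarrow> h x = 0" for n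
  proof -
    have z: "(LINT x|lebesgue. indicat_real K x * h x) = 0" if "compact K" "K \<subseteq> C n" for K
      using that C(2)[of n] by (intro integral_compact_eq_0[OF \<omega> int zero]) auto
    have i: "set_integrable lebesgue (C n) h" by (rule int[OF C(1,2)])
    have "AE x in lebesgue. x \<in> C n \<longrightarrow> h x \<le> 0"
      by (rule AE_nonpos_if_compact_integrals_eq_0[OF C(1) i z])
    moreover have "AE x in lebesgue. x \<in> C n \<longrightarrow> - h x \<le> 0"
    proof (rule AE_nonpos_if_compact_integrals_eq_0[OF C(1)])
      show "set_integrable lebesgue (C n) (\<lambda>x. - h x)" using i by (simp add: set_integrable_def)
      show "(LINT x|lebesgue. indicat_real K x * - h x) = 0" if "compact K" "K \<subseteq> C n" for K
        using z[OF that] by simp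
    qed
    ultimately show ?thesis by eventually_elim auto
  qed
  then have "AE x in lebesgue. \<forall>n. x \<in> C n \<longrightarrow> h x = 0"
    by (rule AE_all_countable[THEN iffD2, OF allI])
  then show ?thesis
  proof eventually_elim
    case (elim x)
    then show ?case using C(3) by blast
  qed
qed

lemma set_integrable_vec_nth:
  "set_integrable lebesgue K f \<Longrightarrow> set_integrable lebesgue K (\<lambda>x. (f x :: 'a::euclidean_space ^ 'n) $ i)"
  unfolding set_integrable_def
  by (drule integrable_bounded_linear[OF bounded_linear_vec_nth[of i]]) simp

lemma integrable_mult_compact_support:
  fixes h g :: "'a::euclidean_space \<Rightarrow> real"
  assumes h: "set_integrable lebesgue K h" and K: "compact K" "K \<subseteq> \<omega>"
    and g: "continuous_on UNIV g" "\<And>x. x \<notin> K \<Longrightarrow> g x = 0"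
  shows "set_integrable lebesgue \<omega> (\<lambda>x. h x * g x)"
proof -
  obtain B where B: "B > 0" "\<And>x. norm (g x) \<le> B"
    using bounded_compact_support[OF g(1) K(1) g(2)] by blast
  have i: "integrable lebesgue (\<lambda>x. indicat_real K x * h x)"
    using h by (simp add: set_integrable_def)
  have eq: "indicat_real \<omega> x *\<^sub>R (h x * g x) = (indicat_real K x * h x) * g x" for x
    using K(2) g(2)[of x] by (cases "x \<in> K") (auto simp: indicator_def)
  show ?thesis unfolding set_integrable_def eq
  proof (rule Bochner_Integration.integrable_bound[OF integrable_mult_right[OF i, of B]])
    show "(\<lambda>x. (indicat_real K x * h x) * g x) \<in> borel_measurable lebesgue"
      by (rule borel_measurable_times[OF borel_measurable_integrable[OF i] borel_measurable_lebesgue_continuous[OF g(1)]])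
    show "AE x in lebesgue. norm ((indicat_real K x * h x) * g x) \<le> norm (B * (indicat_real K x * h x))"
    proof (intro AE_I2)
      fix x
      have "\<bar>indicat_real K x * h x\<bar> * \<bar>g x\<bar> \<le> \<bar>indicat_real K x * h x\<bar> * B"
        using B(2)[of x] by (intro mult_left_mono) auto
      then show "norm ((indicat_real K x * h x) * g x) \<le> norm (B * (indicat_real K x * h x))"
        using B(1) by (simp add: abs_mult mult_ac)
    qed
  qed
qed

lemma weak_gradient_integrable:
  assumes f: "locally_integrable \<omega> f" and G: "locally_integrable \<omega> G" and "test_function \<omega> \<phi>"
  shows "set_integrable lebesgue \<omega> (\<lambda>x. (f x :: real^2) $ i * partial_deriv j \<phi> x)"
    and "set_integrable lebesgue \<omega> (\<lambda>x. (G x :: real^2^2) $ i $ j * \<phi> x)"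
proof -
  obtain g K where t: "\<And>x. has_gradient \<phi> (g x) x" "continuous_on UNIV g"
    "compact K" "K \<subseteq> \<omega>" "\<And>x. x \<notin> K \<Longrightarrow> \<phi> x = 0" "\<And>x. x \<notin> K \<Longrightarrow> g x = 0"
    "\<And>x j. partial_deriv j \<phi> x = g x $ j"
    using assms(3) by (rule test_functionE) blast
  have c: "continuous_on UNIV \<phi>" by (rule continuous_on_if_derivative[OF t(1)])
  have "set_integrable lebesgue K f" "set_integrable lebesgue K G"
    using f G t(3,4) by (auto simp: locally_integrable_def)
  then have "set_integrable lebesgue K (\<lambda>x. f x $ i)" "set_integrable lebesgue K (\<lambda>x. G x $ i $ j)"
    by (auto intro: set_integrable_vec_nth)
  then show "set_integrable lebesgue \<omega> (\<lambda>x. f x $ i * partial_deriv j \<phi> x)"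
    "set_integrable lebesgue \<omega> (\<lambda>x. G x $ i $ j * \<phi> x)"
    using t c by (auto intro!: integrable_mult_compact_support[of K] continuous_intros)
qed

lemma locally_integrable_add:
  "locally_integrable \<omega> f \<Longrightarrow> locally_integrable \<omega> g \<Longrightarrow> locally_integrable \<omega> (\<lambda>x. f x + g x)"
  unfolding locally_integrable_def by (auto intro!: set_integral_add)

lemma has_weak_gradient_add:
  assumes "has_weak_gradient \<omega> u G" and "has_weak_gradient \<omega> v H"
  shows "has_weak_gradient \<omega> (\<lambda>x. u x + v x) (\<lambda>x. G x + H x)"
proof -
  have l: "locally_integrable \<omega> u" "locally_integrable \<omega> G" "locally_integrable \<omega> v" "locally_integrable \<omega> H"
    and e: "\<And>\<phi> i j. test_function \<omega> \<phi> \<Longrightarrow> (LINT x:\<omega>|lebesgue. u x $ i * partial_deriv j \<phi> x)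
          = - (LINT x:\<omega>|lebesgue. G x $ i $ j * \<phi> x)"
    "\<And>\<phi> i j. test_function \<omega> \<phi> \<Longrightarrow> (LINT x:\<omega>|lebesgue. v x $ i * partial_deriv j \<phi> x)
          = - (LINT x:\<omega>|lebesgue. H x $ i $ j * \<phi> x)"
    using assms unfolding has_weak_gradient_def by blast+
  show ?thesis unfolding has_weak_gradient_def
  proof (intro conjI allI impI)
    fix \<phi> i j assume t: "test_function \<omega> \<phi>"
    show "(LINT x:\<omega>|lebesgue. (u x + v x) $ i * partial_deriv j \<phi> x)
          = - (LINT x:\<omega>|lebesgue. (G x + H x) $ i $ j * \<phi> x)"
      unfolding vector_add_component distrib_right
      using e[OF t] weak_gradient_integrable[OF l(1,2) t] weak_gradient_integrable[OF l(3,4) t]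
      by (simp add: set_integral_add)
  qed (use l in \<open>auto intro: locally_integrable_add\<close>)
qed

lemma weak_gradient_unique:
  assumes \<omega>: "open \<omega>" and "has_weak_gradient \<omega> u G" and "has_weak_gradient \<omega> u H"
  shows "AE x in lebesgue. x \<in> \<omega> \<longrightarrow> G x = H x"
proof -
  have l: "locally_integrable \<omega> u" "locally_integrable \<omega> G" "locally_integrable \<omega> H"
    and e: "\<And>\<phi> i j. test_function \<omega> \<phi> \<Longrightarrow> (LINT x:\<omega>|lebesgue. u x $ i * partial_deriv j \<phi> x)
          = - (LINT x:\<omega>|lebesgue. G x $ i $ j * \<phi> x)"
    "\<And>\<phi> i j. test_function \<omega> \<phi> \<Longrightarrow> (LINT x:\<omega>|lebesgue. u x $ i * partial_deriv j \<phi> x)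
          = - (LINT x:\<omega>|lebesgue. H x $ i $ j * \<phi> x)"
    using assms unfolding has_weak_gradient_def by blast+
  have "AE x in lebesgue. x \<in> \<omega> \<longrightarrow> G x $ i $ j - H x $ i $ j = 0" for i j
  proof (rule fundamental_lemma_calculus_of_variations[OF \<omega>])
    fix K :: "(real^2) set" assume "compact K" "K \<subseteq> \<omega>"
    then show "set_integrable lebesgue K (\<lambda>x. G x $ i $ j - H x $ i $ j)"
      using l by (intro set_integral_diff set_integrable_vec_nth) (auto simp: locally_integrable_def)
  next
    fix \<phi> assume t: "test_function \<omega> \<phi>"
    show "(LINT x:\<omega>|lebesgue. (G x $ i $ j - H x $ i $ j) * \<phi> x) = 0"
      unfolding left_diff_distrib
      using e[OF t, of i j] weak_gradient_integrable(2)[OF l(1,2) t] weak_gradient_integrable(2)[OF l(1,3) t]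
      by (simp add: set_integral_diff)
  qed
  then have "AE x in lebesgue. x \<in> \<omega> \<longrightarrow> G x $ 1 $ 1 - H x $ 1 $ 1 = 0" "AE x in lebesgue. x \<in> \<omega> \<longrightarrow> G x $ 1 $ 2 - H x $ 1 $ 2 = 0"
    "AE x in lebesgue. x \<in> \<omega> \<longrightarrow> G x $ 2 $ 1 - H x $ 2 $ 1 = 0" "AE x in lebesgue. x \<in> \<omega> \<longrightarrow> G x $ 2 $ 2 - H x $ 2 $ 2 = 0"
    by blast+
  then show ?thesis
    by eventually_elim (simp add: vec_eq_iff forall_2)
qed

lemma weak_gradient_eq_AE:
  assumes "open \<omega>" and "has_weak_gradient \<omega> u G"
  shows "AE x in lebesgue. x \<in> \<omega> \<longrightarrow> weak_gradient \<omega> u x = G x"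
proof -
  have "has_weak_gradient \<omega> u (weak_gradient \<omega> u)"
    unfolding weak_gradient_def by (rule someI[of "has_weak_gradient \<omega> u", OF assms(2)])
  then show ?thesis using assms by (intro weak_gradient_unique)
qed

section \<open>Classical gradients are weak gradients\<close>

text \<open>The product of a test function with a component of \<open>v\<close>, extended by zero, is differentiable almost
  everywhere, so that its partial derivatives have integral zero as soon as it is Lipschitz. The two
  lemmas at the end of this section establish the Lipschitz property for the two classes of data.\<close>

lemma has_weak_gradient_classical:
  fixes v :: "real^2 \<Rightarrow> real^2"
  assumes \<omega>: "open \<omega>" and \<Omega>: "open \<Omega>" "\<Omega> \<subseteq> \<omega>" "negligible (\<omega> - \<Omega>)"
    and v: "continuous_on \<omega> v"
    and G: "continuous_on \<Omega> G" "\<And>x. x \<in> \<Omega> \<Longrightarrow> norm (G x) \<le> B"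
    and der: "\<And>x. x \<in> \<Omega> \<Longrightarrow> (v has_derivative (\<lambda>h. G x *v h)) (at x)"
    and lip: "\<And>\<phi> i. test_function \<omega> \<phi> \<Longrightarrow> \<exists>L. L-lipschitz_on UNIV (\<lambda>x. if x \<in> \<omega> then \<phi> x * v x $ i else 0)"
  shows "has_weak_gradient \<omega> v (\<lambda>x. indicat_real \<Omega> x *\<^sub>R G x)"
proof -
  let ?G = "\<lambda>x. indicat_real \<Omega> x *\<^sub>R G x"
  have mG: "?G \<in> borel_measurable lebesgue" by (rule indicator_continuous_measurable[OF \<Omega>(1) G(1)])
  have "norm (?G x) \<le> \<bar>B\<bar>" for x using G(2)[of x] by (auto simp: indicator_def)
  then have lG: "locally_integrable \<omega> ?G"
    unfolding locally_integrable_def using mG by (auto intro!: set_integrable_bounded_compact[of _ "\<bar>B\<bar>"])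
  have lv: "locally_integrable \<omega> v"
    unfolding locally_integrable_def set_integrable_def
  proof (intro allI impI, elim conjE)
    fix K assume K: "compact K" "K \<subseteq> \<omega>"
    have "integrable lborel (\<lambda>x. indicat_real K x *\<^sub>R v x)"
      using K v by (intro borel_integrable_compact) (auto intro: continuous_on_subset)
    then show "integrable lebesgue (\<lambda>x. indicat_real K x *\<^sub>R v x)"
      using integrable_completion borel_measurable_integrable by blast
  qed
  have "(LINT x:\<omega>|lebesgue. v x $ i * partial_deriv j \<phi> x) = - (LINT x:\<omega>|lebesgue. ?G x $ i $ j * \<phi> x)"
    if t: "test_function \<omega> \<phi>" for \<phi> i j
  proof -
    obtain g K where g: "\<And>x. has_gradient \<phi> (g x) x" "continuous_on UNIV g"
      "compact K" "K \<subseteq> \<omega>" "\<And>x. x \<notin> K \<Longrightarrow> \<phi> x = 0" "\<And>x. x \<notin> K \<Longrightarrow> g x = 0"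
      "\<And>x j. partial_deriv j \<phi> x = g x $ j"
      using t by (rule test_functionE) blast
    define F where "F x = (if x \<in> \<omega> then \<phi> x * v x $ i else 0)" for x
    define D where "D x = indicat_real \<omega> x *\<^sub>R (v x $ i * g x $ j) + indicat_real \<omega> x *\<^sub>R (?G x $ i $ j * \<phi> x)" for x
    obtain L where L: "L-lipschitz_on UNIV F" using lip[OF t, of i] unfolding F_def by blast
    obtain R where R: "\<And>x. x \<in> K \<Longrightarrow> norm x \<le> R"
      using compact_imp_bounded[OF g(3)] by (auto simp: bounded_iff)
    have i: "integrable lebesgue (\<lambda>x. indicat_real \<omega> x *\<^sub>R (v x $ i * g x $ j))"
      "integrable lebesgue (\<lambda>x. indicat_real \<omega> x *\<^sub>R (?G x $ i $ j * \<phi> x))"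
      using weak_gradient_integrable[OF lv lG t, of i j] unfolding set_integrable_def g(7) by auto
    have "AE x in lebesgue. x \<notin> \<omega> - \<Omega>"
      using \<Omega>(3) by (intro AE_not_in) (simp add: negligible_iff_null_sets)
    then have "AE x in lebesgue. ((\<lambda>t. F (x + t *\<^sub>R axis j 1)) has_real_derivative D x) (at 0)"
    proof eventually_elim
      case (elim x)
      show ?case
      proof (cases "x \<in> \<omega>")
        case True
        then have x: "x \<in> \<Omega>" using elim by blast
        have vi: "has_gradient (\<lambda>y. v y $ i) (G x $ i) x"
          using bounded_linear.has_derivative[OF bounded_linear_vec_nth der[OF x], of i]
          by (simp add: matrix_vector_mul_component)
        have "has_gradient (\<lambda>y. \<phi> y * v y $ i) (\<phi> x *\<^sub>R G x $ i + v x $ i *\<^sub>R g x) x"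
          by (rule has_derivative_eq_rhs[OF has_derivative_mult[OF g(1) vi]])
            (auto simp: fun_eq_iff inner_add_left mult.commute)
        then have "has_gradient F (\<phi> x *\<^sub>R G x $ i + v x $ i *\<^sub>R g x) x"
          by (rule has_derivative_transform_within_open[OF _ \<omega> True]) (simp add: F_def)
        from has_gradient_imp_directional[OF this, of "axis j 1"] show ?thesis
          using True x by (simp add: D_def inner_add_left inner_axis mult.commute add.commute)
      next
        case False
        have "((\<lambda>y. 0) has_derivative (\<lambda>h. 0)) (at x)" by simp
        then have "(F has_derivative (\<lambda>h. 0)) (at x)"
        proof (rule has_derivative_transform_within_open)
          show "open (- K)" using g(3) by (simp add: compact_imp_closed open_Compl)
          show "x \<in> - K" using False g(4) by blast
          show "0 = F y" if "y \<in> - K" for y using that g(5) by (simp add: F_def)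
        qed
        then have "has_gradient F 0 x" by simp
        from has_gradient_imp_directional[OF this, of "axis j 1"] show ?thesis
          using False by (simp add: D_def)
      qed
    qed
    then have "(LINT x|lebesgue. D x) = 0"
    proof (rule integral_partial_derivative_eq_0[OF L, rotated 2])
      show "F x = 0" if "x \<notin> cball 0 R" for x
        using R[of x] g(5)[of x] that by (auto simp: F_def)
      show "D \<in> borel_measurable lebesgue"
        unfolding D_def by (intro borel_measurable_add borel_measurable_integrable i)
    qed
    then show ?thesis
      unfolding D_def set_lebesgue_integral_def g(7)
      by (subst (asm) Bochner_Integration.integral_add[OF i]) simp
  qed
  with lv lG show ?thesis unfolding has_weak_gradient_def by blast
qed

lemma test_function_bounds:
  assumes "test_function \<omega> \<phi>"
  obtains g B where "\<And>x. has_gradient \<phi> (g x) x" "B \<ge> 0" "\<And>x. norm (g x) \<le> B" "\<And>x. \<bar>\<phi> x\<bar> \<le> B"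
    "B-lipschitz_on UNIV \<phi>" "\<And>x. x \<notin> \<omega> \<Longrightarrow> \<phi> x = 0"
proof -
  obtain g K where g: "\<And>x. has_gradient \<phi> (g x) x" "continuous_on UNIV g"
    "compact K" "K \<subseteq> \<omega>" "\<And>x. x \<notin> K \<Longrightarrow> \<phi> x = 0" "\<And>x. x \<notin> K \<Longrightarrow> g x = 0"
    "\<And>x j. partial_deriv j \<phi> x = g x $ j"
    using assms by (rule test_functionE) blast
  obtain B1 where B1: "B1 > 0" "\<And>x. norm (g x) \<le> B1"
    using bounded_compact_support[OF g(2,3,6)] by blast
  obtain B2 where B2: "B2 > 0" "\<And>x. norm (\<phi> x) \<le> B2"
    using bounded_compact_support[OF continuous_on_if_derivative[OF g(1)] g(3,5)] by blast
  have b: "norm (g x) \<le> max B1 B2" "\<bar>\<phi> x\<bar> \<le> max B1 B2" for x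
    using B1(2)[of x] B2(2)[of x] by auto
  show ?thesis
  proof (rule that[of g "max B1 B2"])
    show "(max B1 B2)-lipschitz_on UNIV \<phi>" by (rule lipschitz_on_bounded_gradient[OF g(1) b(1)])
    show "\<phi> x = 0" if "x \<notin> \<omega>" for x using that g(4,5) by blast
  qed (use g(1) b B1 in auto)
qed

lemma lipschitz_product_if_lipschitz:
  fixes v :: "real^2 \<Rightarrow> real^2"
  assumes t: "test_function \<omega> \<phi>" and v: "L-lipschitz_on \<omega> v" "\<And>x. x \<in> \<omega> \<Longrightarrow> norm (v x) \<le> M"
  shows "\<exists>L. L-lipschitz_on UNIV (\<lambda>x. if x \<in> \<omega> then \<phi> x * v x $ i else 0)"
proof -
  obtain g B where g: "\<And>x. has_gradient \<phi> (g x) x" "B \<ge> 0" "\<And>x. norm (g x) \<le> B" "\<And>x. \<bar>\<phi> x\<bar> \<le> B"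
    "B-lipschitz_on UNIV \<phi>" "\<And>x. x \<notin> \<omega> \<Longrightarrow> \<phi> x = 0"
    using t by (rule test_function_bounds) blast
  have L: "L \<ge> 0" using v(1) by (rule lipschitz_on_nonneg)
  have vi: "\<bar>v x $ i\<bar> \<le> \<bar>M\<bar>" if "x \<in> \<omega>" for x
    using component_le_norm_cart[of "v x" i] v(2)[OF that] by linarith
  have \<phi>: "\<bar>\<phi> x - \<phi> y\<bar> \<le> B * dist x y" for x y
    using lipschitz_onD[OF g(5), of x y] by (simp add: dist_real_def)
  define F where "F x = (if x \<in> \<omega> then \<phi> x * v x $ i else 0)" for x
  have F: "F x = \<phi> x * v x $ i" for x using g(6)[of x] by (auto simp: F_def)
  have *: "\<bar>F x - F y\<bar> \<le> (B * L + B * \<bar>M\<bar>) * dist x y" if y: "y \<in> \<omega>" for x y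
  proof -
    have 1: "\<bar>\<phi> x - \<phi> y\<bar> * \<bar>v y $ i\<bar> \<le> (B * dist x y) * \<bar>M\<bar>"
      using \<phi>[of x y] vi[OF y] g(2) by (intro mult_mono) auto
    have 2: "\<bar>\<phi> x\<bar> * \<bar>v x $ i - v y $ i\<bar> \<le> B * (L * dist x y)"
    proof (cases "x \<in> \<omega>")
      case True
      have "\<bar>v x $ i - v y $ i\<bar> \<le> L * dist x y"
        using component_le_norm_cart[of "v x - v y" i] lipschitz_onD[OF v(1) True y] by (simp add: dist_norm)
      then show ?thesis using g(4)[of x] g(2) by (intro mult_mono) auto
    qed (use g L in auto)
    have "F x - F y = \<phi> x * (v x $ i - v y $ i) + (\<phi> x - \<phi> y) * v y $ i"
      unfolding F by (simp add: algebra_simps)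
    then have "\<bar>F x - F y\<bar> \<le> \<bar>\<phi> x\<bar> * \<bar>v x $ i - v y $ i\<bar> + \<bar>\<phi> x - \<phi> y\<bar> * \<bar>v y $ i\<bar>"
      using abs_triangle_ineq by (simp flip: abs_mult)
    with 1 2 show ?thesis by (simp add: algebra_simps)
  qed
  have "(B * L + B * \<bar>M\<bar>)-lipschitz_on UNIV F"
  proof (rule lipschitz_onI)
    fix x y :: "real^2"
    show "dist (F x) (F y) \<le> (B * L + B * \<bar>M\<bar>) * dist x y"
    proof (cases "y \<in> \<omega>")
      case True
      then show ?thesis using *[of y x] by (simp add: dist_real_def)
    next
      case y: False
      show ?thesis
      proof (cases "x \<in> \<omega>")
        case True
        then show ?thesis using *[of x y] by (simp add: dist_real_def dist_commute abs_minus_commute)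
      qed (use y g(2) L in \<open>simp add: F_def\<close>)
    qed
  qed (use g(2) L in auto)
  then show ?thesis unfolding F_def by blast
qed

text \<open>A bound on the gradient of \<open>v\<close> controls differences only along segments inside \<open>\<omega>\<close>. The product,
  extended by zero, has a bounded gradient on the whole plane, where all segments are available.\<close>

lemma lipschitz_product_if_C1:
  fixes v :: "real^2 \<Rightarrow> real^2"
  assumes t: "test_function \<omega> \<phi>" and \<omega>: "open \<omega>" and v: "\<And>x. x \<in> \<omega> \<Longrightarrow> norm (v x) \<le> M"
    and G: "\<And>x. x \<in> \<omega> \<Longrightarrow> norm (G x) \<le> N"
    and der: "\<And>x. x \<in> \<omega> \<Longrightarrow> (v has_derivative (\<lambda>h. G x *v h)) (at x)"
  shows "\<exists>L. L-lipschitz_on UNIV (\<lambda>x. if x \<in> \<omega> then \<phi> x * v x $ i else 0)"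
proof -
  obtain g B where b: "\<And>x. norm (g x) \<le> B" "\<And>x. \<bar>\<phi> x\<bar> \<le> B" "B \<ge> 0"
    and d\<phi>: "\<And>x. has_gradient \<phi> (g x) x"
    using t by (rule test_function_bounds) blast
  obtain K where K: "compact K" "K \<subseteq> \<omega>" "\<And>x. x \<notin> K \<Longrightarrow> \<phi> x = 0"
    using t by (rule test_functionE) blast
  define F where "F x = (if x \<in> \<omega> then \<phi> x * v x $ i else 0)" for x
  define D where "D x = (if x \<in> \<omega> then \<phi> x *\<^sub>R G x $ i + v x $ i *\<^sub>R g x else 0)" for x
  have "has_gradient F (D x) x" for x
  proof (cases "x \<in> \<omega>")
    case x: True
    have vi: "has_gradient (\<lambda>y. v y $ i) (G x $ i) x"
      using bounded_linear.has_derivative[OF bounded_linear_vec_nth der[OF x], of i]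
      by (simp add: matrix_vector_mul_component)
    have "has_gradient (\<lambda>y. \<phi> y * v y $ i) (D x) x"
      by (rule has_derivative_eq_rhs[OF has_derivative_mult[OF d\<phi> vi]])
        (use x in \<open>auto simp: D_def fun_eq_iff inner_add_left mult.commute\<close>)
    then show ?thesis
      by (rule has_derivative_transform_within_open[OF _ \<omega> x]) (simp add: F_def)
  next
    case False
    have "((\<lambda>y. 0) has_derivative (\<lambda>h. 0)) (at x)" by simp
    then have "(F has_derivative (\<lambda>h. 0)) (at x)"
    proof (rule has_derivative_transform_within_open)
      show "open (- K)" using K(1) by (simp add: compact_imp_closed open_Compl)
      show "x \<in> - K" using False K(2) by blast
      show "0 = F y" if "y \<in> - K" for y using that K(3) by (simp add: F_def)
    qed
    then show ?thesis using False by (simp add: D_def)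
  qed
  moreover have "norm (D x) \<le> B * \<bar>N\<bar> + \<bar>M\<bar> * B" for x
  proof (cases "x \<in> \<omega>")
    case True
    have "norm (G x $ i) \<le> \<bar>N\<bar>"
      using Finite_Cartesian_Product.norm_nth_le[of "G x" i] G[OF True] by linarith
    then have "\<bar>\<phi> x\<bar> * norm (G x $ i) \<le> B * \<bar>N\<bar>" using b(2)[of x] b(3) by (intro mult_mono) auto
    moreover have "\<bar>v x $ i\<bar> \<le> \<bar>M\<bar>" using component_le_norm_cart[of "v x" i] v[OF True] by linarith
    then have "\<bar>v x $ i\<bar> * norm (g x) \<le> \<bar>M\<bar> * B" using b(1)[of x] by (intro mult_mono) auto
    ultimately show ?thesis
      using True norm_triangle_ineq[of "\<phi> x *\<^sub>R G x $ i" "v x $ i *\<^sub>R g x"] by (simp add: D_def)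
  qed (use b(3) in \<open>simp add: D_def\<close>)
  ultimately have "(B * \<bar>N\<bar> + \<bar>M\<bar> * B)-lipschitz_on UNIV F"
    by (rule lipschitz_on_bounded_gradient)
  then show ?thesis unfolding F_def by blast
qed

section \<open>The geometry of trace-free matrices\<close>

lemma norm_matrix_le_entries:
  fixes A :: "real^2^2"
  shows "norm A \<le> \<bar>A$1$1\<bar> + \<bar>A$1$2\<bar> + \<bar>A$2$1\<bar> + \<bar>A$2$2\<bar>"
proof -
  have "norm A \<le> (\<Sum>i\<in>UNIV. norm (A $ i))"
    unfolding norm_vec_def by (intro L2_set_le_sum) auto
  also have "\<dots> \<le> (\<Sum>i\<in>UNIV. \<Sum>j\<in>UNIV. \<bar>A $ i $ j\<bar>)"
    by (intro sum_mono norm_le_l1_cart)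
  finally show ?thesis by (simp add: sum_2)
qed

lemma norm_matrix_sq:
  fixes A :: "real^2^2"
  shows "(norm A)\<^sup>2 = (A$1$1)\<^sup>2 + (A$1$2)\<^sup>2 + (A$2$1)\<^sup>2 + (A$2$2)\<^sup>2"
  unfolding power2_norm_eq_inner by (simp add: inner_vec_def sum_2 power2_eq_square)

lemma norm_matrix_nth_le: "\<bar>(A::real^2^2) $ i $ j\<bar> \<le> norm A"
  using component_le_norm_cart[of "A $ i" j] Finite_Cartesian_Product.norm_nth_le[of A i] by linarith

text \<open>Up to a scalar function, this is the gradient of the rotated gradient of a function of \<open>b \<bullet> x\<close>. It is
  \<open>c \<otimes> b\<close> for the vector \<open>c\<close> obtained by rotating \<open>b\<close> by a right angle.\<close>

definition rank_one :: "real^2 \<Rightarrow> real^2^2" where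
  "rank_one b = (\<chi> i j. (if i = 1 then - b $ 2 else b $ 1) * b $ j)"

lemma norm_rank_one: "norm b = 1 \<Longrightarrow> norm (rank_one b) = 1"
proof -
  assume "norm b = 1"
  then have "b $ 1 ^ 2 + b $ 2 ^ 2 = 1"
    using power2_norm_eq_inner[of b] by (simp add: inner_vec_def sum_2 power2_eq_square)
  then have "(norm (rank_one b))\<^sup>2 = 1"
    unfolding norm_matrix_sq by (simp add: rank_one_def) algebra
  then show ?thesis using norm_ge_zero[of "rank_one b"] unfolding power2_eq_1_iff by linarith
qed

text \<open>Complex values give access to polar coordinates, in which the rank-one directions are easy to find.\<close>

definition dev :: "real^2^2 \<Rightarrow> complex" where
  "dev A = Complex ((A$1$1 - A$2$2) / 2) ((A$1$2 + A$2$1) / 2)"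

definition skw :: "real^2^2 \<Rightarrow> real" where
  "skw A = (A$2$1 - A$1$2) / 2"

text \<open>The second inequality confines the skew part. The cone \<open>\<bar>s\<bar> = \<bar>z\<bar> + C\<close> is ruled by rank-one lines, so
  that they can be followed up to the boundary; a bound \<open>\<bar>s\<bar> < C\<close> would not leave room for this.
  The trace is treated separately, so that the region is open in the space of all matrices.\<close>

definition admissible :: "real \<Rightarrow> (real^2^2) set" where
  "admissible C = {A. cmod (dev A) < 3/4 \<and> \<bar>skw A\<bar> < cmod (dev A) + C}"

definition deficit :: "real^2^2 \<Rightarrow> real" where
  "deficit A = 3/4 - cmod (dev A)"

lemma dev_add: "dev (A + B) = dev A + dev B" and dev_scaleR: "dev (c *\<^sub>R A) = c *\<^sub>R dev A"
  by (simp_all add: dev_def complex_eq_iff field_simps)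

lemma skw_add: "skw (A + B) = skw A + skw B" and skw_scaleR: "skw (c *\<^sub>R A) = c * skw A"
  by (simp_all add: skw_def field_simps)

lemma continuous_on_dev [continuous_intros]: "continuous_on S f \<Longrightarrow> continuous_on S (\<lambda>x. dev (f x))"
  and continuous_on_skw [continuous_intros]: "continuous_on S f \<Longrightarrow> continuous_on S (\<lambda>x. skw (f x))"
  unfolding dev_def skw_def by (intro continuous_intros; simp)+

lemma open_admissible: "open (admissible C)"
  unfolding admissible_def by (intro open_Collect_conj open_Collect_less continuous_intros)

text \<open>This bound on the admissible region is what makes the limit of the construction Lipschitz.\<close>

lemma admissible_norm_le:
  assumes "A \<in> admissible C" and "trace A = 0"
  shows "norm A \<le> 5 + 2 * C"
proof -
  have d: "cmod (dev A) < 3/4" "\<bar>skw A\<bar> < 3/4 + C" using assms(1) by (auto simp: admissible_def)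
  have "\<bar>Re (dev A)\<bar> < 3/4" "\<bar>Im (dev A)\<bar> < 3/4"
    using d(1) abs_Re_le_cmod[of "dev A"] abs_Im_le_cmod[of "dev A"] by linarith+
  moreover have "A$1$1 = Re (dev A)" "A$2$2 = - Re (dev A)"
    "A$1$2 = Im (dev A) - skw A" "A$2$1 = Im (dev A) + skw A"
    using assms(2) by (simp_all add: trace_def sum_2 dev_def skw_def field_simps)
  ultimately have "\<bar>A$1$1\<bar> \<le> 3/4" "\<bar>A$2$2\<bar> \<le> 3/4" "\<bar>A$1$2\<bar> \<le> 3/2 + C" "\<bar>A$2$1\<bar> \<le> 3/2 + C"
    using d(2) by linarith+
  then show ?thesis using norm_matrix_le_entries[of A] by linarith
qed

text \<open>For \<open>b = (cos \<beta>, sin \<beta>)\<close> the number \<open>dev (rank_one b)\<close> is \<open>\<i> / 2 * cis (2 * \<beta>)\<close>, which covers the whole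
  circle of radius \<open>1/2\<close>, while \<open>skw (rank_one b)\<close> is always \<open>1/2\<close>.\<close>

lemma ex_rank_one_dev:
  assumes "cmod w = 1"
  obtains b where "norm b = 1" "dev (rank_one b) = w / 2" "skw (rank_one b) = 1 / 2"
proof -
  have "cmod (- \<i> * w) = 1" using assms by (simp add: norm_mult)
  then obtain s where s: "- \<i> * w = cis s"
    using cis_Arg[of "- \<i> * w"] by (metis norm_eq_zero sgn_eq div_by_1 of_real_1 zero_neq_one)
  then have "w = \<i> * cis s" by (metis complex_i_mult_minus minus_minus mult.assoc mult_minus_left)
  define b :: "real^2" where "b = vector [cos (s/2), sin (s/2)]"
  have b: "b $ 1 = cos (s/2)" "b $ 2 = sin (s/2)" by (simp_all add: b_def)
  have "(norm b)\<^sup>2 = 1" unfolding power2_norm_eq_inner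
    by (simp add: inner_vec_def sum_2 b power2_eq_square[symmetric])
  then have nb: "norm b = 1" using norm_ge_zero[of b] unfolding power2_eq_1_iff by linarith
  have "cos s = (cos (s/2))\<^sup>2 - (sin (s/2))\<^sup>2" "sin s = 2 * sin (s/2) * cos (s/2)"
    using cos_double[of "s/2"] sin_double[of "s/2"] by simp_all
  then have "dev (rank_one b) = w / 2"
    unfolding \<open>w = \<i> * cis s\<close> by (simp add: dev_def rank_one_def b complex_eq_iff power2_eq_square)
  moreover have "skw (rank_one b) = 1 / 2"
    using sin_cos_squared_add[of "s/2"] by (simp add: skw_def rank_one_def b power2_eq_square)
  ultimately show ?thesis using nb that by blast
qed

text \<open>The direction is chosen such that \<open>dev\<close> moves radially. Both \<open>\<bar>z\<bar>\<close> and \<open>\<bar>s\<bar>\<close> then change by the same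
  amount with the same sign, up to reflection at zero; the condition \<open>C \<ge> 1\<close> takes care of the
  reflected part, because the segment is shorter than \<open>1\<close>.\<close>

lemma ex_rank_one_segment:
  assumes A: "A \<in> admissible C" and C: "C \<ge> 1"
  obtains b where "norm b = 1"
    "\<And>\<tau>. \<bar>\<tau>\<bar> \<le> (3/4 - cmod (dev A)) / 2 \<Longrightarrow> A + (2 * \<tau>) *\<^sub>R rank_one b \<in> admissible C"
proof -
  define \<rho> where "\<rho> = cmod (dev A)"
  \<comment> \<open>The sign makes \<open>s\<close> grow in modulus exactly when \<open>z\<close> does, so that the segment runs
    parallel to the generators of the cone \<open>\<bar>s\<bar> = \<bar>z\<bar> + C\<close>.\<close>
  define \<sigma> :: real where "\<sigma> = (if skw A \<ge> 0 then 1 else -1)"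
  define w where "w = \<sigma> *\<^sub>R (if dev A = 0 then 1 else dev A / \<rho>)"
  have "cmod w = 1" by (simp add: w_def \<sigma>_def \<rho>_def norm_divide)
  then obtain b where b: "norm b = 1" "dev (rank_one b) = w / 2" "skw (rank_one b) = 1 / 2"
    by (rule ex_rank_one_dev)
  have dA: "dev A = (\<sigma> * \<rho>) *\<^sub>R w"
    by (simp add: w_def \<sigma>_def \<rho>_def complex_eq_iff)
  have "A + (2 * \<tau>) *\<^sub>R rank_one b \<in> admissible C" if \<tau>: "\<bar>\<tau>\<bar> \<le> (3/4 - cmod (dev A)) / 2" for \<tau>
  proof -
    have "dev (A + (2 * \<tau>) *\<^sub>R rank_one b) = (\<sigma> * \<rho> + \<tau>) *\<^sub>R w"
      unfolding dev_add dev_scaleR dA b(2) by (simp add: complex_eq_iff algebra_simps)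
    then have 1: "cmod (dev (A + (2 * \<tau>) *\<^sub>R rank_one b)) = \<bar>\<sigma> * \<rho> + \<tau>\<bar>"
      using \<open>cmod w = 1\<close> by simp
    have 2: "skw (A + (2 * \<tau>) *\<^sub>R rank_one b) = skw A + \<tau>"
      by (simp add: skw_add skw_scaleR b(3))
    have "\<rho> < 3/4" "\<bar>skw A\<bar> < \<rho> + C" "\<rho> \<ge> 0" using A by (auto simp: admissible_def \<rho>_def)
    moreover have "\<bar>\<tau>\<bar> \<le> (3/4 - \<rho>) / 2" using \<tau> by (simp add: \<rho>_def)
    ultimately show ?thesis unfolding admissible_def mem_Collect_eq 1 2 using C
      by (cases "skw A \<ge> 0") (simp_all add: \<sigma>_def abs_real_def split: if_splits)
  qed
  with b(1) show ?thesis by (rule that)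
qed

lemma norm_strain_sq:
  fixes A :: "real^2^2"
  assumes "trace A = 0"
  shows "(norm ((1/2) *\<^sub>R (A + transpose A)))\<^sup>2 = 2 * (cmod (dev A))\<^sup>2"
proof -
  have "A$2$2 = - A$1$1" using assms by (simp add: trace_def sum_2)
  then show ?thesis
    unfolding norm_matrix_sq cmod_power2 by (simp add: transpose_def dev_def field_simps power2_eq_square)
qed

text \<open>If \<open>s\<close> is the argument of \<open>dev A\<close>, then \<open>n\<close> is the unit vector with half this angle.\<close>

lemma strain_in_Uset:
  fixes A :: "real^2^2"
  assumes "trace A = 0" and "cmod (dev A) = 3/4"
  shows "(1/2) *\<^sub>R (A + transpose A) \<in> Uset"
proof -
  have "dev A = complex_of_real (3/4) * cis (Arg (dev A))"
    using rcis_cmod_Arg[of "dev A"] unfolding rcis_def assms(2) by (rule sym)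
  then obtain s where s: "dev A = complex_of_real (3/4) * cis s" by blast
  define n :: "real^2" where "n = vector [cos (s/2), sin (s/2)]"
  have n: "n $ 1 = cos (s/2)" "n $ 2 = sin (s/2)" by (simp_all add: n_def)
  have "(norm n)\<^sup>2 = 1" unfolding power2_norm_eq_inner
    by (simp add: inner_vec_def sum_2 n power2_eq_square[symmetric])
  then have "n \<in> sphere 0 1" using norm_ge_zero[of n] unfolding power2_eq_1_iff by simp
  moreover have "(1/2) *\<^sub>R (A + transpose A) = Umat n"
  proof -
    have cs: "cos s = 2 * (cos (s/2))\<^sup>2 - 1" "cos s = 1 - 2 * (sin (s/2))\<^sup>2" "sin s = 2 * sin (s/2) * cos (s/2)"
      using cos_double_cos[of "s/2"] cos_double_sin[of "s/2"] sin_double[of "s/2"] by simp_all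
    have "A$2$2 = - A$1$1" using assms(1) by (simp add: trace_def sum_2)
    moreover have "A$1$1 - A$2$2 = 3/2 * cos s" "A$1$2 + A$2$1 = 3/2 * sin s"
      using arg_cong[OF s, of Re] arg_cong[OF s, of Im] by (simp_all add: dev_def)
    ultimately have "A$1$1 = 3/4 * cos s" "A$2$2 = - (3/4 * cos s)" "A$1$2 + A$2$1 = 3/2 * sin s"
      by simp_all
    moreover have "Umat n $ 1 $ 1 = 3/4 * (2 * (cos (s/2))\<^sup>2 - 1)" "Umat n $ 2 $ 2 = 3/4 * (2 * (sin (s/2))\<^sup>2 - 1)"
      "Umat n $ 1 $ 2 = 3/4 * (2 * sin (s/2) * cos (s/2))" "Umat n $ 2 $ 1 = 3/4 * (2 * sin (s/2) * cos (s/2))"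
      by (simp_all add: Umat_def mat_def n power2_eq_square)
    moreover have "(2 * (cos (s/2))\<^sup>2 - 1) = cos s" "(2 * (sin (s/2))\<^sup>2 - 1) = - cos s"
      using cs by simp_all
    ultimately show ?thesis
      unfolding vec_eq_iff forall_2 by (simp add: transpose_def cs(3) add.commute)
  qed
  ultimately show ?thesis unfolding Uset_def by blast
qed

lemma strain_in_Sym0: "trace A = 0 \<Longrightarrow> (1/2) *\<^sub>R (A + transpose A) \<in> Sym0"
  by (simp add: Sym0_def trace_def sum_2 transpose_def vec_eq_iff add.commute field_simps)

lemma Vt_eq_0:
  assumes "E \<in> Uset"
  shows "Vt E = 0"
proof -
  obtain U where "Vt E = (norm (E - U))\<^sup>2" "\<forall>U'\<in>Uset. Vt E \<le> (norm (E - U'))\<^sup>2"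
    using Vt_attained by blast
  with assms have "Vt E \<ge> 0" "Vt E \<le> (norm (E - E))\<^sup>2" by auto
  then show ?thesis by simp
qed

section \<open>Compactly supported vector fields and plane waves\<close>

text \<open>Vector fields are carried together with their gradient, row by row, so that sums and limits can be
  taken of both at once.\<close>

definition C1_compact :: "(real^2) set \<Rightarrow> (real^2 \<Rightarrow> real^2) \<Rightarrow> (real^2 \<Rightarrow> real^2^2) \<Rightarrow> bool" where
  "C1_compact S \<eta> H \<longleftrightarrow>
     (\<forall>x i. has_gradient (\<lambda>y. \<eta> y $ i) (H x $ i) x) \<and> continuous_on UNIV H \<and>
     (\<exists>K. compact K \<and> K \<subseteq> S \<and> (\<forall>x. x \<notin> K \<longrightarrow> \<eta> x = 0 \<and> H x = 0))"

lemma C1_compact_mono: "C1_compact S \<eta> H \<Longrightarrow> S \<subseteq> T \<Longrightarrow> C1_compact T \<eta> H"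
  unfolding C1_compact_def by (meson subset_trans)

lemma C1_compact_0: "C1_compact S (\<lambda>x. 0) (\<lambda>x. 0)"
proof -
  have "(\<bullet>) (0::real^2) = (\<lambda>h. 0)" by (simp add: fun_eq_iff)
  then show ?thesis unfolding C1_compact_def by (auto intro!: exI[of _ "{}"])
qed

lemma C1_compact_add:
  assumes "C1_compact S \<eta> H" and "C1_compact S \<eta>' H'"
  shows "C1_compact S (\<lambda>x. \<eta> x + \<eta>' x) (\<lambda>x. H x + H' x)"
proof -
  obtain K K' where K: "compact K" "K \<subseteq> S" "\<And>x. x \<notin> K \<Longrightarrow> \<eta> x = 0 \<and> H x = 0"
    "compact K'" "K' \<subseteq> S" "\<And>x. x \<notin> K' \<Longrightarrow> \<eta>' x = 0 \<and> H' x = 0"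
    using assms unfolding C1_compact_def by blast
  have "has_gradient (\<lambda>y. (\<eta> y + \<eta>' y) $ i) ((H x + H' x) $ i) x" for x i
    unfolding vector_add_component inner_add_left
    using assms by (intro has_derivative_add) (auto simp: C1_compact_def)
  moreover have "continuous_on UNIV (\<lambda>x. H x + H' x)"
    using assms by (intro continuous_intros) (auto simp: C1_compact_def)
  ultimately show ?thesis
    unfolding C1_compact_def using K by (intro conjI exI[of _ "K \<union> K'"]) auto
qed

lemma C1_compact_sum:
  "(\<And>i. i \<in> F \<Longrightarrow> C1_compact S (\<eta> i) (H i)) \<Longrightarrow>
    C1_compact S (\<lambda>x. \<Sum>i\<in>F. \<eta> i x) (\<lambda>x. \<Sum>i\<in>F. H i x)"
  by (induction F rule: infinite_finite_induct) (auto intro: C1_compact_0 C1_compact_add)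

lemma C1_compact_diff:
  assumes "C1_compact S \<eta> H" and "C1_compact S \<eta>' H'"
  shows "C1_compact S (\<lambda>x. \<eta> x - \<eta>' x) (\<lambda>x. H x - H' x)"
proof -
  have "has_gradient (\<lambda>y. (- \<eta>' y) $ i) ((- H' x) $ i) x" for x i
    unfolding vector_uminus_component inner_minus_left
    using assms(2) by (intro has_derivative_minus) (auto simp: C1_compact_def)
  moreover have "continuous_on UNIV (\<lambda>x. - H' x)"
    using assms(2) by (intro continuous_intros) (auto simp: C1_compact_def)
  moreover have "\<exists>K. compact K \<and> K \<subseteq> S \<and> (\<forall>x. x \<notin> K \<longrightarrow> - \<eta>' x = 0 \<and> - H' x = 0)"
    using assms(2) by (auto simp: C1_compact_def)
  ultimately have "C1_compact S (\<lambda>x. - \<eta>' x) (\<lambda>x. - H' x)"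
    unfolding C1_compact_def by blast
  from C1_compact_add[OF assms(1) this] show ?thesis by simp
qed

lemma C1_compactD:
  assumes "C1_compact S \<eta> H"
  shows "has_gradient (\<lambda>y. \<eta> y $ i) (H x $ i) x"
    and "continuous_on UNIV H" and "continuous_on UNIV \<eta>" and "x \<notin> S \<Longrightarrow> \<eta> x = 0" "x \<notin> S \<Longrightarrow> H x = 0"
    and "\<exists>K. compact K \<and> (\<forall>x. x \<notin> K \<longrightarrow> H x = 0)"
proof -
  show der: "has_gradient (\<lambda>y. \<eta> y $ i) (H x $ i) x" for i x
    using assms by (simp add: C1_compact_def)
  show "continuous_on UNIV H" using assms by (simp add: C1_compact_def)
  have "continuous_on UNIV (\<lambda>x. \<eta> x $ i)" for i by (rule continuous_on_if_derivative, fact)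
  then show "continuous_on UNIV \<eta>"
    using continuous_on_vec_lambda[of UNIV "\<lambda>i x. \<eta> x $ i"] by (simp add: vec_nth_inverse)
  show "x \<notin> S \<Longrightarrow> \<eta> x = 0" "x \<notin> S \<Longrightarrow> H x = 0" using assms unfolding C1_compact_def by blast+
  show "\<exists>K. compact K \<and> (\<forall>x. x \<notin> K \<longrightarrow> H x = 0)" using assms unfolding C1_compact_def by blast
qed

lemma measure_cball_half:
  fixes a :: "real^2"
  assumes "r \<ge> 0"
  shows "measure lebesgue (cball a (r/2)) = measure lebesgue (cball a r) / 4"
  using assms by (simp add: content_cball power_divide)

text \<open>Since \<open>cos\<^sup>2 + sin\<^sup>2 = 1\<close>, one of two phases retains at least half of the integral of \<open>\<beta>\<^sup>2\<close>, for every
  frequency \<open>N\<close>. That integral is at least \<open>(2/5)\<^sup>2\<close> times the measure of the smaller ball.\<close>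

lemma ex_phase:
  fixes \<beta> :: "real^2 \<Rightarrow> real"
  assumes c: "continuous_on UNIV \<beta>" "\<And>x. x \<notin> ball a r \<Longrightarrow> \<beta> x = 0" "\<And>x. 0 \<le> \<beta> x"
    "\<And>x. x \<in> cball a (r/2) \<Longrightarrow> 2/5 \<le> \<beta> x" and r: "r > 0"
  obtains p where "measure lebesgue (cball a r) / 50 \<le> (LINT x|lebesgue. (\<beta> x * cos (N * (b \<bullet> x) + p))\<^sup>2)"
proof -
  define I where "I p = (LINT x|lebesgue. (\<beta> x * cos (N * (b \<bullet> x) + p))\<^sup>2)" for p
  have z: "\<beta> x = 0" if "x \<notin> cball a r" for x using c(2) that by (simp add: not_less)
  have i: "integrable lebesgue (\<lambda>x. (\<beta> x * cos (N * (b \<bullet> x) + p))\<^sup>2)" for p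
    by (rule integrable_compact_support[OF _ compact_cball[of a r]])
       (auto intro!: continuous_intros c(1) simp: z)
  have sum: "(\<beta> x * cos (N * (b \<bullet> x) + 0))\<^sup>2 + (\<beta> x * cos (N * (b \<bullet> x) + pi/2))\<^sup>2 = (\<beta> x)\<^sup>2" for x
  proof -
    have "cos (N * (b \<bullet> x) + pi/2) = - sin (N * (b \<bullet> x))" by (simp add: cos_add)
    then show ?thesis using sin_cos_squared_add[of "N * (b \<bullet> x)"]
      by (simp add: power_mult_distrib flip: distrib_left)
  qed
  have "(LINT x|lebesgue. (4/25) * indicat_real (cball a (r/2)) x) \<le> (LINT x|lebesgue. (\<beta> x)\<^sup>2)"
  proof (rule integral_mono)
    show "integrable lebesgue (\<lambda>x. (4/25) * indicat_real (cball a (r/2)) x)"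
      by (rule integrable_scaled_indicator) simp
    show "integrable lebesgue (\<lambda>x. (\<beta> x)\<^sup>2)"
      by (rule integrable_compact_support[OF _ compact_cball[of a r]])
         (auto intro!: continuous_intros c(1) simp: z)
    show "(4/25) * indicat_real (cball a (r/2)) x \<le> (\<beta> x)\<^sup>2" for x
    proof (cases "x \<in> cball a (r/2)")
      case True
      then have "(2/5)\<^sup>2 \<le> (\<beta> x)\<^sup>2" using c(4) by (intro power_mono) auto
      with True show ?thesis by (simp add: power2_eq_square)
    qed simp
  qed
  then have "measure lebesgue (cball a r) / 25 \<le> (LINT x|lebesgue. (\<beta> x)\<^sup>2)"
    using measure_cball_half[of r a] r by simp
  also have "\<dots> = I 0 + I (pi/2)"
    unfolding I_def using sum by (subst Bochner_Integration.integral_add[OF i i, symmetric]) simp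
  finally have "measure lebesgue (cball a r) / 50 \<le> I 0 \<or> measure lebesgue (cball a r) / 50 \<le> I (pi/2)"
    by linarith
  then show ?thesis using that unfolding I_def by blast
qed

text \<open>The field is the rotated gradient of the stream function
  \<open>- 2 * t / N\<^sup>2 * \<beta> x * cos (N * (b \<bullet> x) + p)\<close> with a bump function \<open>\<beta>\<close>, hence divergence free. In its
  gradient all terms contain a factor \<open>1 / N\<close> except the one in which the wave is differentiated twice,
  and this term is a multiple of the rank-one matrix. The amplitude \<open>2 * t\<close> is such that the gradient
  sweeps the segment between \<open>- 2 * t\<close> and \<open>2 * t\<close> times this matrix.\<close>

lemma wave_on_ball:
  fixes a b :: "real^2"
  assumes b: "norm b = 1" and r: "r > 0" and t: "t > 0" and "e > 0"
  obtains \<eta> :: "real^2 \<Rightarrow> real^2" and H :: "real^2 \<Rightarrow> real^2^2" where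
    "C1_compact (cball a r) \<eta> H" "\<And>x. norm (\<eta> x) \<le> e" "\<And>x. trace (H x) = 0"
    "\<And>x. \<exists>\<tau>. \<bar>\<tau>\<bar> \<le> t \<and> norm (H x - (2 * \<tau>) *\<^sub>R rank_one b) \<le> e"
    "(LINT x|lebesgue. (norm (H x))\<^sup>2) \<ge> t\<^sup>2 / 25 * measure lebesgue (cball a r)"
proof -
  obtain \<beta> :: "real^2 \<Rightarrow> real" and g D where
    d\<beta>: "\<And>x. has_gradient \<beta> (g x) x"
    and dg: "\<And>x i. has_gradient (\<lambda>y. g y $ i) (D x $ i) x"
    and cg: "continuous_on UNIV g" and cD: "continuous_on UNIV D" and sym: "\<And>x i j. D x $ i $ j = D x $ j $ i"
    and out: "\<And>x. x \<notin> ball a r \<Longrightarrow> \<beta> x = 0 \<and> g x = 0 \<and> D x = 0"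
    and pos: "\<And>x. x \<in> ball a r \<Longrightarrow> \<beta> x > 0"
    and bd: "\<And>x. 0 \<le> \<beta> x \<and> \<beta> x \<le> 1" and half: "\<And>x. x \<in> cball a (r/2) \<Longrightarrow> 2/5 \<le> \<beta> x"
    by (rule bump_on_ball[OF r, of a]) blast
  have out': "\<beta> x = 0" "g x = 0" "D x = 0" if "x \<notin> cball a r" for x
    using out[of x] that by (auto simp: not_less)
  have c\<beta>: "continuous_on UNIV \<beta>" by (rule continuous_on_if_derivative, fact)
  obtain K1 where K1: "K1 > 0" "\<And>x. norm (g x) \<le> K1"
    using bounded_compact_support[OF cg compact_cball[of a r] out'(2)] by blast
  obtain K2 where K2: "K2 > 0" "\<And>x. norm (D x) \<le> K2"
    using bounded_compact_support[OF cD compact_cball[of a r] out'(3)] by blast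
  define K where "K = max 1 (max K1 K2)"
  have K: "K \<ge> 1" "\<And>x i. \<bar>g x $ i\<bar> \<le> K" "\<And>x i j. \<bar>D x $ i $ j\<bar> \<le> K"
  proof -
    show "K \<ge> 1" by (simp add: K_def)
    show "\<bar>g x $ i\<bar> \<le> K" for x i
      using component_le_norm_cart[of "g x" i] K1(2)[of x] by (simp add: K_def)
    show "\<bar>D x $ i $ j\<bar> \<le> K" for x i j
      using component_le_norm_cart[of "D x $ i" j] Finite_Cartesian_Product.norm_nth_le[of "D x" i] K2(2)[of x] by (simp add: K_def)
  qed
  have bb: "\<bar>b $ i\<bar> \<le> 1" for i using component_le_norm_cart[of b i] b by simp
  \<comment> \<open>An error of \<open>t / 100\<close> costs at most half of the lower bound for the mean square of the
    leading term, see \<open>low\<close> and \<open>fin\<close>.\<close>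
  define e1 where "e1 = min e (t / 100)"
  have e1: "e1 > 0" "e1 \<le> e" "e1 \<le> t / 100" using \<open>e > 0\<close> t by (auto simp: e1_def)
  \<comment> \<open>With \<open>q = 2 * t / N\<close>, each of the four entries of the error matrix is at most \<open>3 * (K * q)\<close>.\<close>
  define N where "N = max 1 (24 * t * K / e1)"
  have N: "N \<ge> 1" "24 * t * K / N \<le> e1"
  proof -
    show "N \<ge> 1" by (simp add: N_def)
    have "24 * t * K / e1 \<le> N" by (simp add: N_def)
    then show "24 * t * K / N \<le> e1" using \<open>N \<ge> 1\<close> e1(1) by (simp add: field_simps)
  qed
  obtain p where p: "measure lebesgue (cball a r) / 50 \<le> (LINT x|lebesgue. (\<beta> x * cos (N * (b \<bullet> x) + p))\<^sup>2)"
    using ex_phase[OF c\<beta>, of a r N b] out bd half r by metis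
  define \<theta> where "\<theta> x = N * (b \<bullet> x) + p" for x
  \<comment> \<open>A wave of frequency \<open>N\<close> in direction \<open>b\<close> with its first two derivatives along \<open>b\<close>: only the
    last one is of order one.\<close>
  define G0 where "G0 x = - (2 * t / N^2) * cos (\<theta> x)" for x
  define G1 where "G1 x = (2 * t / N) * sin (\<theta> x)" for x
  define G2 where "G2 x = 2 * t * cos (\<theta> x)" for x
  have d\<theta>: "(\<theta> has_derivative (\<lambda>h. N * (b \<bullet> h))) (at x)" for x
  proof -
    have "(\<theta> has_derivative (\<lambda>h. N * (b \<bullet> h) + 0)) (at x)"
      unfolding \<theta>_def by (intro derivative_intros)
    then show ?thesis by simp
  qed
  have dG0: "(G0 has_derivative (\<lambda>h. G1 x * (b \<bullet> h))) (at x)" for x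
  proof -
    have "((\<lambda>s. - (2 * t / N^2) * cos s) has_real_derivative - (2 * t / N^2) * - sin (\<theta> x)) (at (\<theta> x))"
      by (intro DERIV_cmult DERIV_cos)
    from has_derivative_real_compose[OF d\<theta> this] show ?thesis
      unfolding G0_def G1_def by (rule has_derivative_eq_rhs) (use N in \<open>auto simp: fun_eq_iff power2_eq_square\<close>)
  qed
  have dG1: "(G1 has_derivative (\<lambda>h. G2 x * (b \<bullet> h))) (at x)" for x
  proof -
    have "((\<lambda>s. (2 * t / N) * sin s) has_real_derivative (2 * t / N) * cos (\<theta> x)) (at (\<theta> x))"
      by (intro DERIV_cmult DERIV_sin)
    from has_derivative_real_compose[OF d\<theta> this] show ?thesis
      unfolding G1_def G2_def by (rule has_derivative_eq_rhs) (use N in \<open>auto simp: fun_eq_iff\<close>)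
  qed
  have c\<theta>: "continuous_on UNIV \<theta>" by (rule continuous_on_if_derivative, fact)
  have cG0: "continuous_on UNIV G0" and cG1: "continuous_on UNIV G1"
    by (rule continuous_on_if_derivative, fact)+
  have cG2: "continuous_on UNIV G2" unfolding G2_def by (intro continuous_intros c\<theta>)
  \<comment> \<open>The partial derivatives of the stream function \<open>\<beta> * G0\<close> and their gradients.\<close>
  define \<psi> where "\<psi> i x = g x $ i * G0 x + \<beta> x * (G1 x * b $ i)" for i x
  define P where "P i x = G0 x *\<^sub>R D x $ i + (g x $ i * G1 x) *\<^sub>R b + (G1 x * b $ i) *\<^sub>R g x
      + (\<beta> x * G2 x * b $ i) *\<^sub>R b" for i x
  have d\<psi>: "has_gradient (\<psi> i) (P i x) x" for i x
  proof -
    have "(\<psi> i has_derivative (\<lambda>h. (g x $ i * (G1 x * (b \<bullet> h)) + (D x $ i \<bullet> h) * G0 x)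
        + (\<beta> x * ((G2 x * (b \<bullet> h)) * b $ i) + (g x \<bullet> h) * (G1 x * b $ i)))) (at x)"
      unfolding \<psi>_def
      by (intro has_derivative_add has_derivative_mult has_derivative_mult_left d\<beta> dg dG0 dG1)
    then show ?thesis
      by (rule has_derivative_eq_rhs) (simp add: P_def fun_eq_iff inner_add_left algebra_simps)
  qed
  define \<eta> :: "real^2 \<Rightarrow> real^2" where "\<eta> x = (\<chi> i. if i = 1 then - \<psi> 2 x else \<psi> 1 x)" for x
  define H :: "real^2 \<Rightarrow> real^2^2" where "H x = (\<chi> i. if i = 1 then - P 2 x else P 1 x)" for x
  have der: "has_gradient (\<lambda>y. \<eta> y $ i) (H x $ i) x" for x i
    by (cases "i = 1") (simp_all add: \<eta>_def H_def d\<psi> has_derivative_minus)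
  have cP: "continuous_on UNIV (P i)" for i
    unfolding P_def by (intro continuous_intros cG0 cG1 cG2 cg c\<beta> cD)
  have cH: "continuous_on UNIV H"
  proof -
    have "continuous_on UNIV (\<lambda>x. if i = 1 then - P 2 x else P 1 x)" for i :: 2
      by (cases "i = 1") (simp_all add: continuous_on_minus cP)
    then show ?thesis unfolding H_def by (rule continuous_on_vec_lambda)
  qed
  have supp: "\<eta> x = 0 \<and> H x = 0" if "x \<notin> cball a r" for x
    using out'[OF that] by (simp add: \<eta>_def H_def \<psi>_def P_def vec_eq_iff)
  have C1: "C1_compact (cball a r) \<eta> H"
    unfolding C1_compact_def by (intro conjI allI der cH exI[of _ "cball a r"] impI compact_cball order_refl)
      (simp_all add: supp)
  have tr: "trace (H x) = 0" for x
    using sym[of x 1 2] by (simp add: trace_def sum_2 H_def P_def algebra_simps)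
  have G0b: "\<bar>G0 x\<bar> \<le> 2 * t / N" for x
  proof -
    have "\<bar>G0 x\<bar> = 2 * t / N^2 * \<bar>cos (\<theta> x)\<bar>" using t by (simp add: G0_def abs_mult)
    also have "\<dots> \<le> 2 * t / N^2 * 1" using t by (intro mult_left_mono) auto
    also have "\<dots> \<le> 2 * t / N"
      using t N(1) by (simp add: divide_simps power2_eq_square)
    finally show ?thesis .
  qed
  have G1b: "\<bar>G1 x\<bar> \<le> 2 * t / N" for x
  proof -
    have "\<bar>G1 x\<bar> = 2 * t / N * \<bar>sin (\<theta> x)\<bar>" using t N by (simp add: G1_def abs_mult)
    also have "\<dots> \<le> 2 * t / N * 1" using t N by (intro mult_left_mono) auto
    finally show ?thesis by simp
  qed
  define q where "q = 2 * t / N"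
  have q: "q \<ge> 0" "12 * (K * q) \<le> e1" "\<And>x. \<bar>G0 x\<bar> \<le> q" "\<And>x. \<bar>G1 x\<bar> \<le> q"
    using t N G0b G1b by (auto simp: q_def mult_ac)
  have \<psi>b: "\<bar>\<psi> i x\<bar> \<le> 2 * (K * q)" for i x
  proof -
    have "\<bar>g x $ i * G0 x\<bar> \<le> K * q"
      unfolding abs_mult using K q by (intro mult_mono) auto
    moreover have "\<bar>\<beta> x * (G1 x * b $ i)\<bar> \<le> 1 * (q * 1)"
      unfolding abs_mult using bd[of x] q bb by (intro mult_mono) auto
    moreover have "1 * (q * 1) \<le> K * q" using K q by (simp add: mult_le_cancel_right1)
    ultimately show ?thesis unfolding \<psi>_def by linarith
  qed
  have small: "norm (\<eta> x) \<le> e" for x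
  proof -
    have "norm (\<eta> x) \<le> \<bar>\<psi> 2 x\<bar> + \<bar>\<psi> 1 x\<bar>"
      using norm_le_l1_cart[of "\<eta> x"] by (simp add: \<eta>_def sum_2)
    also have "\<dots> \<le> 12 * (K * q)"
      using \<psi>b[of 1 x] \<psi>b[of 2 x] mult_nonneg_nonneg[of K q] q(1) K(1) by linarith
    finally show ?thesis using q(2) e1 by linarith
  qed
  \<comment> \<open>In the limit of infinite frequency only \<open>\<beta> * G2\<close> survives in the Hessian; it contributes
    exactly \<open>2 * \<tau>\<close> times the rank-one matrix.\<close>
  define \<tau> where "\<tau> x = t * (\<beta> x * cos (\<theta> x))" for x
  have \<tau>: "\<bar>\<tau> x\<bar> \<le> t" for x
  proof -
    have "\<bar>\<beta> x * cos (\<theta> x)\<bar> \<le> 1 * 1" unfolding abs_mult using bd[of x] by (intro mult_mono) auto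
    then show ?thesis using t unfolding \<tau>_def abs_mult by (simp add: mult_left_le abs_mult)
  qed
  define Er where "Er x = H x - (2 * \<tau> x) *\<^sub>R rank_one b" for x
  have Erb: "norm (Er x) \<le> e1" for x
  proof -
    have ent: "\<bar>G0 x * D x $ i $ j + g x $ i * G1 x * b $ j + G1 x * b $ i * g x $ j\<bar> \<le> 3 * (K * q)" for i j
    proof -
      have "\<bar>G0 x * D x $ i $ j\<bar> \<le> q * K" unfolding abs_mult using K q by (intro mult_mono) auto
      moreover have "\<bar>g x $ i * G1 x * b $ j\<bar> \<le> K * q * 1"
        unfolding abs_mult using K q bb by (intro mult_mono) auto
      moreover have "\<bar>G1 x * b $ i * g x $ j\<bar> \<le> q * 1 * K"
        unfolding abs_mult using K q bb by (intro mult_mono) auto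
      moreover have "q * K = K * q" "K * q * 1 = K * q" "q * 1 * K = K * q" by simp_all
      ultimately show ?thesis by linarith
    qed
    have "\<bar>Er x $ 1 $ j\<bar> \<le> 3 * (K * q)" for j
      using ent[of 2 j] by (simp add: Er_def H_def P_def rank_one_def \<tau>_def G2_def algebra_simps abs_minus_commute)
    moreover have "\<bar>Er x $ 2 $ j\<bar> \<le> 3 * (K * q)" for j
      using ent[of 1 j] by (simp add: Er_def H_def P_def rank_one_def \<tau>_def G2_def algebra_simps)
    ultimately have "norm (Er x) \<le> 3 * (K * q) + 3 * (K * q) + 3 * (K * q) + 3 * (K * q)"
      using norm_matrix_le_entries[of "Er x"] by (smt (verit))
    with q(2) show ?thesis by simp
  qed
  have close: "\<exists>\<tau>. \<bar>\<tau>\<bar> \<le> t \<and> norm (H x - (2 * \<tau>) *\<^sub>R rank_one b) \<le> e" for x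
    using \<tau>[of x] Erb[of x] e1 unfolding Er_def by (intro exI[of _ "\<tau> x"]) auto
  let ?m = "measure lebesgue (cball a r)"
  have low: "4 * t\<^sup>2 * (\<beta> x * cos (\<theta> x))\<^sup>2 - (t\<^sup>2 / 25) * indicat_real (cball a r) x \<le> (norm (H x))\<^sup>2" for x
  proof (cases "x \<in> cball a r")
    case True
    have "H x = Er x + (2 * \<tau> x) *\<^sub>R rank_one b" by (simp add: Er_def)
    then have "norm ((2 * \<tau> x) *\<^sub>R rank_one b) \<le> norm (H x) + norm (Er x)"
      by (metis add_diff_cancel_left' norm_triangle_ineq4)
    then have "2 * \<bar>\<tau> x\<bar> \<le> norm (H x) + norm (Er x)"
      by (simp add: norm_rank_one[OF b] abs_mult)
    then have "2 * \<bar>\<tau> x\<bar> - t / 100 \<le> norm (H x)" using Erb[of x] e1 by linarith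
    then have "4 * (\<tau> x)\<^sup>2 - 4 * \<bar>\<tau> x\<bar> * (t/100) \<le> (norm (H x))\<^sup>2"
    proof (cases "2 * \<bar>\<tau> x\<bar> - t / 100 \<ge> 0")
      case True
      then have "(2 * \<bar>\<tau> x\<bar> - t / 100)\<^sup>2 \<le> (norm (H x))\<^sup>2"
        using \<open>2 * \<bar>\<tau> x\<bar> - t / 100 \<le> norm (H x)\<close> by (intro power_mono) auto
      moreover have "(2 * \<bar>\<tau> x\<bar> - t / 100)\<^sup>2 = 4 * (\<tau> x)\<^sup>2 - 4 * \<bar>\<tau> x\<bar> * (t/100) + (t/100)\<^sup>2"
        by (simp add: power2_diff power_mult_distrib)
      ultimately show ?thesis using zero_le_power2[of "t/100"] by linarith
    next
      case False
      then have "\<bar>\<tau> x\<bar> * \<bar>\<tau> x\<bar> \<le> \<bar>\<tau> x\<bar> * (t / 100)" by (intro mult_left_mono) auto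
      moreover have "(\<tau> x)\<^sup>2 = \<bar>\<tau> x\<bar> * \<bar>\<tau> x\<bar>" by (simp add: power2_eq_square)
      moreover have "4 * \<bar>\<tau> x\<bar> * (t/100) = 4 * (\<bar>\<tau> x\<bar> * (t/100))" by simp
      ultimately show ?thesis using zero_le_power2[of "norm (H x)"] by linarith
    qed
    moreover have "4 * \<bar>\<tau> x\<bar> * (t/100) \<le> 4 * t * (t/100)"
      using \<tau>[of x] t by (intro mult_right_mono mult_left_mono) auto
    ultimately have "4 * (\<tau> x)\<^sup>2 - t\<^sup>2 / 25 \<le> (norm (H x))\<^sup>2" by (simp add: power2_eq_square)
    with True show ?thesis by (simp add: \<tau>_def power_mult_distrib mult.assoc)
  next
    case False
    then show ?thesis using out' by simp
  qed
  have i1: "integrable lebesgue (\<lambda>x. (\<beta> x * cos (\<theta> x))\<^sup>2)"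
    by (rule integrable_compact_support[OF _ compact_cball[of a r]])
       (auto intro!: continuous_intros c\<beta> c\<theta> simp: out')
  have i2: "integrable lebesgue (\<lambda>x. (t\<^sup>2 / 25) * indicat_real (cball a r) x)"
    by (rule integrable_scaled_indicator) simp
  have "(LINT x|lebesgue. 4 * t\<^sup>2 * (\<beta> x * cos (\<theta> x))\<^sup>2 - (t\<^sup>2 / 25) * indicat_real (cball a r) x)
      \<le> (LINT x|lebesgue. (norm (H x))\<^sup>2)"
  proof (rule integral_mono[OF _ _ low])
    show "integrable lebesgue (\<lambda>x. 4 * t\<^sup>2 * (\<beta> x * cos (\<theta> x))\<^sup>2 - (t\<^sup>2 / 25) * indicat_real (cball a r) x)"
      by (intro Bochner_Integration.integrable_diff integrable_mult_right i1 i2)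
    show "integrable lebesgue (\<lambda>x. (norm (H x))\<^sup>2)"
      by (rule integrable_compact_support[OF _ compact_cball[of a r]])
         (auto intro!: continuous_intros cH simp: supp)
  qed
  moreover have "(LINT x|lebesgue. 4 * t\<^sup>2 * (\<beta> x * cos (\<theta> x))\<^sup>2 - (t\<^sup>2 / 25) * indicat_real (cball a r) x)
      = 4 * t\<^sup>2 * (LINT x|lebesgue. (\<beta> x * cos (\<theta> x))\<^sup>2) - (t\<^sup>2 / 25) * ?m"
    by (subst Bochner_Integration.integral_diff[OF integrable_mult_right[OF i1] i2]) simp
  moreover have "4 * t\<^sup>2 * (?m / 50) \<le> 4 * t\<^sup>2 * (LINT x|lebesgue. (\<beta> x * cos (\<theta> x))\<^sup>2)"
    using p unfolding \<theta>_def by (intro mult_left_mono) auto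
  ultimately have fin: "(LINT x|lebesgue. (norm (H x))\<^sup>2) \<ge> t\<^sup>2 / 25 * ?m" by simp
  show ?thesis by (rule that[OF C1 small tr close fin])
qed

section \<open>One step of the iteration\<close>

text \<open>Finiteness is needed for the sum of the perturbations on the sets to be \<open>C\<^sup>1\<close> with compact support;
  losing half of the integral does no harm to the iteration.\<close>

lemma finite_subfamily_half_integral:
  fixes f :: "'a::euclidean_space \<Rightarrow> real" and \<C> :: "'b set" and B :: "'b \<Rightarrow> 'a set"
  assumes f: "integrable lebesgue f" "\<And>x. f x \<ge> 0" "\<And>x. x \<notin> S \<Longrightarrow> f x = 0"
    and \<C>: "countable \<C>" "\<And>i. i \<in> \<C> \<Longrightarrow> B i \<in> sets lebesgue" "negligible (S - (\<Union>i\<in>\<C>. B i))"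
  obtains F where "finite F" "F \<subseteq> \<C>"
    "(LINT x|lebesgue. f x) \<le> 2 * (\<Sum>i\<in>F. LINT x|lebesgue. indicat_real (B i) x * f x)"
proof (cases "(LINT x|lebesgue. f x) \<le> 0")
  case True
  then show ?thesis by (intro that[of "{}"]) auto
next
  case False
  have ae: "AE x in lebesgue. x \<notin> S - (\<Union>i\<in>\<C>. B i)"
    using \<C>(3) by (intro AE_not_in) (simp add: negligible_iff_null_sets)
  have ne: "\<C> \<noteq> {}"
  proof
    assume "\<C> = {}"
    then have "AE x in lebesgue. f x = 0" using ae f(3) by (auto elim!: eventually_mono)
    then have "(LINT x|lebesgue. f x) = 0" by (rule integral_eq_zero_AE)
    with False show False by simp
  qed
  define e where "e = from_nat_into \<C>"
  have e: "range e = \<C>" unfolding e_def using range_from_nat_into[OF ne \<C>(1)] .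
  define U where "U n = (\<Union>i\<in>e ` {..<n}. B i)" for n
  have U: "U n \<in> sets lebesgue" for n
    unfolding U_def using e \<C>(2) by (intro sets.finite_UN) auto
  have int: "integrable lebesgue (\<lambda>x. indicat_real A x * f x)" if "A \<in> sets lebesgue" for A
    using integrable_mult_indicator[OF that f(1)] by simp
  have "(\<lambda>n. LINT x|lebesgue. indicat_real (U n) x * f x) \<longlonglongrightarrow> (LINT x|lebesgue. f x)"
  proof (rule integral_dominated_convergence[where w = f])
    show "AE x in lebesgue. (\<lambda>n. indicat_real (U n) x * f x) \<longlonglongrightarrow> f x"
      using ae
    proof eventually_elim
      case (elim x)
      show ?case
      proof (cases "x \<in> S")
        case True
        then obtain i where i: "i \<in> \<C>" "x \<in> B i" using elim by auto
        then obtain k where "i = e k" using e by auto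
        then have "x \<in> U n" if "n \<ge> Suc k" for n using i that unfolding U_def by auto
        then have "\<forall>\<^sub>F n in sequentially. indicat_real (U n) x * f x = f x"
          unfolding eventually_sequentially by (intro exI[of _ "Suc k"]) auto
        then show ?thesis by (rule tendsto_eventually)
      qed (simp add: f(3))
    qed
    show "AE x in lebesgue. norm (indicat_real (U n) x * f x) \<le> f x" for n
      using f(2) by (intro AE_I2) (auto simp: indicator_def)
  qed (use f int U in auto)
  then have "\<forall>\<^sub>F n in sequentially. (LINT x|lebesgue. f x) / 2 < (LINT x|lebesgue. indicat_real (U n) x * f x)"
    using False by (intro order_tendstoD) auto
  then obtain n where n: "(LINT x|lebesgue. f x) / 2 < (LINT x|lebesgue. indicat_real (U n) x * f x)"
    by (auto simp: eventually_sequentially)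
  let ?F = "e ` {..<n}"
  have sub: "?F \<subseteq> \<C>" using e by auto
  have "(LINT x|lebesgue. indicat_real (U n) x * f x) \<le> (LINT x|lebesgue. (\<Sum>i\<in>?F. indicat_real (B i) x * f x))"
  proof (intro integral_mono int U Bochner_Integration.integrable_sum)
    show "B i \<in> sets lebesgue" if "i \<in> ?F" for i using that sub \<C>(2) by auto
    show "indicat_real (U n) x * f x \<le> (\<Sum>i\<in>?F. indicat_real (B i) x * f x)" for x
    proof (cases "x \<in> U n")
      case True
      then obtain i where i: "i \<in> ?F" "x \<in> B i" unfolding U_def by auto
      have "indicat_real (B i) x * f x \<le> (\<Sum>i\<in>?F. indicat_real (B i) x * f x)"
        using f(2) i(1) by (intro member_le_sum) auto
      with True i show ?thesis by simp
    next
      case False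
      then have "indicat_real (U n) x * f x = 0" by simp
      also have "0 \<le> (\<Sum>i\<in>?F. indicat_real (B i) x * f x)"
        by (intro sum_nonneg mult_nonneg_nonneg f(2)) auto
      finally show ?thesis .
    qed
  qed
  also have "\<dots> = (\<Sum>i\<in>?F. LINT x|lebesgue. indicat_real (B i) x * f x)"
    using sub \<C>(2) by (intro Bochner_Integration.integral_sum int) auto
  finally show ?thesis using n sub by (intro that[of ?F]) auto
qed

lemma trace_sum: "trace (\<Sum>i\<in>F. A i :: real^2^2) = (\<Sum>i\<in>F. trace (A i))"
  by (simp add: trace_def sum_2 sum.distrib)

lemma sum_single_nonzero:
  assumes "finite F" and "j \<in> F" and "\<And>i. i \<in> F \<Longrightarrow> i \<noteq> j \<Longrightarrow> f i = (0::'a::comm_monoid_add)"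
  shows "(\<Sum>i\<in>F. f i) = f j"
  using sum.mono_neutral_right[of F "{j}" f] assms by auto

text \<open>The segment in the centre is compact and the admissible region is open, so there is some space around
  the segment, which can be shared between the variation of \<open>G\<close> on a small ball and the error of the
  wave.\<close>

lemma good_radius:
  fixes G :: "real^2 \<Rightarrow> real^2^2"
  assumes \<Omega>: "open \<Omega>" "c \<in> \<Omega>" and G: "continuous_on \<Omega> G" "G c \<in> admissible C" and C: "C \<ge> 1"
  obtains R e b where "R > 0" "e > 0" "norm b = 1" "cball c R \<subseteq> \<Omega>"
    "\<And>x. x \<in> cball c R \<Longrightarrow> deficit (G x) \<le> 2 * deficit (G c)"
    "\<And>x \<tau> E. x \<in> cball c R \<Longrightarrow> \<bar>\<tau>\<bar> \<le> deficit (G c) / 2 \<Longrightarrow> norm (E - (2 * \<tau>) *\<^sub>R rank_one b) \<le> e \<Longrightarrow>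
       G x + E \<in> admissible C"
proof -
  obtain b where b: "norm b = 1"
    "\<And>\<tau>. \<bar>\<tau>\<bar> \<le> deficit (G c) / 2 \<Longrightarrow> G c + (2 * \<tau>) *\<^sub>R rank_one b \<in> admissible C"
    using ex_rank_one_segment[OF G(2) C] unfolding deficit_def by blast
  define I where "I = {- (deficit (G c) / 2) .. deficit (G c) / 2}"
  let ?S = "(\<lambda>\<tau>. G c + (2 * \<tau>) *\<^sub>R rank_one b) ` I"
  have S: "compact ?S" "?S \<subseteq> admissible C"
    unfolding I_def by (intro compact_continuous_image continuous_intros compact_Icc) (auto intro!: b)
  obtain e where e: "e > 0" "(\<Union>y\<in>?S. cball y e) \<subseteq> admissible C"
    using compact_subset_open_imp_cball_epsilon_subset[OF S(1) open_admissible S(2)] by blast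
  have pos: "deficit (G c) > 0" using G(2) by (simp add: admissible_def deficit_def)
  have cont: "isCont G c" using G(1) \<Omega> continuous_on_eq_continuous_at by blast
  have cd: "continuous_on UNIV deficit" unfolding deficit_def by (intro continuous_intros)
  then have "isCont (\<lambda>x. deficit (G x)) c"
    using cont by (intro isCont_o2[of c G deficit]) (auto simp: continuous_on_eq_continuous_at)
  then have "((\<lambda>x. deficit (G x)) \<longlongrightarrow> deficit (G c)) (nhds c)"
    using tendsto_at_iff_tendsto_nhds[of "\<lambda>x. deficit (G x)" c] by (simp add: isCont_def)
  then have "\<forall>\<^sub>F x in nhds c. deficit (G x) < 2 * deficit (G c)"
    by (rule order_tendstoD(2)) (use pos in simp)
  moreover have "\<forall>\<^sub>F x in nhds c. dist (G x) (G c) < e / 2"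
    using cont e(1) by (intro tendstoD) (auto simp: isCont_def tendsto_at_iff_tendsto_nhds)
  moreover have "\<forall>\<^sub>F x in nhds c. x \<in> \<Omega>" using \<Omega> by (rule eventually_nhds_in_open)
  ultimately have "\<forall>\<^sub>F x in nhds c. x \<in> \<Omega> \<and> dist (G x) (G c) < e / 2 \<and> deficit (G x) < 2 * deficit (G c)"
    by eventually_elim auto
  then obtain R where R: "R > 0"
    "\<And>x. dist x c \<le> R \<Longrightarrow> x \<in> \<Omega> \<and> dist (G x) (G c) < e / 2 \<and> deficit (G x) < 2 * deficit (G c)"
    unfolding eventually_nhds_metric_le by blast
  have "G x + E \<in> admissible C"
    if "x \<in> cball c R" "\<bar>\<tau>\<bar> \<le> deficit (G c) / 2" "norm (E - (2 * \<tau>) *\<^sub>R rank_one b) \<le> e / 2" for x \<tau> E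
  proof -
    have "dist x c \<le> R" using that(1) by (simp add: dist_commute)
    then have "norm (G x - G c) < e / 2" using R(2) by (simp add: dist_norm)
    then have "norm ((G x - G c) + (E - (2 * \<tau>) *\<^sub>R rank_one b)) \<le> e"
      using that(3) norm_triangle_ineq[of "G x - G c" "E - (2 * \<tau>) *\<^sub>R rank_one b"] by linarith
    then have "G x + E \<in> cball (G c + (2 * \<tau>) *\<^sub>R rank_one b) e"
      by (simp add: dist_norm norm_minus_commute algebra_simps)
    moreover have "\<tau> \<in> I" using that(2) by (auto simp: I_def abs_le_iff)
    ultimately show ?thesis using e(2) by blast
  qed
  then show ?thesis
    using R e(1) b(1) by (intro that[of R "e/2" b]) (auto simp: dist_commute less_imp_le)
qed

text \<open>Vitali's covering theorem fills \<open>\<Omega>\<close> with disjoint balls that are small enough for the gradient to be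
  nearly constant on each of them, and finitely many of these carry half of the squared deficit. On each
  ball a wave along the radial segment in the centre is added; its mean square is at least a fixed
  multiple of the squared deficit.\<close>

lemma ex_perturbation_step:
  fixes G :: "real^2 \<Rightarrow> real^2^2"
  assumes \<Omega>: "open \<Omega>" "bounded \<Omega>" and G: "continuous_on \<Omega> G" "\<And>x. x \<in> \<Omega> \<Longrightarrow> G x \<in> admissible C"
    and C: "C \<ge> 1" and d: "d > 0"
  obtains \<eta> H where "C1_compact \<Omega> \<eta> H" "\<And>x. norm (\<eta> x) \<le> d" "\<And>x. trace (H x) = 0"
    "\<And>x. x \<in> \<Omega> \<Longrightarrow> G x + H x \<in> admissible C"
    "(LINT x|lebesgue. indicat_real \<Omega> x * (deficit (G x))\<^sup>2) \<le> 800 * (LINT x|lebesgue. (norm (H x))\<^sup>2)"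
proof -
  have "\<exists>R e b. R > 0 \<and> e > 0 \<and> norm b = 1 \<and> cball c R \<subseteq> \<Omega> \<and>
    (\<forall>x\<in>cball c R. deficit (G x) \<le> 2 * deficit (G c)) \<and>
    (\<forall>x\<in>cball c R. \<forall>\<tau> E. \<bar>\<tau>\<bar> \<le> deficit (G c) / 2 \<longrightarrow> norm (E - (2 * \<tau>) *\<^sub>R rank_one b) \<le> e \<longrightarrow>
       G x + E \<in> admissible C)" if "c \<in> \<Omega>" for c
    using good_radius[OF \<Omega>(1) that G(1) G(2)[OF that] C] by (metis (no_types, lifting))
  then obtain R e b where Reb: "\<And>c. c \<in> \<Omega> \<Longrightarrow> R c > 0 \<and> e c > 0 \<and> norm (b c) = 1 \<and> cball c (R c) \<subseteq> \<Omega>"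
    "\<And>c x. c \<in> \<Omega> \<Longrightarrow> x \<in> cball c (R c) \<Longrightarrow> deficit (G x) \<le> 2 * deficit (G c)"
    "\<And>c x \<tau> E. c \<in> \<Omega> \<Longrightarrow> x \<in> cball c (R c) \<Longrightarrow> \<bar>\<tau>\<bar> \<le> deficit (G c) / 2 \<Longrightarrow>
       norm (E - (2 * \<tau>) *\<^sub>R rank_one (b c)) \<le> e c \<Longrightarrow> G x + E \<in> admissible C"
    by metis
  define f where "f x = indicat_real \<Omega> x * (deficit (G x))\<^sup>2" for x
  have df: "0 < deficit (G x)" "deficit (G x) \<le> 1" if "x \<in> \<Omega>" for x
  proof -
    have "cmod (dev (G x)) < 3/4" using G(2)[OF that] by (simp add: admissible_def)
    then show "0 < deficit (G x)" "deficit (G x) \<le> 1"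
      using norm_ge_zero[of "dev (G x)"] unfolding deficit_def by linarith+
  qed
  have f: "f x \<ge> 0" "x \<notin> \<Omega> \<Longrightarrow> f x = 0" for x by (auto simp: f_def)
  have cG: "continuous_on \<Omega> (\<lambda>x. (deficit (G x))\<^sup>2)"
    unfolding deficit_def by (intro continuous_intros G)
  have f_int: "integrable lebesgue f"
  proof (rule integrable_bounded_support)
    show "f \<in> borel_measurable lebesgue"
      using indicator_continuous_measurable[OF \<Omega>(1) cG] by (simp add: f_def[abs_def])
    show "\<Omega> \<in> lmeasurable" using \<Omega> by (rule lmeasurable_open[rotated])
    show "norm (f x) \<le> 1" for x
      using df[of x] by (cases "x \<in> \<Omega>") (auto simp: f_def abs_square_le_1)
  qed (simp add: f(2))
  define \<K> where "\<K> = {(c, r). c \<in> \<Omega> \<and> 0 < r \<and> r \<le> R c}"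
  obtain \<C> where \<C>: "countable \<C>" "\<C> \<subseteq> \<K>"
    "pairwise (\<lambda>i j. disjnt (cball (fst i) (snd i)) (cball (fst j) (snd j))) \<C>"
    "negligible (\<Omega> - (\<Union>i\<in>\<C>. cball (fst i) (snd i)))"
  proof (rule Vitali_covering_theorem_cballs[of \<K> snd \<Omega> fst])
    show "0 < snd i" if "i \<in> \<K>" for i using that by (auto simp: \<K>_def)
    show "\<exists>i. i \<in> \<K> \<and> x \<in> cball (fst i) (snd i) \<and> snd i < d" if "x \<in> \<Omega>" "0 < d" for x d
      using that Reb(1)[OF that(1)] by (intro exI[of _ "(x, min (R x) (d/2))"]) (auto simp: \<K>_def)
  qed blast
  obtain F where F: "finite F" "F \<subseteq> \<C>"
    "(LINT x|lebesgue. f x) \<le> 2 * (\<Sum>i\<in>F. LINT x|lebesgue. indicat_real (cball (fst i) (snd i)) x * f x)"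
    by (rule finite_subfamily_half_integral[OF f_int f \<C>(1) _ \<C>(4)]) auto
  let ?B = "\<lambda>i. cball (fst i) (snd i)"
  have FK: "fst i \<in> \<Omega>" "snd i > 0" "?B i \<subseteq> cball (fst i) (R (fst i))" "?B i \<subseteq> \<Omega>" if "i \<in> F" for i
  proof -
    show 1: "fst i \<in> \<Omega>" "snd i > 0" "?B i \<subseteq> cball (fst i) (R (fst i))"
      using that F(2) \<C>(2) by (auto simp: \<K>_def)
    show "?B i \<subseteq> \<Omega>" using 1 Reb(1)[OF 1(1)] by blast
  qed
  have disj: "x \<notin> ?B j" if "i \<in> F" "j \<in> F" "i \<noteq> j" "x \<in> ?B i" for i j x
    using \<C>(3) F(2) that unfolding pairwise_def disjnt_def by blast
  have "\<exists>\<eta> H. C1_compact (?B i) \<eta> H \<and> (\<forall>x. norm (\<eta> x) \<le> min d (e (fst i))) \<and> (\<forall>x. trace (H x) = 0) \<and>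
     (\<forall>x. \<exists>\<tau>. \<bar>\<tau>\<bar> \<le> deficit (G (fst i)) / 2 \<and> norm (H x - (2 * \<tau>) *\<^sub>R rank_one (b (fst i))) \<le> min d (e (fst i))) \<and>
     (deficit (G (fst i)) / 2)\<^sup>2 / 25 * measure lebesgue (?B i) \<le> (LINT x|lebesgue. (norm (H x))\<^sup>2)"
    if i: "i \<in> F" for i
  proof -
    have "norm (b (fst i)) = 1" "0 < deficit (G (fst i)) / 2" "0 < min d (e (fst i))"
      using Reb(1)[OF FK(1)[OF i]] df(1)[OF FK(1)[OF i]] d by auto
    then obtain \<eta> H where w1: "C1_compact (?B i) \<eta> H" and w2: "\<And>x. norm (\<eta> x) \<le> min d (e (fst i))"
      and w3: "\<And>x. trace (H x) = 0"
      and w4: "\<And>x. \<exists>\<tau>. \<bar>\<tau>\<bar> \<le> deficit (G (fst i)) / 2 \<and>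
        norm (H x - (2 * \<tau>) *\<^sub>R rank_one (b (fst i))) \<le> min d (e (fst i))"
      and w5: "(deficit (G (fst i)) / 2)\<^sup>2 / 25 * measure lebesgue (?B i) \<le> (LINT x|lebesgue. (norm (H x))\<^sup>2)"
      by (rule wave_on_ball[OF _ FK(2)[OF i], where a = "fst i"]) blast
    show ?thesis
      by (intro exI[of _ \<eta>] exI[of _ H] conjI allI w1 w2 w3 w4 w5)
  qed
  then obtain \<eta> H where w: "\<And>i. i \<in> F \<Longrightarrow> C1_compact (?B i) (\<eta> i) (H i)"
     "\<And>i x. i \<in> F \<Longrightarrow> norm (\<eta> i x) \<le> min d (e (fst i))" "\<And>i x. i \<in> F \<Longrightarrow> trace (H i x) = 0"
     "\<And>i x. i \<in> F \<Longrightarrow> \<exists>\<tau>. \<bar>\<tau>\<bar> \<le> deficit (G (fst i)) / 2 \<and>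
         norm (H i x - (2 * \<tau>) *\<^sub>R rank_one (b (fst i))) \<le> min d (e (fst i))"
     "\<And>i. i \<in> F \<Longrightarrow> (deficit (G (fst i)) / 2)\<^sup>2 / 25 * measure lebesgue (?B i) \<le> (LINT x|lebesgue. (norm (H i x))\<^sup>2)"
    by metis
  define \<eta>' where "\<eta>' x = (\<Sum>i\<in>F. \<eta> i x)" for x
  define H' where "H' x = (\<Sum>i\<in>F. H i x)" for x
  have z: "\<eta> i x = 0" "H i x = 0" if "i \<in> F" "x \<notin> ?B i" for i x
    using w(1)[OF that(1)] that(2) unfolding C1_compact_def by blast+
  have val: "\<eta>' x = \<eta> j x" "H' x = H j x" if "j \<in> F" "x \<in> ?B j" for j x
    unfolding \<eta>'_def H'_def using that disj z by (intro sum_single_nonzero F(1); metis)+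
  have val0: "\<eta>' x = 0" "H' x = 0" if "\<And>j. j \<in> F \<Longrightarrow> x \<notin> ?B j" for x
    unfolding \<eta>'_def H'_def using that z by (auto intro!: sum.neutral)
  have "C1_compact \<Omega> \<eta>' H'"
    unfolding \<eta>'_def H'_def using w(1) FK(4) by (intro C1_compact_sum) (rule C1_compact_mono)
  moreover have "norm (\<eta>' x) \<le> d" for x
    using val(1)[of _ x] val0(1)[of x] w(2)[of _ x] d by (metis less_imp_le min.boundedE norm_zero)
  moreover have "trace (H' x) = 0" for x
    unfolding H'_def trace_sum using w(3) by simp
  moreover have "G x + H' x \<in> admissible C" if "x \<in> \<Omega>" for x
  proof (cases "\<exists>j\<in>F. x \<in> ?B j")
    case True
    then obtain j where j: "j \<in> F" "x \<in> ?B j" by blast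
    obtain \<tau> where "\<bar>\<tau>\<bar> \<le> deficit (G (fst j)) / 2"
      "norm (H j x - (2 * \<tau>) *\<^sub>R rank_one (b (fst j))) \<le> min d (e (fst j))"
      using w(4)[OF j(1)] by blast
    then show ?thesis
      unfolding val(2)[OF j] using Reb(3)[OF FK(1)[OF j(1)]] FK(3)[OF j(1)] j(2) by auto
  next
    case False
    then show ?thesis using val0(2)[of x] G(2)[OF that] by auto
  qed
  moreover have "(LINT x|lebesgue. f x) \<le> 800 * (LINT x|lebesgue. (norm (H' x))\<^sup>2)"
  proof -
    have H_int: "integrable lebesgue (\<lambda>x. (norm (H i x))\<^sup>2)" if "i \<in> F" for i
      using w(1)[OF that] by (intro integrable_compact_support[OF _ compact_cball[of "fst i" "snd i"]])
        (auto intro!: continuous_intros simp: C1_compact_def z[OF that])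
    have le: "(LINT x|lebesgue. indicat_real (?B i) x * f x) \<le> 400 * (LINT x|lebesgue. (norm (H i x))\<^sup>2)"
      if i: "i \<in> F" for i
    proof -
      let ?t = "deficit (G (fst i))"
      have "(LINT x|lebesgue. indicat_real (?B i) x * f x) \<le> (LINT x|lebesgue. (4 * ?t\<^sup>2) * indicat_real (?B i) x)"
      proof (rule integral_mono)
        show "integrable lebesgue (\<lambda>x. indicat_real (?B i) x * f x)"
          using integrable_mult_indicator[OF _ f_int, of "?B i"] by simp
        show "integrable lebesgue (\<lambda>x. (4 * ?t\<^sup>2) * indicat_real (?B i) x)"
          by (rule integrable_scaled_indicator) simp
        show "indicat_real (?B i) x * f x \<le> (4 * ?t\<^sup>2) * indicat_real (?B i) x" for x
        proof (cases "x \<in> ?B i")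
          case True
          then have "x \<in> \<Omega>" "deficit (G x) \<le> 2 * ?t"
            using FK[OF i] Reb(2)[OF FK(1)[OF i]] by auto
          then have "(deficit (G x))\<^sup>2 \<le> (2 * ?t)\<^sup>2" using df(1)[of x] by (intro power_mono) auto
          with True \<open>x \<in> \<Omega>\<close> show ?thesis by (simp add: f_def power_mult_distrib)
        qed simp
      qed
      also have "\<dots> = (4 * ?t\<^sup>2) * measure lebesgue (?B i)" by simp
      \<comment> \<open>The amplitude of the wave is \<open>?t / 2\<close>, and \<open>4 * 4 * 25 = 400\<close>.\<close>
      also have "\<dots> = 400 * ((?t / 2)\<^sup>2 / 25 * measure lebesgue (?B i))"
        by (simp add: power_divide)
      finally show ?thesis using w(5)[OF i] by linarith
    qed
    have sq: "(norm (H' x))\<^sup>2 = (\<Sum>i\<in>F. (norm (H i x))\<^sup>2)" for x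
    proof (cases "\<exists>j\<in>F. x \<in> ?B j")
      case True
      then obtain j where j: "j \<in> F" "x \<in> ?B j" by blast
      have "(\<Sum>i\<in>F. (norm (H i x))\<^sup>2) = (norm (H j x))\<^sup>2"
        using j disj z by (intro sum_single_nonzero F(1)) auto
      then show ?thesis using val(2)[OF j] by simp
    next
      case False
      then show ?thesis using val0(2)[of x] z(2) by (auto intro!: sum.neutral)
    qed
    have "(LINT x|lebesgue. f x) \<le> 2 * (\<Sum>i\<in>F. 400 * (LINT x|lebesgue. (norm (H i x))\<^sup>2))"
      by (rule order_trans[OF F(3) mult_left_mono[OF sum_mono[OF le]]]) auto
    also have "\<dots> = 800 * (\<Sum>i\<in>F. LINT x|lebesgue. (norm (H i x))\<^sup>2)"
      by (simp add: sum_distrib_left)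
    also have "(\<Sum>i\<in>F. LINT x|lebesgue. (norm (H i x))\<^sup>2) = (LINT x|lebesgue. (norm (H' x))\<^sup>2)"
      unfolding sq using H_int by (intro Bochner_Integration.integral_sum[symmetric])
    finally show ?thesis .
  qed
  ultimately show ?thesis unfolding f_def by (rule that)
qed

section \<open>The limit of the iteration\<close>

lemma weakly_small_matrix:
  fixes \<Phi> :: "real^2 \<Rightarrow> real^2^2"
  assumes \<Phi>: "continuous_on UNIV \<Phi>" and \<Omega>: "bounded \<Omega>" and "e > 0"
  obtains d where "d > 0"
    "\<And>\<theta> \<Theta>. C1_compact \<Omega> \<theta> \<Theta> \<Longrightarrow> (\<And>x. norm (\<theta> x) \<le> d) \<Longrightarrow> (\<And>x. norm (\<Theta> x) \<le> M) \<Longrightarrow>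
       \<bar>LINT x|lebesgue. \<Phi> x \<bullet> \<Theta> x\<bar> \<le> e"
proof -
  obtain R where R: "\<Omega> \<subseteq> cball 0 R" using \<Omega> by (auto simp: bounded_iff subset_iff)
  have c\<Phi>: "continuous_on UNIV (\<lambda>x. \<Phi> x $ i $ j)" for i j by (intro continuous_intros \<Phi>)
  define small where "small i j d \<longleftrightarrow> (\<forall>\<theta> \<Theta>. C1_compact \<Omega> \<theta> \<Theta> \<longrightarrow> (\<forall>x. norm (\<theta> x) \<le> d) \<longrightarrow>
      (\<forall>x. norm (\<Theta> x) \<le> M) \<longrightarrow> \<bar>LINT x|lebesgue. \<Phi> x $ i $ j * \<Theta> x $ i $ j\<bar> \<le> e / 4)" for i j d
  have "\<exists>d>0. small i j d" for i j
  proof -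
    have "e / 4 > 0" using \<open>e > 0\<close> by simp
    then obtain d where d: "d > 0" "\<And>\<phi> g K. \<lbrakk>\<And>x. has_gradient \<phi> (g x) x; continuous_on UNIV g;
        compact K; K \<subseteq> cball 0 R; \<And>x. x \<notin> K \<Longrightarrow> \<phi> x = 0; \<And>x. x \<notin> K \<Longrightarrow> g x = 0;
        \<And>x. \<bar>\<phi> x\<bar> \<le> d; \<And>x. \<bar>g x \<bullet> axis j 1\<bar> \<le> M\<rbrakk> \<Longrightarrow>
        \<bar>LINT x|lebesgue. \<Phi> x $ i $ j * (g x \<bullet> axis j 1)\<bar> \<le> e / 4"
      by (rule weakly_small_if_uniformly_small[OF c\<Phi>[of i j], where R = R and b = "axis j 1" and M = M]) blast
    have "\<bar>LINT x|lebesgue. \<Phi> x $ i $ j * \<Theta> x $ i $ j\<bar> \<le> e / 4"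
      if C: "C1_compact \<Omega> \<theta> \<Theta>" and small: "\<forall>x. norm (\<theta> x) \<le> d" "\<forall>x. norm (\<Theta> x) \<le> M" for \<theta> \<Theta>
    proof -
      obtain K where K: "compact K" "K \<subseteq> \<Omega>" "\<And>x. x \<notin> K \<Longrightarrow> \<theta> x = 0 \<and> \<Theta> x = 0"
        and der: "\<And>x i. has_gradient (\<lambda>y. \<theta> y $ i) (\<Theta> x $ i) x"
        and c\<Theta>: "continuous_on UNIV \<Theta>" using C unfolding C1_compact_def by blast
      have "\<bar>LINT x|lebesgue. \<Phi> x $ i $ j * (\<Theta> x $ i \<bullet> axis j 1)\<bar> \<le> e / 4"
      proof (rule d(2)[OF der _ K(1)])
        show "continuous_on UNIV (\<lambda>x. \<Theta> x $ i)" by (intro continuous_intros c\<Theta>)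
        show "K \<subseteq> cball 0 R" using K(2) R by (rule order_trans)
        show "\<theta> x $ i = 0" "\<Theta> x $ i = 0" if "x \<notin> K" for x using K(3)[OF that] by simp_all
        show "\<bar>\<theta> x $ i\<bar> \<le> d" for x
          using component_le_norm_cart[of "\<theta> x" i] small(1)[rule_format, of x] by linarith
        show "\<bar>\<Theta> x $ i \<bullet> axis j 1\<bar> \<le> M" for x
          using norm_matrix_nth_le[of "\<Theta> x" i j] small(2)[rule_format, of x] by (simp add: inner_axis)
      qed
      then show ?thesis by (simp add: inner_axis)
    qed
    with d(1) show ?thesis unfolding small_def by blast
  qed
  then obtain d where d0: "\<And>i j. d i j > 0 \<and> small i j (d i j)" by metis
  have d: "d i j > 0"
    "C1_compact \<Omega> \<theta> \<Theta> \<Longrightarrow> \<forall>x. norm (\<theta> x) \<le> d i j \<Longrightarrow> \<forall>x. norm (\<Theta> x) \<le> M \<Longrightarrow>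
      \<bar>LINT x|lebesgue. \<Phi> x $ i $ j * \<Theta> x $ i $ j\<bar> \<le> e / 4" for i j \<theta> \<Theta>
    using d0[of i j] unfolding small_def by blast+
  define d' where "d' = min (min (d 1 1) (d 1 2)) (min (d 2 1) (d 2 2))"
  have d': "d' > 0" "d' \<le> d i j" for i j
    using d(1) exhaust_2[of i] exhaust_2[of j] by (auto simp: d'_def)
  moreover have "\<bar>LINT x|lebesgue. \<Phi> x \<bullet> \<Theta> x\<bar> \<le> e"
    if C: "C1_compact \<Omega> \<theta> \<Theta>" and small: "\<And>x. norm (\<theta> x) \<le> d'" "\<And>x. norm (\<Theta> x) \<le> M" for \<theta> \<Theta>
  proof -
    obtain K where K: "compact K" "\<And>x. x \<notin> K \<Longrightarrow> \<Theta> x = 0"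
      and c\<Theta>: "continuous_on UNIV \<Theta>" using C unfolding C1_compact_def by blast
    have b: "\<bar>LINT x|lebesgue. \<Phi> x $ i $ j * \<Theta> x $ i $ j\<bar> \<le> e / 4" for i j
      using small d'(2)[of i j] by (intro d(2)[OF C]) (auto intro: order_trans)
    have "integrable lebesgue (\<lambda>x. \<Phi> x $ i $ j * \<Theta> x $ i $ j)" for i j
      by (rule integrable_compact_support[OF _ K(1)])
        (auto intro!: continuous_intros \<Phi> c\<Theta> simp: K(2))
    then have "(LINT x|lebesgue. \<Phi> x \<bullet> \<Theta> x) = (\<Sum>i\<in>UNIV. \<Sum>j\<in>UNIV. LINT x|lebesgue. \<Phi> x $ i $ j * \<Theta> x $ i $ j)"
      by (simp add: inner_vec_def Bochner_Integration.integral_sum Bochner_Integration.integrable_sum)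
    also have "\<bar>\<dots>\<bar> \<le> e"
      using b[of 1 1] b[of 1 2] b[of 2 1] b[of 2 2] unfolding sum_2 by linarith
    finally show ?thesis .
  qed
  ultimately show ?thesis by (intro that[of d']) auto
qed

text \<open>Here \<open>E k\<close> stands for the squared norm of the \<open>k\<close>-th gradient, and \<open>D m k\<close> for the squared distance
  between two of them.\<close>

lemma almost_monotone_Cauchy:
  fixes E :: "nat \<Rightarrow> real" and D :: "nat \<Rightarrow> nat \<Rightarrow> real"
  assumes bdd: "\<And>k. E k \<le> B" and nn: "\<And>m k. D m k \<ge> 0"
    and D: "\<And>m k. k \<le> m \<Longrightarrow> D m k \<le> E m - E k + 2 * (1/2)^k" and "e > 0"
  obtains N where "\<And>m k. N \<le> k \<Longrightarrow> k \<le> m \<Longrightarrow> D m k < e"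
proof -
  \<comment> \<open>The possible loss \<open>2 * (1/2)^k\<close> in step \<open>k\<close> is the decrease of \<open>4 * (1/2)^k\<close>.\<close>
  define a where "a k = E k - 4 * (1/2)^k" for k
  have "a k \<le> a (Suc k)" for k
    using D[of k "Suc k"] nn[of "Suc k" k] by (simp add: a_def)
  then have "incseq a" by (rule incseq_SucI)
  moreover have "a k \<le> B" for k using bdd[of k] by (simp add: a_def add_increasing2 diff_le_eq)
  ultimately obtain L where "a \<longlonglongrightarrow> L" using incseq_convergent by metis
  then have "Cauchy a" by (rule LIMSEQ_imp_Cauchy)
  then obtain N1 where N1: "\<And>m k. m \<ge> N1 \<Longrightarrow> k \<ge> N1 \<Longrightarrow> \<bar>a m - a k\<bar> < e/2"
    using \<open>e > 0\<close> unfolding Cauchy_iff by (metis half_gt_zero real_norm_def)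
  have "(\<lambda>k. 4 * (1/2::real)^k) \<longlonglongrightarrow> 4 * 0"
    by (intro tendsto_mult_left LIMSEQ_power_zero) simp
  then have "\<forall>\<^sub>F k in sequentially. 4 * (1/2::real)^k < e/2"
    by (rule order_tendstoD) (use \<open>e > 0\<close> in simp)
  then obtain N2 where N2: "\<And>k. k \<ge> N2 \<Longrightarrow> 4 * (1/2::real)^k < e/2"
    unfolding eventually_sequentially by blast
  have "D m k < e" if "max N1 N2 \<le> k" "k \<le> m" for m k
  proof -
    have "D m k \<le> (a m - a k) + 4 * (1/2)^m - 2 * (1/2)^k"
      using D[OF that(2)] by (simp add: a_def)
    moreover have "\<bar>a m - a k\<bar> < e/2" "4 * (1/2::real)^m < e/2" using N1 N2 that by auto
    moreover have "(1/2::real)^k > 0" by simp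
    ultimately show ?thesis by linarith
  qed
  then show ?thesis by (rule that)
qed

text \<open>On sets of finite measure the passage from \<open>L\<^sup>2\<close> to \<open>L\<^sup>1\<close> rests on \<open>y \<le> s + y\<^sup>2 / s\<close> for \<open>s > 0\<close>.\<close>

lemma L1_Cauchy_if_L2_Cauchy:
  fixes f :: "nat \<Rightarrow> 'a::euclidean_space \<Rightarrow> 'b::euclidean_space"
  assumes S: "S \<in> lmeasurable" "\<And>k x. x \<notin> S \<Longrightarrow> f k x = 0"
    and i1: "\<And>m k. integrable lebesgue (\<lambda>x. norm (f m x - f k x))"
    and i2: "\<And>m k. integrable lebesgue (\<lambda>x. (norm (f m x - f k x))\<^sup>2)"
    and Cauchy: "\<And>e. e > 0 \<Longrightarrow> \<exists>N. \<forall>k m. N \<le> k \<longrightarrow> k \<le> m \<longrightarrow> (LINT x|lebesgue. (norm (f m x - f k x))\<^sup>2) < e"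
    and "e > 0"
  shows "\<exists>N. \<forall>m\<ge>N. \<forall>k\<ge>N. (LINT x|lebesgue. norm (f m x - f k x)) < e"
proof -
  define s where "s = e / (2 * (measure lebesgue S + 1))"
  have m: "measure lebesgue S + 1 > 0" by (simp add: add_nonneg_pos)
  then have s: "s > 0" using \<open>e > 0\<close> by (simp add: s_def)
  have "s * measure lebesgue S \<le> s * (measure lebesgue S + 1)" using s by (intro mult_left_mono) auto
  also have "\<dots> = e / 2" using m unfolding s_def by (simp add: divide_simps)
  finally have s': "s * measure lebesgue S \<le> e / 2" .
  have "s * (e / 2) > 0" using s \<open>e > 0\<close> by simp
  then obtain N where N: "\<And>k m. N \<le> k \<Longrightarrow> k \<le> m \<Longrightarrow> (LINT x|lebesgue. (norm (f m x - f k x))\<^sup>2) < s * (e / 2)"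
    using Cauchy by blast
  have *: "(LINT x|lebesgue. norm (f m x - f k x)) < e" if "N \<le> k" "k \<le> m" for m k
  proof -
    have "(LINT x|lebesgue. norm (f m x - f k x))
        \<le> (LINT x|lebesgue. s * indicat_real S x + (norm (f m x - f k x))\<^sup>2 / s)"
    proof (rule integral_mono[OF i1])
      show "integrable lebesgue (\<lambda>x. s * indicat_real S x + (norm (f m x - f k x))\<^sup>2 / s)"
        using integrable_scaled_indicator[OF S(1), of s] i2 by (intro Bochner_Integration.integrable_add) auto
      show "norm (f m x - f k x) \<le> s * indicat_real S x + (norm (f m x - f k x))\<^sup>2 / s" for x
      proof (cases "x \<in> S")
        case True
        define y where "y = norm (f m x - f k x)"
        have "y * s \<le> s * s + y * y"
        proof (cases "y \<le> s")
          case True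
          then have "y * s \<le> s * s" using s by (intro mult_right_mono) auto
          then show ?thesis by (simp add: add_increasing2)
        next
          case False
          then have "y * s \<le> y * y" using s by (intro mult_left_mono) auto
          then show ?thesis by (simp add: add_increasing)
        qed
        then have "y \<le> s + y\<^sup>2 / s" using s by (simp add: field_simps power2_eq_square)
        with True show ?thesis by (simp add: y_def)
      next
        case False
        then show ?thesis by (simp add: S(2))
      qed
    qed
    also have "\<dots> = s * measure lebesgue S + (LINT x|lebesgue. (norm (f m x - f k x))\<^sup>2) / s"
      using integrable_scaled_indicator[OF S(1), of s] i2 S(1)
      by (subst Bochner_Integration.integral_add) auto
    also have "\<dots> < s * measure lebesgue S + e / 2"
      using N[OF that] s by (simp add: divide_less_eq mult.commute)
    also have "\<dots> \<le> e" using s' by linarith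
    finally show ?thesis .
  qed
  then have "(LINT x|lebesgue. norm (f m x - f k x)) < e" if "N \<le> k" "N \<le> m" for m k
    using *[of k m] *[of m k] that by (cases "k \<le> m") (auto simp: norm_minus_commute)
  then show ?thesis by blast
qed

text \<open>The perturbations converge uniformly and their gradients in \<open>L\<^sup>2\<close>, so almost everywhere along a
  subsequence. At every stage the size of the next increments is chosen after the current gradient, and
  so small that all later changes of the gradient are almost orthogonal to it.\<close>

lemma exact_perturbation:
  fixes G :: "real^2 \<Rightarrow> real^2^2"
  assumes \<Omega>: "open \<Omega>" "bounded \<Omega>" and G: "continuous_on \<Omega> G" "\<And>x. x \<in> \<Omega> \<Longrightarrow> G x \<in> admissible C"
    "\<And>x. x \<in> \<Omega> \<Longrightarrow> trace (G x) = 0" and C: "C \<ge> 1" and \<epsilon>: "\<epsilon> > 0"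
  obtains \<phi> :: "real^2 \<Rightarrow> real^2" and W :: "real^2 \<Rightarrow> real^2^2" and M where
    "continuous_on UNIV \<phi>" "\<forall>x. x \<notin> \<Omega> \<longrightarrow> \<phi> x = 0" "\<forall>x. norm (\<phi> x) \<le> \<epsilon>"
    "W \<in> borel_measurable lebesgue" "AE x in lebesgue. norm (W x) \<le> M"
    "AE x in lebesgue. trace (W x) = 0" "AE x in lebesgue. x \<in> \<Omega> \<longrightarrow> deficit (G x + W x) = 0"
    "\<forall>S. \<Omega> \<subseteq> S \<longrightarrow> has_weak_gradient S \<phi> W"
proof -
  define M where "M = 10 + 4 * C"
  \<comment> \<open>The increments after stage \<open>n\<close> are bounded by \<open>d n\<close>, \<open>d n / 2\<close>, \<open>d n / 4\<close> and so on, hence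
    their sum by \<open>2 * d n\<close>; \<open>M\<close> bounds its gradient.\<close>
  define pair where "pair n d \<Phi> \<longleftrightarrow> (\<forall>\<theta> \<Theta>. C1_compact \<Omega> \<theta> \<Theta> \<longrightarrow> (\<forall>x. norm (\<theta> x) \<le> 2 * d) \<longrightarrow>
      (\<forall>x. norm (\<Theta> x) \<le> M) \<longrightarrow> \<bar>LINT x|lebesgue. \<Phi> x \<bullet> \<Theta> x\<bar> \<le> (1/2)^n)" for n d and \<Phi> :: "real^2 \<Rightarrow> real^2^2"
  have ex_pair: "\<exists>d>0. d \<le> c \<and> pair n d \<Phi>" if cont: "continuous_on UNIV \<Phi>" and "c > 0" for n c \<Phi>
  proof -
    have "(1/2::real)^n > 0" by simp
    then obtain d where d: "d > 0" "\<And>\<theta> \<Theta>. C1_compact \<Omega> \<theta> \<Theta> \<Longrightarrow> (\<And>x. norm (\<theta> x) \<le> d) \<Longrightarrow> (\<And>x. norm (\<Theta> x) \<le> M) \<Longrightarrow>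
       \<bar>LINT x|lebesgue. \<Phi> x \<bullet> \<Theta> x\<bar> \<le> (1/2)^n"
      by (rule weakly_small_matrix[OF cont \<Omega>(2), where M = M]) blast
    have "pair n (min (d/2) c) \<Phi>"
      unfolding pair_def
    proof (intro allI impI)
      fix \<theta> \<Theta> assume *: "C1_compact \<Omega> \<theta> \<Theta>" "\<forall>x. norm (\<theta> x) \<le> 2 * min (d/2) c" "\<forall>x. norm (\<Theta> x) \<le> M"
      have "norm (\<theta> x) \<le> d" for x using *(2)[rule_format, of x] by linarith
      with * show "\<bar>LINT x|lebesgue. \<Phi> x \<bullet> \<Theta> x\<bar> \<le> (1/2)^n" by (intro d(2)) auto
    qed
    with d(1) \<open>c > 0\<close> show ?thesis by (intro exI[of _ "min (d/2) c"]) auto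
  qed
  \<comment> \<open>A state consists of a perturbation, its gradient and the bound for the next increment.\<close>
  define P where "P n s \<longleftrightarrow> (case s of (\<phi>, \<Phi>, d) \<Rightarrow> C1_compact \<Omega> \<phi> \<Phi> \<and> (\<forall>x. trace (\<Phi> x) = 0) \<and>
      (\<forall>x\<in>\<Omega>. G x + \<Phi> x \<in> admissible C) \<and> d > 0 \<and> pair n d \<Phi> \<and> (n = 0 \<longrightarrow> (\<forall>x. \<phi> x = 0) \<and> d \<le> \<epsilon> / 2))"
    for n :: nat and s :: "(real^2 \<Rightarrow> real^2) \<times> (real^2 \<Rightarrow> real^2^2) \<times> real"
  define Q where "Q s s' \<longleftrightarrow> (case (s, s') of ((\<phi>, \<Phi>, d), (\<phi>', \<Phi>', d')) \<Rightarrow> d' \<le> d / 2 \<and>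
      (\<forall>x. norm (\<phi>' x - \<phi> x) \<le> d) \<and>
      (LINT x|lebesgue. indicat_real \<Omega> x * (deficit (G x + \<Phi> x))\<^sup>2) \<le> 800 * (LINT x|lebesgue. (norm (\<Phi>' x - \<Phi> x))\<^sup>2))"
    for s s' :: "(real^2 \<Rightarrow> real^2) \<times> (real^2 \<Rightarrow> real^2^2) \<times> real"
  have "\<exists>s. \<forall>n. P n (s n) \<and> Q (s n) (s (Suc n))"
  proof (rule dependent_nat_choice)
    obtain d where "d > 0" "d \<le> \<epsilon> / 2" "pair 0 d (\<lambda>x. 0)"
      using ex_pair[of "\<lambda>x. 0" "\<epsilon> / 2" 0] \<epsilon> by auto
    then have "P 0 (\<lambda>x. 0, \<lambda>x. 0, d)"
      unfolding P_def using C1_compact_0 G(2) by (simp add: trace_def)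
    then show "\<exists>s. P 0 s" by blast
  next
    fix s n assume "P n s"
    obtain \<phi> \<Phi> d where s: "s = (\<phi>, \<Phi>, d)" by (cases s) auto
    have p: "C1_compact \<Omega> \<phi> \<Phi>" "\<And>x. trace (\<Phi> x) = 0" "\<And>x. x \<in> \<Omega> \<Longrightarrow> G x + \<Phi> x \<in> admissible C" "d > 0"
      using \<open>P n s\<close> unfolding P_def s by auto
    have "continuous_on \<Omega> (\<lambda>x. G x + \<Phi> x)"
      by (intro continuous_intros G(1) continuous_on_subset[OF C1_compactD(2)[OF p(1)]]) auto
    then obtain \<eta> H where st: "C1_compact \<Omega> \<eta> H" "\<And>x. norm (\<eta> x) \<le> d" "\<And>x. trace (H x) = 0"
      "\<And>x. x \<in> \<Omega> \<Longrightarrow> (G x + \<Phi> x) + H x \<in> admissible C"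
      "(LINT x|lebesgue. indicat_real \<Omega> x * (deficit (G x + \<Phi> x))\<^sup>2) \<le> 800 * (LINT x|lebesgue. (norm (H x))\<^sup>2)"
      by (rule ex_perturbation_step[OF \<Omega> _ p(3) C p(4)]) blast+
    let ?\<phi> = "\<lambda>x. \<phi> x + \<eta> x" and ?\<Phi> = "\<lambda>x. \<Phi> x + H x"
    have c1: "C1_compact \<Omega> ?\<phi> ?\<Phi>" by (rule C1_compact_add[OF p(1) st(1)])
    obtain d' where d': "d' > 0" "d' \<le> d / 2" "pair (Suc n) d' ?\<Phi>"
      using ex_pair[OF C1_compactD(2)[OF c1], of "d/2" "Suc n"] p(4) by auto
    have "P (Suc n) (?\<phi>, ?\<Phi>, d')"
      unfolding P_def using c1 p(2) st(3,4) d' by (simp add: trace_add add.assoc)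
    moreover have "Q s (?\<phi>, ?\<Phi>, d')"
      unfolding Q_def s using d'(2) st(2,5) by simp
    ultimately show "\<exists>s'. P (Suc n) s' \<and> Q s s'" by blast
  qed
  then obtain s where s: "\<And>n. P n (s n)" "\<And>n. Q (s n) (s (Suc n))" by blast
  define \<phi> where "\<phi> n = fst (s n)" for n
  define \<Phi> where "\<Phi> n = fst (snd (s n))" for n
  define d where "d n = snd (snd (s n))" for n
  have sn: "s n = (\<phi> n, \<Phi> n, d n)" for n by (simp add: \<phi>_def \<Phi>_def d_def)
  have p: "C1_compact \<Omega> (\<phi> n) (\<Phi> n)" "\<And>x. trace (\<Phi> n x) = 0" "\<And>x. x \<in> \<Omega> \<Longrightarrow> G x + \<Phi> n x \<in> admissible C"
    "d n > 0" "pair n (d n) (\<Phi> n)" for n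
    using s(1)[of n] unfolding P_def sn by auto
  have p0: "\<phi> 0 x = 0" "d 0 \<le> \<epsilon> / 2" for x using s(1)[of 0] unfolding P_def sn by auto
  have q: "d (Suc n) \<le> d n / 2" "norm (\<phi> (Suc n) x - \<phi> n x) \<le> d n"
    "(LINT x|lebesgue. indicat_real \<Omega> x * (deficit (G x + \<Phi> n x))\<^sup>2) \<le> 800 * (LINT x|lebesgue. (norm (\<Phi> (Suc n) x - \<Phi> n x))\<^sup>2)"
    for n x using s(2)[of n] unfolding Q_def sn by auto
  have tel: "norm (\<phi> (k + n) x - \<phi> k x) \<le> 2 * d k - 2 * d (k + n)" for k n x
  proof (induction n)
    case (Suc n)
    have "norm (\<phi> (k + Suc n) x - \<phi> k x) \<le> norm (\<phi> (Suc (k + n)) x - \<phi> (k + n) x) + norm (\<phi> (k + n) x - \<phi> k x)"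
      using norm_triangle_ineq[of "\<phi> (Suc (k + n)) x - \<phi> (k + n) x" "\<phi> (k + n) x - \<phi> k x"] by simp
    with Suc q(2)[of "k + n" x] q(1)[of "k + n"] show ?case by simp
  qed simp
  have \<phi>d: "norm (\<phi> m x - \<phi> k x) \<le> 2 * d k" if "k \<le> m" for k m x
    using tel[of k "m - k" x] p(4)[of m] that by simp
  have dle: "d n \<le> d 0 * (1/2)^n" for n
  proof (induction n)
    case (Suc n)
    then show ?case using q(1)[of n] by simp
  qed simp
  have d0: "d \<longlonglongrightarrow> 0"
  proof (rule tendsto_sandwich[of "\<lambda>n. 0" d _ "\<lambda>n. d 0 * (1/2)^n"])
    show "(\<lambda>n. d 0 * (1/2)^n) \<longlonglongrightarrow> 0" by (intro tendsto_mult_right_zero LIMSEQ_power_zero) simp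
  qed (use p(4) dle in \<open>auto intro!: always_eventually less_imp_le\<close>)
  have \<Phi>b: "norm (\<Phi> n x) \<le> M" "norm (\<Phi> m x - \<Phi> n x) \<le> M" for m n x
  proof -
    have *: "norm (G x) \<le> M / 2" "norm (G x + \<Phi> k x) \<le> M / 2" if "x \<in> \<Omega>" for k
    proof -
      have "trace (G x + \<Phi> k x) = 0" using p(2)[of k x] G(3)[OF that] by (simp add: trace_add)
      then show "norm (G x) \<le> M / 2" "norm (G x + \<Phi> k x) \<le> M / 2"
        using admissible_norm_le[OF G(2)[OF that] G(3)[OF that]] admissible_norm_le[OF p(3)[OF that, of k]]
        unfolding M_def by simp_all
    qed
    have "M \<ge> 0" using C by (simp add: M_def)
    then show "norm (\<Phi> n x) \<le> M"
      using *(1) *(2)[of n] norm_triangle_ineq4[of "G x + \<Phi> n x" "G x"] C1_compactD(5)[OF p(1), of x n]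
      by (cases "x \<in> \<Omega>") auto
    show "norm (\<Phi> m x - \<Phi> n x) \<le> M"
      using *(2)[of n] *(2)[of m] norm_triangle_ineq4[of "G x + \<Phi> m x" "G x + \<Phi> n x"]
        C1_compactD(5)[OF p(1), of x n] C1_compactD(5)[OF p(1), of x m] \<open>M \<ge> 0\<close>
      by (cases "x \<in> \<Omega>") auto
  qed
  have cont: "continuous_on UNIV (\<Phi> n)" for n by (rule C1_compactD(2)[OF p(1)])
  have z: "\<Phi> n x = 0" "\<phi> n x = 0" if "x \<notin> \<Omega>" for n x using C1_compactD(4,5)[OF p(1) that] by auto
  have lm: "\<Omega> \<in> lmeasurable" using \<Omega> by (rule lmeasurable_open[rotated])
  obtain R where R: "\<Omega> \<subseteq> cball 0 R" using \<Omega>(2) by (auto simp: bounded_iff subset_iff)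
  have z': "\<Phi> n x = 0" if "x \<notin> cball 0 R" for n x using z(1) R that by blast
  define E where "E k = (LINT x|lebesgue. (norm (\<Phi> k x))\<^sup>2)" for k
  define D where "D m k = (LINT x|lebesgue. (norm (\<Phi> m x - \<Phi> k x))\<^sup>2)" for m k
  have i1: "integrable lebesgue (\<Phi> n)" for n
    by (rule integrable_compact_support[OF cont compact_cball[of 0 R] z'])
  have i2: "integrable lebesgue (\<lambda>x. (norm (\<Phi> m x - \<Phi> k x))\<^sup>2)" "integrable lebesgue (\<lambda>x. norm (\<Phi> m x - \<Phi> k x))"
    "integrable lebesgue (\<lambda>x. (norm (\<Phi> k x))\<^sup>2)" "integrable lebesgue (\<lambda>x. \<Phi> k x \<bullet> (\<Phi> m x - \<Phi> k x))" for m k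
    by (rule integrable_compact_support[OF _ compact_cball[of 0 R]]; auto intro!: continuous_intros cont simp: z')+
  \<comment> \<open>Near-orthogonality yields Pythagoras' theorem up to an error of \<open>2 * (1/2)^k\<close>.\<close>
  have Db: "D m k \<le> E m - E k + 2 * (1/2)^k" if "k \<le> m" for m k
  proof -
    have "\<bar>LINT x|lebesgue. \<Phi> k x \<bullet> (\<Phi> m x - \<Phi> k x)\<bar> \<le> (1/2)^k"
      using p(5)[of k] C1_compact_diff[OF p(1)[of m] p(1)[of k]] \<phi>d[OF that] \<Phi>b(2)
      unfolding pair_def by blast
    moreover have "E m = E k + (D m k + 2 * (LINT x|lebesgue. \<Phi> k x \<bullet> (\<Phi> m x - \<Phi> k x)))"
    proof -
      have "(norm (\<Phi> m x))\<^sup>2 = (norm (\<Phi> k x))\<^sup>2 + ((norm (\<Phi> m x - \<Phi> k x))\<^sup>2 + 2 * (\<Phi> k x \<bullet> (\<Phi> m x - \<Phi> k x)))" for x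
        unfolding power2_norm_eq_inner by (simp add: inner_diff_left inner_diff_right inner_commute)
      then show ?thesis unfolding E_def D_def using i2 by simp
    qed
    ultimately show ?thesis by linarith
  qed
  have Eb: "E k \<le> M\<^sup>2 * measure lebesgue \<Omega>" for k
  proof -
    have "\<bar>E k\<bar> \<le> M\<^sup>2 * measure lebesgue \<Omega>"
      unfolding E_def using \<Phi>b(1)
      by (intro integral_abs_le_support lm borel_measurable_integrable i2) (auto intro!: power_mono simp: z)
    then show ?thesis by linarith
  qed
  have "D m k \<ge> 0" for m k unfolding D_def by simp
  then have DC: "\<exists>N. \<forall>k m. N \<le> k \<longrightarrow> k \<le> m \<longrightarrow> D m k < e" if "e > 0" for e
    by (rule almost_monotone_Cauchy[OF Eb _ Db that]) blast+
  have L1: "\<exists>N. \<forall>m\<ge>N. \<forall>k\<ge>N. (LINT x|lebesgue. norm (\<Phi> m x - \<Phi> k x)) < e" if "e > 0" for e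
    by (rule L1_Cauchy_if_L2_Cauchy[OF lm z(1) i2(2,1) DC[unfolded D_def] that])
  obtain r where r: "strict_mono r" "AE x in lebesgue. Cauchy (\<lambda>i. \<Phi> (r i) x)"
    by (rule cauchy_L1_AE_cauchy_subseq[OF i1 L1])
  define W where "W x = lim (\<lambda>i. \<Phi> (r i) x)" for x
  have Wlim: "AE x in lebesgue. (\<lambda>i. \<Phi> (r i) x) \<longlonglongrightarrow> W x"
    using r(2) unfolding W_def by eventually_elim (simp add: Cauchy_convergent_iff convergent_LIMSEQ_iff)
  have W_meas: "W \<in> borel_measurable lebesgue"
    unfolding W_def by (intro borel_measurable_lim_metric borel_measurable_lebesgue_continuous cont)
  have W0: "W x = 0" if "x \<notin> \<Omega>" for x unfolding W_def using z(1)[OF that] by (simp add: limI)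
  have Wb: "AE x in lebesgue. norm (W x) \<le> M"
    using Wlim by eventually_elim (rule Lim_norm_ubound[OF sequentially_bot], auto intro!: always_eventually \<Phi>b)
  have Wtr: "AE x in lebesgue. trace (W x) = 0"
    using Wlim
  proof eventually_elim
    case (elim x)
    have "(\<lambda>i. trace (\<Phi> (r i) x)) \<longlonglongrightarrow> trace (W x)"
      unfolding trace_def by (intro tendsto_intros elim)
    then show ?case using p(2) by (simp add: LIMSEQ_const_iff)
  qed
  define f where "f n x = indicat_real \<Omega> x * (deficit (G x + \<Phi> n x))\<^sup>2" for n x
  define f' where "f' x = indicat_real \<Omega> x * (deficit (G x + W x))\<^sup>2" for x
  have cd: "continuous_on UNIV deficit" unfolding deficit_def by (intro continuous_intros)
  have f_meas: "f n \<in> borel_measurable lebesgue" for n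
  proof -
    have "continuous_on \<Omega> (\<lambda>x. (deficit (G x + \<Phi> n x))\<^sup>2)"
      unfolding deficit_def by (intro continuous_intros G(1) continuous_on_subset[OF cont]) auto
    from indicator_continuous_measurable[OF \<Omega>(1) this] show ?thesis by (simp add: f_def[abs_def])
  qed
  have fb: "norm (f n x) \<le> 1 * indicat_real \<Omega> x" for n x
  proof (cases "x \<in> \<Omega>")
    case True
    have "0 \<le> deficit (G x + \<Phi> n x)" "deficit (G x + \<Phi> n x) \<le> 1"
      using p(3)[OF True, of n] norm_ge_zero[of "dev (G x + \<Phi> n x)"] unfolding deficit_def admissible_def mem_Collect_eq
      by linarith+
    then show ?thesis using True by (simp add: f_def abs_square_le_1)
  qed (simp add: f_def)
  have flim: "AE x in lebesgue. (\<lambda>i. f (r i) x) \<longlonglongrightarrow> f' x"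
    using Wlim unfolding f_def f'_def
    by eventually_elim (intro tendsto_intros isCont_tendsto_compose[of _ deficit], use cd in \<open>simp_all add: continuous_on_eq_continuous_at\<close>)
  have f'_meas: "f' \<in> borel_measurable lebesgue"
  proof -
    from borel_measurable_add[OF indicator_continuous_measurable[OF \<Omega>(1) G(1)] W_meas]
    have "(\<lambda>x. deficit (indicat_real \<Omega> x *\<^sub>R G x + W x)) \<in> borel_measurable lebesgue"
      by (rule measurable_compose) (intro borel_measurable_continuous_onI cd)
    then have "(\<lambda>x. indicat_real \<Omega> x * (deficit (indicat_real \<Omega> x *\<^sub>R G x + W x))\<^sup>2) \<in> borel_measurable lebesgue"
      using \<Omega>(1) by (intro borel_measurable_times borel_measurable_power borel_measurable_indicator) auto
    moreover have "(\<lambda>x. indicat_real \<Omega> x * (deficit (indicat_real \<Omega> x *\<^sub>R G x + W x))\<^sup>2) = f'"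
      by (auto simp: f'_def indicator_def)
    ultimately show ?thesis by simp
  qed
  have "(\<lambda>i. LINT x|lebesgue. f (r i) x) \<longlonglongrightarrow> (LINT x|lebesgue. f' x)"
    by (rule integral_dominated_convergence[OF f'_meas f_meas integrable_scaled_indicator[OF lm, where B = 1] flim])
      (intro AE_I2 fb)
  \<comment> \<open>The deficit is controlled by the next increment, and the increments tend to zero in \<open>L\<^sup>2\<close>.\<close>
  moreover have "(\<lambda>i. LINT x|lebesgue. f (r i) x) \<longlonglongrightarrow> 0"
  proof (rule LIMSEQ_I)
    fix e :: real assume "e > 0"
    then have "e / 800 > 0" by simp
    then obtain N where N: "\<And>k m. N \<le> k \<Longrightarrow> k \<le> m \<Longrightarrow> D m k < e / 800" using DC by blast
    have "norm ((LINT x|lebesgue. f (r i) x) - 0) < e" if "N \<le> i" for i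
    proof -
      have "N \<le> r i" using that seq_suble[OF r(1), of i] by linarith
      then have "(LINT x|lebesgue. f (r i) x) < e"
        using N[of "r i" "Suc (r i)"] q(3)[of "r i"] unfolding f_def D_def by simp
      moreover have "(LINT x|lebesgue. f (r i) x) \<ge> 0" by (simp add: f_def)
      ultimately show ?thesis by simp
    qed
    then show "\<exists>N. \<forall>i\<ge>N. norm ((LINT x|lebesgue. f (r i) x) - 0) < e" by blast
  qed
  ultimately have f'0: "(LINT x|lebesgue. f' x) = 0" by (rule LIMSEQ_unique)
  have f'_int: "integrable lebesgue f'"
    by (rule integrable_dominated_convergence[OF f'_meas f_meas integrable_scaled_indicator[OF lm, where B = 1] flim])
      (intro AE_I2 fb)
  have "AE x in lebesgue. f' x = 0"
    using integral_nonneg_eq_0_iff_AE[OF f'_int] f'0 by (simp add: f'_def)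
  then have Wdef: "AE x in lebesgue. x \<in> \<Omega> \<longrightarrow> deficit (G x + W x) = 0"
    by eventually_elim (auto simp: f'_def)
  define \<phi>' where "\<phi>' x = lim (\<lambda>n. \<phi> n x)" for x
  have \<phi>lim: "(\<lambda>n. \<phi> n x) \<longlonglongrightarrow> \<phi>' x" for x
  proof -
    have "Cauchy (\<lambda>n. \<phi> n x)"
    proof (rule CauchyI')
      fix e :: real assume "e > 0"
      then have "\<forall>\<^sub>F n in sequentially. d n < e / 2" using d0 by (intro order_tendstoD(2)) auto
      then obtain N where N: "\<And>n. n \<ge> N \<Longrightarrow> d n < e / 2" by (auto simp: eventually_sequentially)
      have "norm (\<phi> m x - \<phi> n x) < e" if "m \<ge> N" "n > m" for m n
        using \<phi>d[of m n x] N[OF that(1)] that by (simp add: norm_minus_commute)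
      then show "\<exists>N. \<forall>m\<ge>N. \<forall>n>m. dist (\<phi> m x) (\<phi> n x) < e" unfolding dist_norm by blast
    qed
    then show ?thesis unfolding \<phi>'_def by (simp add: Cauchy_convergent_iff convergent_LIMSEQ_iff)
  qed
  have \<phi>'d: "norm (\<phi>' x - \<phi> k x) \<le> 2 * d k" for k x
  proof (rule Lim_norm_ubound[OF sequentially_bot])
    show "(\<lambda>n. \<phi> n x - \<phi> k x) \<longlonglongrightarrow> \<phi>' x - \<phi> k x" by (intro tendsto_intros \<phi>lim)
    show "\<forall>\<^sub>F n in sequentially. norm (\<phi> n x - \<phi> k x) \<le> 2 * d k"
      unfolding eventually_sequentially using \<phi>d by blast
  qed
  have "uniform_limit UNIV \<phi> \<phi>' sequentially"
  proof (rule uniform_limitI)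
    fix e :: real assume "e > 0"
    then have "\<forall>\<^sub>F n in sequentially. d n < e / 2" using d0 by (intro order_tendstoD(2)) auto
    then show "\<forall>\<^sub>F n in sequentially. \<forall>x\<in>UNIV. dist (\<phi> n x) (\<phi>' x) < e"
    proof eventually_elim
      case (elim n)
      have "norm (\<phi>' x - \<phi> n x) < e" for x using \<phi>'d[of x n] elim by linarith
      then show ?case by (simp add: dist_norm norm_minus_commute)
    qed
  qed
  then have c\<phi>': "continuous_on UNIV \<phi>'"
    by (rule uniform_limit_theorem[rotated]) (auto intro!: always_eventually C1_compactD(3)[OF p(1)])
  have z\<phi>': "\<phi>' x = 0" if "x \<notin> \<Omega>" for x
    unfolding \<phi>'_def using z(2)[OF that] by (simp add: limI)
  have b\<phi>': "norm (\<phi>' x) \<le> \<epsilon>" for x using \<phi>'d[of x 0] p0(1)[of x] p0(2) by simp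
  have ibp: "(LINT x|lebesgue. \<phi>' x $ i * (g x \<bullet> e)) = - (LINT x|lebesgue. (W x $ i \<bullet> e) * \<psi> x)"
    if \<psi>: "\<And>x. has_gradient \<psi> (g x) x" and cg: "continuous_on UNIV g" and K: "compact K"
      and K0: "\<And>x. x \<notin> K \<Longrightarrow> \<psi> x = 0" "\<And>x. x \<notin> K \<Longrightarrow> g x = 0" for \<psi> g K i e
  proof -
    have c\<psi>: "continuous_on UNIV \<psi>" by (rule continuous_on_if_derivative, fact)
    obtain B where B: "B > 0" "\<And>x. norm (g x) \<le> B" using bounded_compact_support[OF cg K K0(2)] by blast
    obtain B' where B': "B' > 0" "\<And>x. norm (\<psi> x) \<le> B'" using bounded_compact_support[OF c\<psi> K K0(1)] by blast
    have Kl: "K \<in> lmeasurable" using K by (rule lmeasurable_compact)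
    have eq: "(LINT x|lebesgue. \<phi> n x $ i * (g x \<bullet> e)) = - (LINT x|lebesgue. (\<Phi> n x $ i \<bullet> e) * \<psi> x)" for n
    proof (rule integral_by_parts_compact_support[OF C1_compactD(1)[OF p(1)] _ \<psi> cg K K0])
      show "continuous_on UNIV (\<lambda>x. \<Phi> n x $ i)" by (intro continuous_intros cont)
    qed auto
    have "(\<lambda>k. LINT x|lebesgue. \<phi> (r k) x $ i * (g x \<bullet> e)) \<longlonglongrightarrow> (LINT x|lebesgue. \<phi>' x $ i * (g x \<bullet> e))"
    proof (rule integral_dominated_convergence[OF _ _ integrable_scaled_indicator[OF Kl, of "(2 * d 0) * (B * norm e)"]])
      show "(\<lambda>x. \<phi>' x $ i * (g x \<bullet> e)) \<in> borel_measurable lebesgue"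
        "(\<lambda>x. \<phi> (r k) x $ i * (g x \<bullet> e)) \<in> borel_measurable lebesgue" for k
        by (intro borel_measurable_lebesgue_continuous continuous_intros c\<phi>' cg C1_compactD(3)[OF p(1)])+
      show "AE x in lebesgue. (\<lambda>k. \<phi> (r k) x $ i * (g x \<bullet> e)) \<longlonglongrightarrow> \<phi>' x $ i * (g x \<bullet> e)"
        using LIMSEQ_subseq_LIMSEQ[OF \<phi>lim r(1)]
        by (intro AE_I2 tendsto_intros) (simp add: o_def)
      have "\<bar>\<phi> (r k) x $ i * (g x \<bullet> e)\<bar> \<le> (2 * d 0) * (B * norm e)" for k x
      proof -
        have "\<bar>\<phi> (r k) x $ i\<bar> \<le> 2 * d 0"
          using component_le_norm_cart[of "\<phi> (r k) x" i] \<phi>d[of 0 "r k" x] p0(1)[of x] by simp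
        moreover have "\<bar>g x \<bullet> e\<bar> \<le> B * norm e"
          using Cauchy_Schwarz_ineq2[of "g x" e] B(2)[of x] mult_right_mono[of "norm (g x)" B "norm e"] by simp
        ultimately show ?thesis unfolding abs_mult using p(4)[of 0] by (intro mult_mono) auto
      qed
      then show "AE x in lebesgue. norm (\<phi> (r k) x $ i * (g x \<bullet> e)) \<le> 2 * d 0 * (B * norm e) * indicat_real K x" for k
        using K0 by (intro AE_I2) (auto simp: indicator_def)
    qed
    moreover have "(\<lambda>k. LINT x|lebesgue. (\<Phi> (r k) x $ i \<bullet> e) * \<psi> x) \<longlonglongrightarrow> (LINT x|lebesgue. (W x $ i \<bullet> e) * \<psi> x)"
    proof (rule integral_dominated_convergence[OF _ _ integrable_scaled_indicator[OF Kl, of "(M * norm e) * B'"]])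
      show "(\<lambda>x. (\<Phi> (r k) x $ i \<bullet> e) * \<psi> x) \<in> borel_measurable lebesgue" for k
        by (intro borel_measurable_lebesgue_continuous continuous_intros cont c\<psi>)
      have "(\<lambda>x. W x $ i \<bullet> e) \<in> borel_measurable lebesgue"
        using W_meas
        by (rule measurable_compose) (intro borel_measurable_continuous_onI continuous_intros)
      then show "(\<lambda>x. (W x $ i \<bullet> e) * \<psi> x) \<in> borel_measurable lebesgue"
        by (rule borel_measurable_times) (intro borel_measurable_lebesgue_continuous c\<psi>)
      show "AE x in lebesgue. (\<lambda>k. (\<Phi> (r k) x $ i \<bullet> e) * \<psi> x) \<longlonglongrightarrow> (W x $ i \<bullet> e) * \<psi> x"
        using Wlim by eventually_elim (intro tendsto_intros)
      have "\<bar>(\<Phi> (r k) x $ i \<bullet> e) * \<psi> x\<bar> \<le> (M * norm e) * B'" for k x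
      proof -
        have "\<bar>\<Phi> (r k) x $ i \<bullet> e\<bar> \<le> norm (\<Phi> (r k) x $ i) * norm e" by (rule Cauchy_Schwarz_ineq2)
        also have "\<dots> \<le> M * norm e"
          using Finite_Cartesian_Product.norm_nth_le[of "\<Phi> (r k) x" i] \<Phi>b(1)[of "r k" x] by (intro mult_right_mono) auto
        finally show ?thesis unfolding abs_mult using B'(2)[of x] C by (intro mult_mono) (auto simp: M_def)
      qed
      then show "AE x in lebesgue. norm ((\<Phi> (r k) x $ i \<bullet> e) * \<psi> x) \<le> M * norm e * B' * indicat_real K x" for k
        using K0 by (intro AE_I2) (auto simp: indicator_def)
    qed
    ultimately show ?thesis
      unfolding eq using LIMSEQ_unique tendsto_minus by blast
  qed
  have weak: "has_weak_gradient S \<phi>' W" if S: "\<Omega> \<subseteq> S" for S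
    unfolding has_weak_gradient_def
  proof (intro conjI allI impI)
    have m\<phi>: "\<phi>' \<in> borel_measurable lebesgue" by (rule borel_measurable_lebesgue_continuous[OF c\<phi>'])
    show "locally_integrable S \<phi>'" "locally_integrable S W"
      unfolding locally_integrable_def
      using set_integrable_bounded_compact[OF m\<phi>, of \<epsilon>] set_integrable_bounded_compact[OF W_meas Wb] b\<phi>' by auto
    fix \<psi> i j assume t: "test_function S \<psi>"
    obtain g K where g: "\<And>x. has_gradient \<psi> (g x) x" "continuous_on UNIV g"
      "compact K" "K \<subseteq> S" "\<And>x. x \<notin> K \<Longrightarrow> \<psi> x = 0" "\<And>x. x \<notin> K \<Longrightarrow> g x = 0"
      "\<And>x j. partial_deriv j \<psi> x = g x $ j"
      using t by (rule test_functionE) blast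
    have z: "\<phi>' x = 0" "W x = 0" if "x \<notin> S" for x using z\<phi>'[of x] W0[of x] that S by auto
    have "(LINT x:S|lebesgue. \<phi>' x $ i * partial_deriv j \<psi> x) = (LINT x|lebesgue. \<phi>' x $ i * (g x \<bullet> axis j 1))"
      unfolding set_lebesgue_integral_def
      by (intro Bochner_Integration.integral_cong) (auto simp: g(7) z indicator_def inner_axis)
    also have "\<dots> = - (LINT x|lebesgue. (W x $ i \<bullet> axis j 1) * \<psi> x)"
      by (rule ibp[OF g(1,2,3,5,6)])
    also have "(LINT x|lebesgue. (W x $ i \<bullet> axis j 1) * \<psi> x) = (LINT x:S|lebesgue. W x $ i $ j * \<psi> x)"
      unfolding set_lebesgue_integral_def
      by (intro Bochner_Integration.integral_cong) (auto simp: z indicator_def inner_axis)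
    finally show "(LINT x:S|lebesgue. \<phi>' x $ i * partial_deriv j \<psi> x) = - (LINT x:S|lebesgue. W x $ i $ j * \<psi> x)" .
  qed
  show ?thesis
    using c\<phi>' z\<phi>' b\<phi>' W_meas Wb Wtr Wdef weak by (intro that[of \<phi>' W M]) simp_all
qed

section \<open>Attainment\<close>

text \<open>A nonempty open set is not a null set: bounds that hold almost everywhere hold everywhere for continuous
  functions.\<close>

lemma AE_closed_imp_all:
  fixes f :: "'a::euclidean_space \<Rightarrow> 'b::topological_space"
  assumes \<Omega>: "open \<Omega>" and f: "continuous_on \<Omega> f" and S: "closed S"
    and ae: "AE x in lebesgue. x \<in> \<Omega> \<longrightarrow> f x \<in> S" and x: "x \<in> \<Omega>"
  shows "f x \<in> S"
proof (rule ccontr)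
  let ?V = "\<Omega> \<inter> f -` (- S)"
  assume "f x \<notin> S"
  then have "?V \<noteq> {}" using x by blast
  moreover have "open ?V"
    using f \<Omega> S by (simp add: continuous_on_open_vimage open_Compl Int_commute)
  moreover have "negligible ?V"
  proof -
    have "AE x in lebesgue. x \<notin> ?V" using ae by eventually_elim auto
    then show ?thesis
      using \<open>open ?V\<close> by (simp add: negligible_iff_null_sets AE_iff_null_sets)
  qed
  ultimately show False using open_not_negligible by blast
qed

lemma Linf_bounded:
  fixes f :: "real^2 \<Rightarrow> 'b::euclidean_space"
  assumes "f \<in> borel_measurable (lebesgue_on \<omega>)" and "AE x in lebesgue_on \<omega>. norm (f x) \<le> B"
  shows "f \<in> Linf \<omega>" and "Linf_norm \<omega> f \<le> ereal B"
proof -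
  have "(\<lambda>x. ereal (norm (f x))) \<in> borel_measurable (lebesgue_on \<omega>)"
    by (rule borel_measurable_ereal, rule measurable_compose[OF assms(1)])
      (intro borel_measurable_continuous_onI continuous_intros)
  then show "Linf_norm \<omega> f \<le> ereal B"
    unfolding Linf_norm_def using assms(2) by (intro esssup_I) auto
  also have "\<dots> < \<infinity>" by simp
  finally show "f \<in> Linf \<omega>" using assms(1) by (simp add: Linf_def)
qed

lemma continuous_on_closure_bounded:
  fixes f :: "'a::euclidean_space \<Rightarrow> 'b::euclidean_space"
  assumes "bounded S" and "continuous_on (closure S) f"
  obtains B where "B > 0" "\<And>x. x \<in> S \<Longrightarrow> norm (f x) \<le> B"
proof -
  have "bounded (f ` closure S)"
    using assms by (auto intro!: compact_imp_bounded compact_continuous_image)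
  then have "bounded (f ` S)" by (rule bounded_subset) (use closure_subset in blast)
  then show ?thesis using that unfolding bounded_pos by auto
qed

text \<open>The hypotheses on the trace and the strain, stated for an arbitrary weak gradient, turn into pointwise
  statements about \<open>G\<close> on \<open>\<Omega>\<close>; they say that \<open>G\<close> takes admissible values as soon as \<open>C\<close> exceeds the bound
  of \<open>G\<close>. The perturbation vanishes outside \<open>\<Omega>\<close>, hence on the boundary of \<open>\<omega>\<close>.\<close>

lemma attainment_for_C1_data:
  fixes v :: "real^2 \<Rightarrow> real^2"
  assumes \<omega>: "open \<omega>" "bounded \<omega>" and \<Omega>: "open \<Omega>" "\<Omega> \<subseteq> \<omega>" "negligible (\<omega> - \<Omega>)"
    and w: "continuous_on (closure \<omega>) w" "\<And>x. x \<in> \<omega> \<Longrightarrow> w x = v x"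
    and G: "continuous_on \<Omega> G" "\<And>x. x \<in> \<Omega> \<Longrightarrow> norm (G x) \<le> B" "B \<ge> 0"
    and weak: "has_weak_gradient \<omega> v (\<lambda>x. indicat_real \<Omega> x *\<^sub>R G x)"
    and tr: "AE x in lebesgue_on \<omega>. trace (weak_gradient \<omega> v x) = 0"
    and st: "Linf_norm \<omega> (strain \<omega> v) < ereal (3 / (2 * sqrt 2))"
    and \<epsilon>: "\<epsilon> > 0"
  shows "\<exists>u\<in>W1inf \<omega>.
           (AE x in lebesgue_on \<omega>. strain \<omega> u x \<in> Sym0 \<and> Vt (strain \<omega> u x) = 0) \<and>
           boundary_eq \<omega> u v \<and> Linf_norm \<omega> (\<lambda>x. u x - v x) \<le> ereal \<epsilon>"
proof -
  have \<omega>s: "\<omega> \<in> sets lebesgue" using \<omega>(1) by auto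
  have ae_iff: "(AE x in lebesgue_on \<omega>. P x) \<longleftrightarrow> (AE x in lebesgue. x \<in> \<omega> \<longrightarrow> P x)" for P
    using \<omega>s by (simp add: AE_restrict_space_iff)
  let ?G = "\<lambda>x. indicat_real \<Omega> x *\<^sub>R G x"
  have wg: "AE x in lebesgue. x \<in> \<Omega> \<longrightarrow> weak_gradient \<omega> v x = G x"
    using weak_gradient_eq_AE[OF \<omega>(1) weak]
  proof eventually_elim
    case (elim x)
    then show ?case using \<Omega>(2) by auto
  qed
  have tr0: "trace (G x) = 0" if "x \<in> \<Omega>" for x
  proof -
    have "AE x in lebesgue. x \<in> \<Omega> \<longrightarrow> trace (G x) \<in> {0}"
      using wg tr[unfolded ae_iff]
    proof eventually_elim
      case (elim x)
      then show ?case using \<Omega>(2) by auto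
    qed
    moreover have "continuous_on \<Omega> (\<lambda>x. trace (G x))"
      unfolding trace_def by (intro continuous_intros G(1))
    ultimately have "trace (G x) \<in> {0}"
      using AE_closed_imp_all[OF \<Omega>(1) _ closed_singleton _ that] by blast
    then show ?thesis by simp
  qed
  obtain c where c: "Linf_norm \<omega> (strain \<omega> v) < ereal c" "c < 3 / (2 * sqrt 2)"
    using ereal_dense2[OF st] by auto
  have ctG: "continuous_on \<Omega> (\<lambda>x. transpose (G x))"
    unfolding transpose_def by (intro continuous_on_vec_lambda continuous_intros G(1))
  have stb: "norm ((1/2) *\<^sub>R (G x + transpose (G x))) \<le> c" if "x \<in> \<Omega>" for x
  proof -
    have "AE x in lebesgue_on \<omega>. ereal (norm (strain \<omega> v x)) \<le> Linf_norm \<omega> (strain \<omega> v)"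
      unfolding Linf_norm_def by (rule esssup_AE)
    then have "AE x in lebesgue. x \<in> \<Omega> \<longrightarrow> norm ((1/2) *\<^sub>R (G x + transpose (G x))) \<in> {..c}"
      using wg unfolding ae_iff
    proof eventually_elim
      case (elim x)
      show ?case
      proof
        assume x: "x \<in> \<Omega>"
        then have "ereal (norm ((1/2) *\<^sub>R (G x + transpose (G x)))) \<le> Linf_norm \<omega> (strain \<omega> v)"
          using elim \<Omega>(2) by (auto simp: strain_def)
        with c(1) have "ereal (norm ((1/2) *\<^sub>R (G x + transpose (G x)))) < ereal c" by (rule le_less_trans[rotated])
        then show "norm ((1/2) *\<^sub>R (G x + transpose (G x))) \<in> {..c}" by simp
      qed
    qed
    moreover have "continuous_on \<Omega> (\<lambda>x. norm ((1/2) *\<^sub>R (G x + transpose (G x))))"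
      by (intro continuous_intros G(1) ctG)
    ultimately have "norm ((1/2) *\<^sub>R (G x + transpose (G x))) \<in> {..c}"
      using AE_closed_imp_all[OF \<Omega>(1) _ closed_atMost _ that] by blast
    then show ?thesis by simp
  qed
  define C where "C = B + 1"
  have adm: "G x \<in> admissible C" if x: "x \<in> \<Omega>" for x
  proof -
    have "2 * (cmod (dev (G x)))\<^sup>2 \<le> c\<^sup>2"
      using power_mono[OF stb[OF x] norm_ge_zero, of 2] norm_strain_sq[OF tr0[OF x]] by simp
    also have "c\<^sup>2 < (3 / (2 * sqrt 2))\<^sup>2"
      using c(2) stb[OF x] norm_ge_zero[of "(1/2) *\<^sub>R (G x + transpose (G x))"]
      by (intro power_strict_mono) linarith+
    also have "(3 / (2 * sqrt 2))\<^sup>2 = 2 * (3/4)\<^sup>2" by (simp add: power_divide power_mult_distrib power2_eq_square)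
    finally have "(cmod (dev (G x)))\<^sup>2 < (3/4)\<^sup>2" by simp
    then have "cmod (dev (G x)) < 3/4" by (rule power_less_imp_less_base) simp
    moreover have "\<bar>skw (G x)\<bar> \<le> B"
      using norm_matrix_nth_le[of "G x" 1 2] norm_matrix_nth_le[of "G x" 2 1] G(2)[OF x]
        abs_triangle_ineq4[of "G x $ 2 $ 1" "G x $ 1 $ 2"] by (simp add: skw_def)
    then have "\<bar>skw (G x)\<bar> < cmod (dev (G x)) + C"
      using norm_ge_zero[of "dev (G x)"] unfolding C_def by linarith
    ultimately show ?thesis by (simp add: admissible_def)
  qed
  have C: "C \<ge> 1" using G(3) by (simp add: C_def)
  have b\<Omega>: "bounded \<Omega>" using \<omega>(2) \<Omega>(2) by (rule bounded_subset)
  obtain \<phi> W M where \<phi>: "continuous_on UNIV \<phi>" "\<forall>x. x \<notin> \<Omega> \<longrightarrow> \<phi> x = 0" "\<forall>x. norm (\<phi> x) \<le> \<epsilon>"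
    and W: "W \<in> borel_measurable lebesgue" "AE x in lebesgue. norm (W x) \<le> M"
    "AE x in lebesgue. trace (W x) = 0" "AE x in lebesgue. x \<in> \<Omega> \<longrightarrow> deficit (G x + W x) = 0"
    and weak\<phi>: "\<forall>S. \<Omega> \<subseteq> S \<longrightarrow> has_weak_gradient S \<phi> W"
    by (rule exact_perturbation[OF \<Omega>(1) b\<Omega> G(1) adm tr0 C \<epsilon>])
  have m\<phi>: "\<phi> \<in> borel_measurable lebesgue" by (rule borel_measurable_lebesgue_continuous[OF \<phi>(1)])
  have z: "\<phi> x = 0" if "x \<notin> \<omega>" for x using \<phi>(2) that \<Omega>(2) by auto
  from has_weak_gradient_add[OF weak weak\<phi>[rule_format, OF \<Omega>(2)]]
  have wu: "has_weak_gradient \<omega> (\<lambda>x. v x + \<phi> x) (\<lambda>x. ?G x + W x)" .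
  let ?u = "\<lambda>x. v x + \<phi> x"
  have mG: "?G \<in> borel_measurable lebesgue" by (rule indicator_continuous_measurable[OF \<Omega>(1) G(1)])
  have mr: "f \<in> borel_measurable (lebesgue_on \<omega>)" if "f \<in> borel_measurable lebesgue" for f :: "real^2 \<Rightarrow> 'c::euclidean_space"
    using that by (rule measurable_restrict_space1)
  have cv: "continuous_on \<omega> v"
    using continuous_on_subset[OF w(1) closure_subset] w(2) by (simp cong: continuous_on_cong)
  then have mv: "v \<in> borel_measurable (lebesgue_on \<omega>)"
    by (rule continuous_imp_measurable_on_sets_lebesgue[OF _ \<omega>s])
  obtain Bw where "\<And>x. x \<in> \<omega> \<Longrightarrow> norm (w x) \<le> Bw"
    by (rule continuous_on_closure_bounded[OF \<omega>(2) w(1)]) blast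
  then have vb: "norm (v x) \<le> Bw" if "x \<in> \<omega>" for x using w(2)[OF that] that by metis
  have "?u \<in> Linf \<omega>"
  proof (rule Linf_bounded(1))
    show "?u \<in> borel_measurable (lebesgue_on \<omega>)" using mv mr[OF m\<phi>] by (rule borel_measurable_add)
    have "norm (?u x) \<le> Bw + \<epsilon>" if "x \<in> \<omega>" for x
      using norm_triangle_ineq[of "v x" "\<phi> x"] vb[OF that] \<phi>(3)[rule_format, of x] by linarith
    then show "AE x in lebesgue_on \<omega>. norm (?u x) \<le> Bw + \<epsilon>" unfolding ae_iff by auto
  qed
  moreover have "(\<lambda>x. ?G x + W x) \<in> Linf \<omega>"
  proof (rule Linf_bounded(1))
    show "(\<lambda>x. ?G x + W x) \<in> borel_measurable (lebesgue_on \<omega>)"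
      by (rule mr[OF borel_measurable_add[OF mG W(1)]])
    show "AE x in lebesgue_on \<omega>. norm (?G x + W x) \<le> B + M"
      unfolding ae_iff using W(2)
    proof eventually_elim
      case (elim x)
      have "norm (?G x) \<le> B" using G(2)[of x] G(3) by (auto simp: indicator_def)
      then show ?case using elim norm_triangle_ineq[of "?G x" "W x"] by linarith
    qed
  qed
  ultimately have "?u \<in> W1inf \<omega>" unfolding W1inf_def using wu by blast
  moreover have "AE x in lebesgue_on \<omega>. strain \<omega> ?u x \<in> Sym0 \<and> Vt (strain \<omega> ?u x) = 0"
  proof -
    have "AE x in lebesgue. x \<notin> \<omega> - \<Omega>"
      using \<Omega>(3) by (intro AE_not_in) (simp add: negligible_iff_null_sets)
    then show ?thesis
      unfolding ae_iff using weak_gradient_eq_AE[OF \<omega>(1) wu] W(3,4)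
    proof eventually_elim
      case (elim x)
      show ?case
      proof
        assume "x \<in> \<omega>"
        then have x: "x \<in> \<Omega>" using elim(1) by blast
        let ?A = "G x + W x"
        have "weak_gradient \<omega> ?u x = ?A" using elim(2) \<open>x \<in> \<omega>\<close> x by simp
        then have s: "strain \<omega> ?u x = (1/2) *\<^sub>R (?A + transpose ?A)" by (simp only: strain_def)
        have t: "trace ?A = 0" using elim(3) tr0[OF x] by (simp add: trace_add)
        moreover have "cmod (dev ?A) = 3/4" using elim(4) x by (simp add: deficit_def)
        ultimately show "strain \<omega> ?u x \<in> Sym0 \<and> Vt (strain \<omega> ?u x) = 0"
          unfolding s using strain_in_Sym0 strain_in_Uset Vt_eq_0 by blast
      qed
    qed
  qed
  moreover have "boundary_eq \<omega> ?u v"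
    unfolding boundary_eq_def ae_iff
  proof (intro exI conjI)
    show "continuous_on (closure \<omega>) (\<lambda>x. w x + \<phi> x)"
      by (intro continuous_intros w(1) continuous_on_subset[OF \<phi>(1)]) auto
    show "\<forall>x\<in>frontier \<omega>. w x + \<phi> x = w x"
      using z \<omega>(1) by (auto simp: frontier_def interior_open)
  qed (use w in auto)
  moreover have "Linf_norm \<omega> (\<lambda>x. ?u x - v x) \<le> ereal \<epsilon>"
    using Linf_bounded(2)[OF mr[OF m\<phi>], of \<epsilon>] \<phi>(3) by simp
  ultimately show ?thesis by blast
qed

lemma matrix_norm_le_if_affine_lipschitz:
  fixes v :: "real^2 \<Rightarrow> real^2" and A :: "real^2^2"
  assumes aff: "\<And>y. y \<in> W \<Longrightarrow> v y = A *v y + b" and lip: "L-lipschitz_on W v" and W: "open W" "x \<in> W"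
  shows "norm A \<le> 4 * L"
proof -
  obtain r where r: "r > 0" "cball x r \<subseteq> W" using W open_contains_cball by blast
  have ent: "\<bar>A $ i $ j\<bar> \<le> L" for i j
  proof -
    let ?y = "x + r *\<^sub>R axis j 1"
    have "?y \<in> W" using r by (auto simp: dist_norm norm_axis_1)
    then have "r * norm (A *v axis j 1) \<le> L * r"
      using lipschitz_onD[OF lip \<open>?y \<in> W\<close> W(2)] aff W(2) r(1)
      by (simp add: dist_norm norm_axis_1 matrix_vector_right_distrib matrix_vector_mult_scaleR)
    then have "norm (A *v axis j 1) \<le> L" using r(1) by (simp add: mult.commute)
    moreover have "(A *v axis j 1) $ i = A $ i $ j"
      by (simp add: matrix_vector_mul_component inner_axis)
    ultimately show ?thesis
      using component_le_norm_cart[of "A *v axis j 1" i] by simp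
  qed
  show ?thesis
    using norm_matrix_le_entries[of A] ent[of 1 1] ent[of 1 2] ent[of 2 1] ent[of 2 2] by linarith
qed

theorem theorem3p6:
  fixes \<omega> :: "(real^2) set" and v :: "real^2 \<Rightarrow> real^2"
  assumes "lipschitz_domain \<omega>" and "bounded \<omega>"
    and "(piecewise_affine \<omega> v \<and> (\<exists>L. L-lipschitz_on \<omega> v))
         \<or> (\<exists>\<alpha>. 0 < \<alpha> \<and> \<alpha> < 1 \<and> C1_holder \<omega> \<alpha> v)"
    and "AE x in lebesgue_on \<omega>. trace (weak_gradient \<omega> v x) = 0"
    and "Linf_norm \<omega> (strain \<omega> v) < ereal (3 / (2 * sqrt 2))"
  shows "\<forall>\<epsilon>>0. \<exists>u\<in>W1inf \<omega>.
           (AE x in lebesgue_on \<omega>. strain \<omega> u x \<in> Sym0 \<and> Vt (strain \<omega> u x) = 0) \<and>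
           boundary_eq \<omega> u v \<and>
           Linf_norm \<omega> (\<lambda>x. u x - v x) \<le> ereal \<epsilon>"
proof (intro allI impI)
  fix \<epsilon> :: real assume \<epsilon>: "\<epsilon> > 0"
  have \<omega>: "open \<omega>" "bounded \<omega>" using assms(1,2) by (auto simp: lipschitz_domain_def)
  from assms(3) show "\<exists>u\<in>W1inf \<omega>.
           (AE x in lebesgue_on \<omega>. strain \<omega> u x \<in> Sym0 \<and> Vt (strain \<omega> u x) = 0) \<and>
           boundary_eq \<omega> u v \<and> Linf_norm \<omega> (\<lambda>x. u x - v x) \<le> ereal \<epsilon>"
  proof (elim disjE conjE exE)
    fix L assume pa: "piecewise_affine \<omega> v" and L: "L-lipschitz_on \<omega> v"
    obtain P where P': "\<forall>W\<in>P. lipschitz_domain W \<and> W \<subseteq> \<omega>"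
      "\<forall>W\<in>P. \<exists>A b. \<forall>x\<in>W. v x = A *v x + b" "negligible (\<omega> - \<Union>P)"
      using pa unfolding piecewise_affine_def by (elim conjE exE) (rule that)
    note P = P'(1)[rule_format] P'(2)[THEN bspec] P'(3)
    have oP: "open W" if "W \<in> P" for W using P(1)[OF that] by (simp add: lipschitz_domain_def)
    define G where "G x = matrix (frechet_derivative v (at x))" for x
    have G: "(v has_derivative (\<lambda>h. A *v h)) (at x) \<and> G x = A"
      if "W \<in> P" "\<forall>x\<in>W. v x = A *v x + b" "x \<in> W" for W A b x
    proof -
      have "((\<lambda>y. A *v y + b) has_derivative (\<lambda>h. A *v h + 0)) (at x)"
        by (intro has_derivative_add has_derivative_const bounded_linear_imp_has_derivative matrix_vector_mul_bounded_linear)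
      then have d: "(v has_derivative (\<lambda>h. A *v h)) (at x)"
        unfolding add_0_right
        by (rule has_derivative_transform_within_open[OF _ oP[OF that(1)] that(3)]) (use that(2) in auto)
      then have "frechet_derivative v (at x) = (\<lambda>h. A *v h)" by (rule frechet_derivative_at[symmetric])
      with d show ?thesis by (simp add: G_def)
    qed
    have der: "(v has_derivative (\<lambda>h. G x *v h)) (at x)" if x: "x \<in> \<Union>P" for x
    proof -
      obtain W A b where "W \<in> P" "x \<in> W" "\<forall>x\<in>W. v x = A *v x + b" using x P(2) by blast
      with G[of W A b x] show ?thesis by simp
    qed
    have cG: "continuous_on (\<Union>P) G"
    proof (rule continuous_on_open_Union)
      fix W assume W: "W \<in> P"
      then obtain A b where "\<forall>x\<in>W. v x = A *v x + b" using P(2) by blast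
      then have "G x = A" if "x \<in> W" for x using G[OF W] that by blast
      then show "continuous_on W G" by (simp cong: continuous_on_cong)
    qed (rule oP)
    have sub: "\<Union>P \<subseteq> \<omega>" using P(1) by blast
    have bG: "norm (G x) \<le> 4 * L" if x: "x \<in> \<Union>P" for x
    proof -
      obtain W A b where W: "W \<in> P" "x \<in> W" "\<forall>x\<in>W. v x = A *v x + b" using x P(2) by blast
      have "L-lipschitz_on W v" using L P(1)[OF W(1)] lipschitz_on_subset by blast
      then show ?thesis
        using matrix_norm_le_if_affine_lipschitz[OF _ _ oP[OF W(1)] W(2), of v A b L] G[OF W(1,3,2)] W(3) by simp
    qed
    obtain w where w: "continuous_on (closure \<omega>) w" "\<And>x. x \<in> \<omega> \<Longrightarrow> v x = w x"
      using uniformly_continuous_on_extension_on_closure[OF lipschitz_on_uniformly_continuous[OF L]]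
        uniformly_continuous_imp_continuous by metis
    obtain Bw where "\<And>x. x \<in> \<omega> \<Longrightarrow> norm (w x) \<le> Bw"
      by (rule continuous_on_closure_bounded[OF \<omega>(2) w(1)]) blast
    then have vb: "norm (v x) \<le> Bw" if "x \<in> \<omega>" for x using w(2)[OF that] that by metis
    have oU: "open (\<Union>P)" using oP by blast
    have "has_weak_gradient \<omega> v (\<lambda>x. indicat_real (\<Union>P) x *\<^sub>R G x)"
      by (rule has_weak_gradient_classical[OF \<omega>(1) oU sub P(3) lipschitz_on_continuous_on[OF L] cG bG der
          lipschitz_product_if_lipschitz[OF _ L vb]])
    then show ?thesis
      using w lipschitz_on_nonneg[OF L] assms(4,5)
      by (intro attainment_for_C1_data[OF \<omega> oU sub P(3) w(1) _ cG bG _ _ _ _ \<epsilon>]) auto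
  next
    fix \<alpha> assume "C1_holder \<omega> \<alpha> v"
    then obtain w G where w: "continuous_on (closure \<omega>) w" "continuous_on (closure \<omega>) G"
      "\<And>x. x \<in> \<omega> \<Longrightarrow> w x = v x" and der: "\<And>x. x \<in> \<omega> \<Longrightarrow> (v has_derivative (\<lambda>h. G x *v h)) (at x)"
      unfolding C1_holder_def by blast
    have cG: "continuous_on \<omega> G" and cw: "continuous_on \<omega> w"
      by (rule continuous_on_subset[OF _ closure_subset], fact)+
    then have cv: "continuous_on \<omega> v" using w(3) by (simp cong: continuous_on_cong)
    obtain B1 where "\<And>x. x \<in> \<omega> \<Longrightarrow> norm (w x) \<le> B1"
      by (rule continuous_on_closure_bounded[OF \<omega>(2) w(1)]) blast
    then have vb: "norm (v x) \<le> B1" if "x \<in> \<omega>" for x using w(3)[OF that] that by metis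
    obtain B2 where B: "B2 > 0" and Gb: "\<And>x. x \<in> \<omega> \<Longrightarrow> norm (G x) \<le> B2"
      by (rule continuous_on_closure_bounded[OF \<omega>(2) w(2)]) blast
    have "has_weak_gradient \<omega> v (\<lambda>x. indicat_real \<omega> x *\<^sub>R G x)"
      by (rule has_weak_gradient_classical[OF \<omega>(1) \<omega>(1) order_refl _ cv cG Gb der
          lipschitz_product_if_C1[OF _ \<omega>(1) vb Gb der]]) auto
    then show ?thesis
      using w B assms(4,5)
      by (intro attainment_for_C1_data[OF \<omega> \<omega>(1) order_refl _ w(1) _ cG Gb _ _ _ _ \<epsilon>]) auto
  qed
qed

end
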